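(* Consider the problem of minimizing $F=f+\psi$ and the Contracting Proximal Tensor Method as in the context, with $\sigma_d(\psi)>0$, and let $$\omega=\min\Bigl\{\Bigl(\frac{\sigma_d(\psi)\,p!}{L_p(f)(p+1)2^{p-1}}\Bigr)^{\frac1{p+1}},\ \frac12\Bigr\}.$$ For a given $\varepsilon>0$, let the inner accuracy be fixed as $$\delta=\Bigl(\frac{p!\,\varepsilon}{L_p(f)}\Bigr)^{\frac p{p+1}}\frac{\gamma_0\,p\,\omega}{2^p(p+1)^{((p+1)^2+1)/(p+1)}}.$$ Then, in order to achieve $F(x_K)-F^*\le\varepsilon$, it is enough to perform $$K=\Bigl\lfloor2+\frac1\omega\mathcal{L}\Bigr\rfloor$$ iterations of the method, where $$\mathcal{L}=\log\Bigl(\max\Bigl\{\frac{(p+1)^p}{\omega^{p+1}},\ \frac{L_p(f)\,\beta_d(x_0;x^* )(p+1)^{p+1}2^{p+\frac1p}}{p!\,\varepsilon}\Bigr\}\Bigr).$$ The total number of oracle calls $N_K=\sum_{k=0}^{K-1}t_k$ (the total number of inner tensor steps in these $K$ iterations) is bounded as $$N_K\le K\cdot\Biggl(3+\Bigl(1+\frac e{(e-1)p}\Bigr)\bigl(1+\mathcal{L}\bigr)+\log\Bigl(\max\Bigl\{1,\Bigl(\frac{4\sigma_d(\psi)\,p!}{(p+1)L_p(f)}\Bigr)^{\frac1p}\Bigr\}\cdot\Bigl(1+\frac1{\gamma_0}\Bigr)\cdot\frac{(p+1)^{\frac{p+2}p}}{p^{\frac{p+1}p}}\cdot2^{\frac{2p^2+p+4}p}\Bigr)\Biggr),$$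 where $e=\exp(1)$.
   Context: $\mathbb{E}$ is a finite-dimensional real vector space with Euclidean norm $\|x\|=\langle Bx,x\rangle^{1/2}$, where $B:\mathbb{E}\to\mathbb{E}^*$ is a fixed symmetric positive-definite linear operator; $\|s\|_*=\sup\{\langle s,h\rangle:\|h\|\le1\}$ on $\mathbb{E}^*$; the norm of a $p$-linear symmetric form is $\|D\|=\sup\{D[h_1,\dots,h_p]:\|h_i\|\le1\}$. Problem: minimize $F=f+\psi$, where $f$ is convex and differentiable (at least $p$ times) on its open domain, $\psi:\mathbb{E}\to\mathbb{R}\cup\{+\infty\}$ is proper closed convex, $\operatorname{dom}\psi\subset\operatorname{dom}f$; a solution $x^*$ exists and $F^*=F(x^* )$. For a fixed integer $p\ge1$, $\|D^pf(x)-D^pf(y)\|\le L_p(f)\|x-y\|$ for $x,y\in\operatorname{dom}f$, with $0<L_p(f)<+\infty$. Let $d(x)=\frac1{p+1}\|x-x_0\|^{p+1}$ and $\beta_d(x;y)=d(y)-d(x)-\langle\nabla d(x),y-x\rangle$. The constant $\sigma_d(\psi)>0$ is such that $\psi(y)-\psi(x)-\langle\psi'(x),y-x\rangle\ge\sigma_d(\psi)\beta_d(x;y)$ for all $x,y\in\operatorname{dom}\psi$, $\psi'(x)\in\partial\psi(x)$. Tensor step: for $h=g+\phi$ with $g$ smooth convex and $\phi$ closed convex, with $\Omega_p(g,x;y)=g(x)+\sum_{i=1}^p\frac1{i!}D^ig(x)[y-x]^i$, $$T_M(h;x)=\operatorname*{argmin}_{y\in\mathbb{E}}\Bigl\{\Omega_p(g,x;y)+\frac{M}{(p+1)!}\|y-x\|^{p+1}+\phi(y)\Bigr\},$$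 and for $T=T_M(h;x)$, $h'(T)=\nabla g(T)-\nabla_y\Omega_p(g,x;T)-\frac M{p!}\|T-x\|^{p-1}B(T-x)\in\partial h(T)$. Contracting Proximal Tensor Method (case $\sigma_d(\psi)>0$). Choose $x_0\in\operatorname{dom}F$, inner accuracy $\delta>0$, $\gamma_0>0$. Set $v_0=x_0$, $A_0=0$, $c=\frac{p!\,\gamma_0}{2^{p-1}(p+1)^{p+2}L_p(f)}$, and $\omega$ as in the claim. For $k\ge0$: (1) if $k=0$, $a_1=c(p+1)$; if $k\ge1$, $a_{k+1}=\omega(1-\omega)^{-1}A_k$; (2) $A_{k+1}=A_k+a_{k+1}$; (3) $g_{k+1}(x)=A_{k+1}f\bigl(\frac{a_{k+1}x+A_kx_k}{A_{k+1}}\bigr)$, $\phi_{k+1}(x)=a_{k+1}\psi(x)+\gamma_k\beta_d(v_k;x)$, $h_{k+1}=g_{k+1}+\phi_{k+1}$; (4) set $z_0=v_k$, $t_k=0$, $M=pL_p(f)\frac{a_{k+1}^{p+1}}{A_{k+1}^p}$; repeat $z_{t_k+1}=T_M(h_{k+1};z_{t_k})$, $t_k:=t_k+1$ until $\|h_{k+1}'(z_{t_k})\|_*\le\delta$; set $v_{k+1}=z_{t_k}$ (so $t_k$ is the final number of inner tensor steps at iteration $k$); (5) $x_{k+1}=\frac{a_{k+1}v_{k+1}+A_kx_k}{A_{k+1}}$; (6) $\gamma_{k+1}=\gamma_k+a_{k+1}\sigma_d(\psi)$. One oracle call is one tensor step. *)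

theory Defs
  imports "HOL-Analysis.Analysis"
begin

text \<open>
  The space is a type of class \<open>euclidean_space\<close>, of which only the vector space structure and
  the topology (unique in finite dimension) are used. The geometry comes from a
  separate symmetric positive definite operator \<open>B\<close> from the space to its dual, where a
  functional is a linear map to the reals, so that \<open>B x h\<close> is the pairing of \<open>B x\<close> with \<open>h\<close>.
\<close>

definition spd_operator :: "('a::real_vector \<Rightarrow> 'a \<Rightarrow> real) \<Rightarrow> bool" where
  "spd_operator B \<longleftrightarrow>
     bilinear B \<and> (\<forall>x y. B x y = B y x) \<and> (\<forall>x. x \<noteq> 0 \<longrightarrow> B x x > 0)"

definition bnorm :: "('a::real_vector \<Rightarrow> 'a \<Rightarrow> real) \<Rightarrow> 'a \<Rightarrow> real" where
  "bnorm B x = sqrt (B x x)"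

definition dual_norm :: "('a::real_vector \<Rightarrow> 'a \<Rightarrow> real) \<Rightarrow> ('a \<Rightarrow> real) \<Rightarrow> real" where
  "dual_norm B s = (SUP h\<in>{h. bnorm B h \<le> 1}. s h)"

text \<open>A \<open>p\<close>-linear form takes the list of its \<open>p\<close> arguments.\<close>

definition form_norm ::
    "('a::real_vector \<Rightarrow> 'a \<Rightarrow> real) \<Rightarrow> nat \<Rightarrow> ('a list \<Rightarrow> real) \<Rightarrow> real" where
  "form_norm B p W =
     (SUP hs\<in>{hs. length hs = p \<and> (\<forall>h\<in>set hs. bnorm B h \<le> 1)}. W hs)"

text \<open>
  \<open>nderiv g [h\<^sub>1, \<dots>, h\<^sub>i] x\<close> is the \<open>i\<close>-th derivative of \<open>g\<close> at \<open>x\<close> in the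
  directions \<open>h\<^sub>1, \<dots>, h\<^sub>i\<close>. In finite dimension the \<open>i\<close>-th derivative, as a map into the
  \<open>i\<close>-linear forms, is Frechet differentiable iff its value at each fixed list of directions
  is; this is what \<open>times_differentiable_on\<close> asks for, on an open set.
\<close>

primrec nderiv :: "('a::real_normed_vector \<Rightarrow> real) \<Rightarrow> 'a list \<Rightarrow> 'a \<Rightarrow> real" where
  "nderiv g [] = g"
| "nderiv g (h # hs) = (\<lambda>x. frechet_derivative (nderiv g hs) (at x) h)"

definition times_differentiable_on ::
    "nat \<Rightarrow> ('a::real_normed_vector \<Rightarrow> real) \<Rightarrow> 'a set \<Rightarrow> bool" where
  "times_differentiable_on p g S \<longleftrightarrow>
     (\<forall>hs. length hs < p \<longrightarrow> (\<forall>x\<in>S. nderiv g hs differentiable (at x)))"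

definition edom :: "('a \<Rightarrow> ereal) \<Rightarrow> 'a set" where
  "edom \<psi> = {x. \<psi> x < \<infinity>}"

definition epi :: "('a \<Rightarrow> ereal) \<Rightarrow> ('a \<times> real) set" where
  "epi \<psi> = {(x, r). \<psi> x \<le> ereal r}"

definition proper_closed_convex :: "('a::real_normed_vector \<Rightarrow> ereal) \<Rightarrow> bool" where
  "proper_closed_convex \<psi> \<longleftrightarrow>
     (\<forall>x. \<psi> x \<noteq> -\<infinity>) \<and> edom \<psi> \<noteq> {} \<and> closed (epi \<psi>) \<and> convex (epi \<psi>)"

definition subdifferential ::
    "('a::real_vector \<Rightarrow> ereal) \<Rightarrow> 'a \<Rightarrow> ('a \<Rightarrow> real) set" where
  "subdifferential \<psi> x = {s. linear s \<and> (\<forall>y. \<psi> x + ereal (s (y - x)) \<le> \<psi> y)}"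

text \<open>
  The smooth part is a real function \<open>f\<close>, meaningful on its open domain only. As the
  domain of \<open>\<psi>\<close> is contained in it, the sum is \<open>\<infinity>\<close> wherever \<open>f\<close> is not defined.
\<close>

definition composite :: "('a \<Rightarrow> real) \<Rightarrow> ('a \<Rightarrow> ereal) \<Rightarrow> 'a \<Rightarrow> ereal" where
  "composite f \<psi> x = ereal (f x) + \<psi> x"

definition prox_fun ::
    "('a::real_vector \<Rightarrow> 'a \<Rightarrow> real) \<Rightarrow> nat \<Rightarrow> 'a \<Rightarrow> 'a \<Rightarrow> real" where
  "prox_fun B p x0 x = bnorm B (x - x0) ^ (p + 1) / real (p + 1)"

definition bregman :: "('a::real_normed_vector \<Rightarrow> real) \<Rightarrow> 'a \<Rightarrow> 'a \<Rightarrow> real" where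
  "bregman d x y = d y - d x - frechet_derivative d (at x) (y - x)"

definition relatively_strongly_convex ::
    "('a::real_normed_vector \<Rightarrow> real) \<Rightarrow> real \<Rightarrow> ('a \<Rightarrow> ereal) \<Rightarrow> bool" where
  "relatively_strongly_convex d \<sigma> \<psi> \<longleftrightarrow>
     (\<forall>x\<in>edom \<psi>. \<forall>y\<in>edom \<psi>. \<forall>s\<in>subdifferential \<psi> x.
        real_of_ereal (\<psi> y) - real_of_ereal (\<psi> x) - s (y - x) \<ge> \<sigma> * bregman d x y)"

definition taylor :: "nat \<Rightarrow> ('a::real_normed_vector \<Rightarrow> real) \<Rightarrow> 'a \<Rightarrow> 'a \<Rightarrow> real" where
  "taylor p g x y = g x + (\<Sum>i=1..p. nderiv g (replicate i (y - x)) x / fact i)"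

definition tensor_model ::
    "('a::real_normed_vector \<Rightarrow> 'a \<Rightarrow> real) \<Rightarrow> nat \<Rightarrow> real \<Rightarrow> ('a \<Rightarrow> real) \<Rightarrow> ('a \<Rightarrow> ereal)
      \<Rightarrow> 'a \<Rightarrow> 'a \<Rightarrow> ereal" where
  "tensor_model B p M g \<phi> x y =
     ereal (taylor p g x y + M / fact (p + 1) * bnorm B (y - x) ^ (p + 1)) + \<phi> y"

definition tensor_step ::
    "('a::real_normed_vector \<Rightarrow> 'a \<Rightarrow> real) \<Rightarrow> nat \<Rightarrow> real \<Rightarrow> ('a \<Rightarrow> real) \<Rightarrow> ('a \<Rightarrow> ereal)
      \<Rightarrow> 'a \<Rightarrow> 'a" where
  "tensor_step B p M g \<phi> x = arg_min (tensor_model B p M g \<phi> x) (\<lambda>_. True)"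

text \<open>The subgradient of \<open>g + \<phi>\<close> at the point \<open>T\<close> produced by a tensor step from \<open>x\<close>.\<close>

definition tensor_subgrad ::
    "('a::real_normed_vector \<Rightarrow> 'a \<Rightarrow> real) \<Rightarrow> nat \<Rightarrow> real \<Rightarrow> ('a \<Rightarrow> real)
      \<Rightarrow> 'a \<Rightarrow> 'a \<Rightarrow> ('a \<Rightarrow> real)" where
  "tensor_subgrad B p M g x T =
     (\<lambda>h. frechet_derivative g (at T) h - frechet_derivative (taylor p g x) (at T) h
          - M / fact p * bnorm B (T - x) ^ (p - 1) * B (T - x) h)"

text \<open>
  The contracted smooth part and the composite part of the subproblem of one iteration,
  with the coefficients \<open>a\<close> and \<open>A\<close> before the update of \<open>A\<close>.
\<close>

definition sub_smooth ::
    "('a::real_vector \<Rightarrow> real) \<Rightarrow> real \<Rightarrow> real \<Rightarrow> 'a \<Rightarrow> 'a \<Rightarrow> real" where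
  "sub_smooth f a A xk x = (A + a) * f ((1 / (A + a)) *\<^sub>R (a *\<^sub>R x + A *\<^sub>R xk))"

definition sub_composite ::
    "('a::real_normed_vector \<Rightarrow> real) \<Rightarrow> ('a \<Rightarrow> ereal) \<Rightarrow> real \<Rightarrow> real \<Rightarrow> 'a
      \<Rightarrow> 'a \<Rightarrow> ereal" where
  "sub_composite d \<psi> a \<gamma> v x = ereal a * \<psi> x + ereal (\<gamma> * bregman d v x)"

definition sub_reg :: "nat \<Rightarrow> real \<Rightarrow> real \<Rightarrow> real \<Rightarrow> real" where
  "sub_reg p L a A = real p * L * (a ^ (p + 1) / (A + a) ^ p)"

definition inner_stop ::
    "('a::real_normed_vector \<Rightarrow> 'a \<Rightarrow> real) \<Rightarrow> nat \<Rightarrow> real \<Rightarrow> ('a \<Rightarrow> real) \<Rightarrow> real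
      \<Rightarrow> (nat \<Rightarrow> 'a) \<Rightarrow> nat \<Rightarrow> bool" where
  "inner_stop B p M g \<delta> z j \<longleftrightarrow>
     1 \<le> j \<and> dual_norm B (tensor_subgrad B p M g (z (j - 1)) (z j)) \<le> \<delta>"

text \<open>
  The equations determine all the sequences (except \<open>a 0\<close>, which is not used). The inner
  iterates \<open>z k j\<close> of iteration \<open>k\<close> are continued past the stopping test, and \<open>t k\<close> is
  the first index that passes it. If no index did, \<open>t k\<close> would be unspecified, so termination
  of the inner loops is not part of this definition and has to be claimed separately.
\<close>

definition contracting_prox_tensor_method ::
    "('a::real_normed_vector \<Rightarrow> 'a \<Rightarrow> real) \<Rightarrow> nat \<Rightarrow> ('a \<Rightarrow> real) \<Rightarrow> ('a \<Rightarrow> ereal)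
      \<Rightarrow> real \<Rightarrow> real \<Rightarrow> 'a \<Rightarrow> real \<Rightarrow> real \<Rightarrow> real
      \<Rightarrow> (nat \<Rightarrow> 'a) \<Rightarrow> (nat \<Rightarrow> 'a) \<Rightarrow> (nat \<Rightarrow> real) \<Rightarrow> (nat \<Rightarrow> real) \<Rightarrow> (nat \<Rightarrow> real)
      \<Rightarrow> (nat \<Rightarrow> nat \<Rightarrow> 'a) \<Rightarrow> (nat \<Rightarrow> nat) \<Rightarrow> bool" where
  "contracting_prox_tensor_method B p f \<psi> L \<sigma> x0 \<delta> \<gamma>0 \<omega> x v a A \<gamma> z t \<longleftrightarrow>
     (let c = fact p * \<gamma>0 / (2 ^ (p - 1) * real (p + 1) ^ (p + 2) * L);
          g = (\<lambda>k. sub_smooth f (a (Suc k)) (A k) (x k));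
          \<phi> = (\<lambda>k. sub_composite (prox_fun B p x0) \<psi> (a (Suc k)) (\<gamma> k) (v k));
          M = (\<lambda>k. sub_reg p L (a (Suc k)) (A k))
      in x 0 = x0 \<and> v 0 = x0 \<and> A 0 = 0 \<and> \<gamma> 0 = \<gamma>0 \<and>
         (\<forall>k.
            a (Suc k) = (if k = 0 then c * real (p + 1) else \<omega> / (1 - \<omega>) * A k) \<and>
            A (Suc k) = A k + a (Suc k) \<and>
            z k 0 = v k \<and>
            (\<forall>j. z k (Suc j) = tensor_step B p (M k) (g k) (\<phi> k) (z k j)) \<and>
            t k = (LEAST j. inner_stop B p (M k) (g k) \<delta> (z k) j) \<and>
            v (Suc k) = z k (t k) \<and>
            x (Suc k) = (1 / A (Suc k)) *\<^sub>R (a (Suc k) *\<^sub>R v (Suc k) + A k *\<^sub>R x k) \<and>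
            \<gamma> (Suc k) = \<gamma> k + a (Suc k) * \<sigma>))"

end

theory Submission
  imports Defs
begin

text \<open>
  Two independent estimates carry the proof: the inner loops converge linearly with a rate that
  depends on \<open>p\<close> only, and the outer loop has a potential that barely grows.

  Inner loop. The subproblem of iteration \<open>k\<close> is \<open>h = g + \<phi>\<close>, where the \<open>p\<close>-th derivative of the
  contracted function \<open>g\<close> has the Lipschitz constant \<open>L a\<^bsup>p+1\<^esup> / A\<^sup>p\<close> and \<open>\<phi>\<close> is uniformly convex of
  degree \<open>p + 1\<close>, because the Bregman distance of the prox-function is (\<open>bregman_ge\<close>). The choice of
  \<open>\<omega>\<close> makes the second constant dominate the first (\<open>well_conditioned\<close>). Let \<open>T\<close> be the tensor
  step from \<open>x\<close>. Its optimality condition gives a subgradient of \<open>h\<close> at \<open>T\<close> and strong convexity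
  of \<open>h\<close> along it (\<open>step_strong_convexity\<close>). Taylor's theorem shows that this subgradient is
  close to a multiple of \<open>B (x - T)\<close>, hence its pairing with \<open>x - T\<close> is at least the \<open>(p+1)/p\<close>-th power of its norm, up to a constant
  (\<open>grad_estimates\<close>). So a step that ends with a large gradient has decreased \<open>h\<close> a lot, and a small
  gradient means a small residual: the residual shrinks by the factor \<open>p / (2 p + 2)\<close>. For large \<open>p\<close>
  it is better to compare the model with a point between \<open>x\<close> and the minimizer, which gives
  \<open>1/3 + (2/3)\<^bsup>p+1\<^esup>\<close>. The better of the two is at most \<open>exp (- inner_rate p)\<close>.

  Outer loop. The potential \<open>A\<^sub>k (F x\<^sub>k - F\<^sup>*) + \<gamma>\<^sub>k \<beta> v\<^sub>k x\<^sup>*\<close> increases in one iteration by at most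
  \<open>\<delta>\<close> times the distance of \<open>v\<close> from the solution (\<open>iterate_step\<close>). That distance is at most a
  constant times the \<open>(p+1)\<close>-st root of the new potential, so the \<open>p/(p+1)\<close>-th power of the
  potential grows linearly in \<open>k\<close> (\<open>energy_growth\<close>), and \<open>\<delta>\<close> is such that the potential
  stays below \<open>\<epsilon> A\<^sub>1 exp (max \<L> (\<omega> (k - 1)))\<close> (\<open>energy_bound\<close>). Since \<open>A\<^sub>K\<close> is at least \<open>A\<^sub>1 exp (\<omega> (K - 1))\<close>, this
  gives the bound on the objective.

  Counting. The same potential bounds the distance from \<open>v\<^sub>k\<close> to the solution of the subproblem
  (\<open>exact_solution\<close>), thus the residual after the first tensor step, and the number of further
  steps is the logarithm of its quotient by the residual that forces the test to succeed,
  divided by the rate (\<open>inner_steps_le\<close>). That logarithm is \<open>\<L> + k ln (1 / (1 - \<omega>)) / p\<close> up to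
  constants; its average over \<open>k < K\<close> is at most \<open>(1 + ln 2 / p) \<L>\<close> up to constants, and the rate is
  chosen such that the quotient has the coefficient \<open>1 + e / ((e - 1) p)\<close>.
\<close>

section \<open>The norm of a symmetric positive definite operator\<close>

locale spd_geometry =
  fixes B :: "'a::euclidean_space \<Rightarrow> 'a \<Rightarrow> real"
  assumes spd: "spd_operator B"
begin

lemma bilinear_B: "bilinear B"
  and B_commute: "B x y = B y x"
  and B_pos: "x \<noteq> 0 \<Longrightarrow> B x x > 0"
  using spd by (auto simp: spd_operator_def)

lemma B_add_left [simp]: "B (x + y) w = B x w + B y w"
  and B_add_right [simp]: "B w (x + y) = B w x + B w y"
  and B_diff_left [simp]: "B (x - y) w = B x w - B y w"
  and B_diff_right [simp]: "B w (x - y) = B w x - B w y"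
  and B_scale_left [simp]: "B (c *\<^sub>R x) w = c * B x w"
  and B_scale_right [simp]: "B w (c *\<^sub>R x) = c * B w x"
  and B_zero_left [simp]: "B 0 w = 0"
  and B_zero_right [simp]: "B w 0 = 0"
  and B_minus_left [simp]: "B (- x) w = - B x w"
  and B_minus_right [simp]: "B w (- x) = - B w x"
  using bilinear_B
  by (auto simp: bilinear_ladd bilinear_radd bilinear_lsub bilinear_rsub bilinear_lmul
      bilinear_rmul bilinear_lzero bilinear_rzero bilinear_lneg bilinear_rneg)

lemma linear_B: "linear (B x)"
  using bilinear_B by (simp add: bilinear_def)

lemma bounded_bilinear_B: "bounded_bilinear B"
  using bilinear_B by (simp add: bilinear_conv_bounded_bilinear)

lemma B_nonneg: "B x x \<ge> 0"
  by (cases "x = 0") (auto dest: B_pos intro: less_imp_le)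

lemma bnorm_nonneg [simp]: "bnorm B x \<ge> 0"
  by (simp add: bnorm_def B_nonneg)

lemma bnorm_power2: "bnorm B x ^ 2 = B x x"
  by (simp add: bnorm_def B_nonneg)

lemma bnorm_zero [simp]: "bnorm B 0 = 0"
  by (simp add: bnorm_def)

lemma bnorm_eq_0_iff [simp]: "bnorm B x = 0 \<longleftrightarrow> x = 0"
  using B_pos[of x] by (cases "x = 0") (auto simp: bnorm_def)

lemma bnorm_pos_iff [simp]: "bnorm B x > 0 \<longleftrightarrow> x \<noteq> 0"
  using bnorm_nonneg[of x] bnorm_eq_0_iff[of x] by linarith

lemma bnorm_scale [simp]: "bnorm B (c *\<^sub>R x) = \<bar>c\<bar> * bnorm B x"
  by (simp add: bnorm_def real_sqrt_mult flip: mult.assoc)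

lemma bnorm_minus [simp]: "bnorm B (- x) = bnorm B x"
  by (simp add: bnorm_def)

lemma bnorm_minus_commute: "bnorm B (x - y) = bnorm B (y - x)"
  by (metis bnorm_minus minus_diff_eq)

lemma Cauchy_Schwarz_B: "B x y \<le> bnorm B x * bnorm B y"
proof (cases "x = 0 \<or> y = 0")
  case False
  let ?a = "bnorm B x" and ?b = "bnorm B y"
  have ab: "?a > 0" "?b > 0"
    using False by auto
  have "0 \<le> B (?b *\<^sub>R x - ?a *\<^sub>R y) (?b *\<^sub>R x - ?a *\<^sub>R y)"
    by (rule B_nonneg)
  also have "\<dots> = ?b ^ 2 * B x x - 2 * ?a * ?b * B x y + ?a ^ 2 * B y y"
    by (simp add: B_commute algebra_simps power2_eq_square)
  also have "\<dots> = 2 * (?a * ?b) * (?a * ?b - B x y)"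
    by (simp add: algebra_simps power2_eq_square flip: bnorm_power2)
  finally show ?thesis
    using mult_pos_pos[OF ab] by (simp add: zero_le_mult_iff)
qed auto

lemma bnorm_triangle: "bnorm B (x + y) \<le> bnorm B x + bnorm B y"
proof (rule power2_le_imp_le)
  show "bnorm B (x + y) ^ 2 \<le> (bnorm B x + bnorm B y) ^ 2"
    using Cauchy_Schwarz_B[of x y]
    by (simp add: bnorm_power2 power2_sum B_commute[of y x])
qed simp

lemma continuous_on_bnorm [continuous_intros]:
  assumes "continuous_on S f"
  shows "continuous_on S (\<lambda>x. bnorm B (f x))"
  unfolding bnorm_def
  by (intro continuous_intros bounded_bilinear.continuous_on[OF bounded_bilinear_B] assms)

lemma norm_le_bnorm: "\<exists>C>0. \<forall>x. norm x \<le> C * bnorm B x"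
proof -
  obtain b :: 'a where "b \<in> Basis"
    using nonempty_Basis by blast
  then have nonempty: "sphere (0::'a) 1 \<noteq> {}"
    by (intro ex_in_conv[THEN iffD1] exI[of _ b]) simp
  have "compact (sphere (0::'a) 1)" "continuous_on (sphere 0 1) (bnorm B)"
    using continuous_on_bnorm[OF continuous_on_id] by (auto simp: id_def)
  then obtain e where e: "e \<in> sphere 0 1" "\<And>x. x \<in> sphere 0 1 \<Longrightarrow> bnorm B e \<le> bnorm B x"
    using nonempty continuous_attains_inf[of "sphere (0::'a) 1" "bnorm B"] by blast
  have pos: "bnorm B e > 0"
    using e(1) by auto
  have "norm x \<le> 1 / bnorm B e * bnorm B x" for x
  proof (cases "x = 0")
    case False
    then have "bnorm B e \<le> bnorm B ((1 / norm x) *\<^sub>R x)"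
      by (intro e(2)) auto
    then show ?thesis
      using False pos by (simp add: field_simps)
  qed auto
  then show ?thesis
    using pos by (intro exI[of _ "1 / bnorm B e"]) auto
qed

lemma bounded_if_bnorm_bounded:
  assumes "\<And>x. x \<in> S \<Longrightarrow> bnorm B (x - c) \<le> r"
  shows "bounded S"
proof -
  obtain C where C: "C > 0" "\<And>x. norm x \<le> C * bnorm B x"
    using norm_le_bnorm by blast
  have "dist c x \<le> C * r" if "x \<in> S" for x
    using C(2)[of "x - c"] assms[OF that] C(1)
    by (metis dist_norm dist_commute mult_le_cancel_left_pos order_trans)
  then show ?thesis
    unfolding bounded_def by blast
qed

text \<open>
  Every functional is \<open>B w\<close> for some \<open>w\<close>, and its dual norm is then the norm of \<open>w\<close>. This turns
  computations with dual norms into computations with the inner product \<open>B\<close>.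
\<close>

lemma Riesz_B:
  assumes "linear \<xi>"
  obtains w where "\<xi> = B w"
proof -
  define R where "R x = (\<Sum>b\<in>Basis. B x b *\<^sub>R b)" for x
  have R: "R x \<bullet> h = B x h" for x h
  proof -
    have "B x h = B x (\<Sum>b\<in>Basis. (h \<bullet> b) *\<^sub>R b)"
      by (simp add: euclidean_representation)
    also have "\<dots> = (\<Sum>b\<in>Basis. (h \<bullet> b) * B x b)"
      by (simp add: linear_sum[OF linear_B] linear_cmul[OF linear_B])
    also have "\<dots> = R x \<bullet> h"
      by (simp add: R_def inner_sum_left inner_commute[of h] mult.commute)
    finally show ?thesis ..
  qed
  have "linear R"
    unfolding R_def by (intro linearI) (simp_all add: scaleR_left.add sum.distrib scaleR_sum_right algebra_simps)
  moreover have "inj R"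
    using \<open>linear R\<close> unfolding linear_injective_0[OF \<open>linear R\<close>]
    by (metis R B_pos inner_zero_left less_irrefl)
  ultimately have "surj R"
    by (rule linear_inj_imp_surj)
  then obtain w where w: "R w = (\<Sum>b\<in>Basis. \<xi> b *\<^sub>R b)"
    using surjD[of R "\<Sum>b\<in>Basis. \<xi> b *\<^sub>R b"] by auto
  then have "B w h = \<xi> h" for h
  proof -
    have "\<xi> h = \<xi> (\<Sum>b\<in>Basis. (h \<bullet> b) *\<^sub>R b)"
      by (simp add: euclidean_representation)
    also have "\<dots> = (\<Sum>b\<in>Basis. \<xi> b *\<^sub>R b) \<bullet> h"
      by (simp add: linear_sum[OF assms] linear_cmul[OF assms] inner_sum_left
          inner_commute[of h] mult.commute)
    also have "\<dots> = B w h"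
      using R[of w h] w by simp
    finally show ?thesis ..
  qed
  then have "\<xi> = B w"
    by (intro ext) simp
  then show ?thesis
    by (rule that)
qed

lemma dual_norm_B: "dual_norm B (B w) = bnorm B w"
proof -
  have le: "B w h \<le> bnorm B w" if "bnorm B h \<le> 1" for h
    using Cauchy_Schwarz_B[of w h] mult_left_mono[OF that, of "bnorm B w"] by simp
  have "bnorm B w \<in> B w ` {h. bnorm B h \<le> 1}"
  proof (cases "w = 0")
    case False
    have "B w ((1 / bnorm B w) *\<^sub>R w) = bnorm B w"
      using False by (simp add: power2_eq_square flip: bnorm_power2)
    then show ?thesis
      using False by (intro image_eqI[of _ _ "(1 / bnorm B w) *\<^sub>R w"]) auto
  qed (auto intro: image_eqI[of _ _ 0])
  then show ?thesis
    unfolding dual_norm_def by (intro cSup_eq_maximum) (auto intro: le)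
qed

lemma le_dual_norm: "linear \<xi> \<Longrightarrow> \<xi> h \<le> dual_norm B \<xi> * bnorm B h"
  by (erule Riesz_B) (simp add: dual_norm_B Cauchy_Schwarz_B)

lemma dual_norm_nonneg: "linear \<xi> \<Longrightarrow> 0 \<le> dual_norm B \<xi>"
  by (erule Riesz_B) (simp add: dual_norm_B)

section \<open>Uniform convexity of the prox-function\<close>

text \<open>
  The chain rule through the square root fails at the centre; there the power is \<open>o(\<parallel>x - c\<parallel>)\<close>.
\<close>

lemma has_derivative_bnorm_power:
  assumes "p \<ge> 1"
  shows "((\<lambda>x. bnorm B (x - c) ^ (p + 1)) has_derivative
           (\<lambda>h. real (p + 1) * bnorm B (x - c) ^ (p - 1) * B (x - c) h)) (at x)"
proof (cases "x = c")
  case False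
  then have pos: "B (x - c) (x - c) > 0"
    by (intro B_pos) simp
  have id: "((\<lambda>x. x - c) has_derivative (\<lambda>h. h)) (at x)"
    by (auto intro!: derivative_eq_intros)
  have "(\<lambda>h. B (x - c) h + B h (x - c)) = (\<lambda>h. 2 * B (x - c) h)"
    by (intro ext) (metis B_commute mult_2)
  then have D: "((\<lambda>x. B (x - c) (x - c)) has_derivative (\<lambda>h. 2 * B (x - c) h)) (at x)"
    using bounded_bilinear.FDERIV[OF bounded_bilinear_B id id] by (simp only:)
  have "((\<lambda>x. sqrt (B (x - c) (x - c))) has_derivative
      (\<lambda>h. inverse (sqrt (B (x - c) (x - c))) / 2 * (2 * B (x - c) h))) (at x)"
    by (rule has_derivative_compose[OF D DERIV_real_sqrt[OF pos, unfolded has_field_derivative_def]])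
  moreover have "(\<lambda>h. inverse (sqrt (B (x - c) (x - c))) / 2 * (2 * B (x - c) h)) =
      (\<lambda>h. B (x - c) h / bnorm B (x - c))"
    unfolding bnorm_def by (intro ext) (simp add: field_simps del: B_diff_left B_diff_right)
  ultimately have "((\<lambda>x. bnorm B (x - c)) has_derivative (\<lambda>h. B (x - c) h / bnorm B (x - c))) (at x)"
    by (simp only: bnorm_def)
  then have "((\<lambda>x. bnorm B (x - c) ^ (p + 1)) has_derivative
      (\<lambda>h. real (p + 1) * (B (x - c) h / bnorm B (x - c)) * bnorm B (x - c) ^ p)) (at x)"
    using has_derivative_power[of "\<lambda>x. bnorm B (x - c)" _ x UNIV "p + 1"] by (simp only: add_diff_cancel_right')
  moreover have "(\<lambda>h. real (p + 1) * (B (x - c) h / bnorm B (x - c)) * bnorm B (x - c) ^ p) =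
      (\<lambda>h. real (p + 1) * bnorm B (x - c) ^ (p - 1) * B (x - c) h)"
    using False assms by (cases p) (auto simp: fun_eq_iff field_simps simp del: B_diff_left B_diff_right)
  ultimately show ?thesis
    by (simp only:)
next
  case True
  obtain C where C: "C > 0" "\<And>x y. norm (B x y) \<le> norm x * norm y * C"
    using bounded_bilinear.pos_bounded[OF bounded_bilinear_B] by blast
  have le: "bnorm B y \<le> sqrt C * norm y" for y
  proof -
    have "B y y \<le> norm y * norm y * C"
      using C(2)[of y y] by simp
    then have "bnorm B y \<le> sqrt (norm y * norm y * C)"
      unfolding bnorm_def by simp
    then show ?thesis
      by (simp add: real_sqrt_mult mult.commute)
  qed
  have "((\<lambda>y. norm (bnorm B (y - c) ^ (p + 1)) / norm (y - c)) \<longlongrightarrow> 0) (at c)"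
  proof (rule tendsto_sandwich[of "\<lambda>_. 0" _ _ "\<lambda>y. sqrt C ^ (p + 1) * norm (y - c) ^ p"])
    show "\<forall>\<^sub>F y in at c. norm (bnorm B (y - c) ^ (p + 1)) / norm (y - c)
        \<le> sqrt C ^ (p + 1) * norm (y - c) ^ p"
    proof (rule always_eventually, rule)
      fix y
      have "bnorm B (y - c) ^ (p + 1) \<le> (sqrt C * norm (y - c)) ^ (p + 1)"
        by (intro power_mono le) auto
      then show "norm (bnorm B (y - c) ^ (p + 1)) / norm (y - c)
          \<le> sqrt C ^ (p + 1) * norm (y - c) ^ p"
        using C(1) by (cases "y = c") (simp_all add: divide_le_eq power_mult_distrib mult_ac)
    qed
    have "((\<lambda>y. sqrt C ^ (p + 1) * norm (y - c) ^ p) \<longlongrightarrow> sqrt C ^ (p + 1) * norm (c - c) ^ p) (at c)"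
      by (intro tendsto_intros)
    then show "((\<lambda>y. sqrt C ^ (p + 1) * norm (y - c) ^ p) \<longlongrightarrow> 0) (at c)"
      using assms by (simp add: zero_power)
  qed auto
  then have "((\<lambda>x. bnorm B (x - c) ^ (p + 1)) has_derivative (\<lambda>h. 0)) (at c)"
    unfolding has_derivative_iff_norm by simp
  then show ?thesis
    using True by simp
qed

end

context spd_geometry
begin

lemma has_derivative_prox_fun:
  assumes "p \<ge> 1"
  shows "(prox_fun B p c has_derivative (\<lambda>h. bnorm B (x - c) ^ (p - 1) * B (x - c) h)) (at x)"
proof -
  have "((\<lambda>x. bnorm B (x - c) ^ (p + 1) * (1 / real (p + 1))) has_derivative
      (\<lambda>h. real (p + 1) * bnorm B (x - c) ^ (p - 1) * B (x - c) h * (1 / real (p + 1)))) (at x)"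
    by (intro has_derivative_mult_left has_derivative_bnorm_power assms)
  moreover have "(\<lambda>h. real (p + 1) * bnorm B (x - c) ^ (p - 1) * B (x - c) h * (1 / real (p + 1))) =
      (\<lambda>h. bnorm B (x - c) ^ (p - 1) * B (x - c) h)"
    by (intro ext) (simp del: of_nat_add)
  moreover have "prox_fun B p c = (\<lambda>x. bnorm B (x - c) ^ (p + 1) * (1 / real (p + 1)))"
    by (intro ext) (simp add: prox_fun_def)
  ultimately show ?thesis
    by (simp only:)
qed

lemma bregman_prox_fun:
  assumes "p \<ge> 1"
  shows "bregman (prox_fun B p c) x y =
    prox_fun B p c y - prox_fun B p c x - bnorm B (x - c) ^ (p - 1) * B (x - c) (y - x)"
  unfolding bregman_def
  using frechet_derivative_at[OF has_derivative_prox_fun[OF assms], of x c, symmetric]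
  by (simp del: B_diff_left B_diff_right)

lemma bregman_three_points:
  assumes "p \<ge> 1"
  shows "bregman (prox_fun B p c) x y = bregman (prox_fun B p c) x w + bregman (prox_fun B p c) w y
    + (bnorm B (w - c) ^ (p - 1) * B (w - c) (y - w) - bnorm B (x - c) ^ (p - 1) * B (x - c) (y - w))"
  by (simp add: bregman_prox_fun[OF assms] algebra_simps)

lemma continuous_on_bregman:
  assumes "p \<ge> 1"
  shows "continuous_on S (bregman (prox_fun B p c) x)"
  unfolding bregman_prox_fun[OF assms, abs_def] prox_fun_def
  by (intro continuous_intros bounded_bilinear.continuous_on[OF bounded_bilinear_B])
    (simp_all del: B_diff_left B_diff_right)

end

lemma power_mean_le:
  fixes a b :: real
  assumes "0 \<le> a" "0 \<le> b"
  shows "((a + b) / 2) ^ n \<le> (a ^ n + b ^ n) / 2"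
proof (induction n)
  case (Suc n)
  have "((a + b) / 2) ^ Suc n \<le> (a + b) / 2 * ((a ^ n + b ^ n) / 2)"
    using mult_left_mono[OF Suc, of "(a + b) / 2"] assms by simp
  also have "0 \<le> (a - b) * (a ^ n - b ^ n)"
    using assms power_mono[of a b n] power_mono[of b a n]
    by (cases "a \<le> b") (auto simp: zero_le_mult_iff)
  then have "(a + b) / 2 * ((a ^ n + b ^ n) / 2) \<le> (a ^ Suc n + b ^ Suc n) / 2"
    by (simp add: algebra_simps)
  finally show ?case .
qed auto

context spd_geometry
begin

text \<open>
  With \<open>a\<close>, \<open>b\<close> for the norms of \<open>x\<close> and \<open>y\<close>, the left-hand side is the sum of
  \<open>(a\<^sup>m + b\<^sup>m) / 2\<close> times the squared distance and of
  \<open>(a\<^sup>m - b\<^sup>m) (a\<^sup>2 - b\<^sup>2) / 2\<close>, which is nonnegative; the power mean and the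
  triangle inequality finish the proof.
\<close>

lemma prox_gradient_uniformly_monotone:
  "(bnorm B x ^ m * B x (x - y) - bnorm B y ^ m * B y (x - y)) \<ge> bnorm B (x - y) ^ (m + 2) / 2 ^ m"
proof -
  let ?a = "bnorm B x" and ?b = "bnorm B y" and ?c = "bnorm B (x - y)"
  have "?c ^ (m + 2) / 2 ^ m = (?c / 2) ^ m * ?c ^ 2"
    by (simp add: power_divide power_add power2_eq_square)
  also have "\<dots> \<le> ((?a + ?b) / 2) ^ m * ?c ^ 2"
    using bnorm_triangle[of x "- y"] by (intro mult_right_mono power_mono) auto
  also have "\<dots> \<le> ((?a ^ m + ?b ^ m) / 2) * ?c ^ 2"
    by (intro mult_right_mono power_mean_le) auto
  also have "0 \<le> (?a ^ m - ?b ^ m) * (?a ^ 2 - ?b ^ 2)"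
    using power_mono[of ?a ?b m] power_mono[of ?b ?a m]
      power_mono[of ?a ?b 2] power_mono[of ?b ?a 2]
    by (cases "?a \<le> ?b") (auto simp: zero_le_mult_iff)
  then have "((?a ^ m + ?b ^ m) / 2) * ?c ^ 2 \<le>
      ((?a ^ m + ?b ^ m) / 2) * ?c ^ 2 + (?a ^ m - ?b ^ m) * (?a ^ 2 - ?b ^ 2) / 2"
    by simp
  also have "\<dots> = ?a ^ m * B x (x - y) - ?b ^ m * B y (x - y)"
    unfolding bnorm_power2 by (simp add: B_commute[of y x] field_simps)
  finally show ?thesis .
qed

text \<open>The monotonicity of the gradient, integrated along the segment from \<open>x\<close> to \<open>y\<close>.\<close>

lemma bregman_ge:
  assumes p: "p \<ge> 1"
  shows "bregman (prox_fun B p c) x y \<ge> bnorm B (y - x) ^ (p + 1) / (2 ^ (p - 1) * real (p + 1))"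
proof -
  define u where "u = y - x"
  define D where "D w h = bnorm B (w - c) ^ (p - 1) * B (w - c) h" for w h
  define C where "C = bnorm B u ^ (p + 1) / 2 ^ (p - 1)"
  define \<phi> where "\<phi> \<tau> = prox_fun B p c (x + \<tau> *\<^sub>R u) - \<tau> * D x u
      - \<tau> ^ (p + 1) * (C / real (p + 1))" for \<tau> :: real
  have deriv: "(\<phi> has_real_derivative (D (x + \<tau> *\<^sub>R u) u - D x u
      - \<tau> ^ p * C)) (at \<tau>)" for \<tau>
  proof -
    have "((\<lambda>\<tau>. prox_fun B p c (x + \<tau> *\<^sub>R u)) has_derivative (\<lambda>h. D (x + \<tau> *\<^sub>R u) (h *\<^sub>R u))) (at \<tau>)"
      unfolding D_def
      by (rule has_derivative_compose[of "\<lambda>\<tau>. x + \<tau> *\<^sub>R u", OF _ has_derivative_prox_fun[OF p]])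
        (auto intro!: derivative_eq_intros)
    then have "((\<lambda>\<tau>. prox_fun B p c (x + \<tau> *\<^sub>R u)) has_real_derivative D (x + \<tau> *\<^sub>R u) u) (at \<tau>)"
      unfolding has_field_derivative_def
      by (rule back_subst[where P = "\<lambda>D. (_ has_derivative D) _"]) (auto simp: D_def)
    moreover have "((\<lambda>\<tau>. \<tau> ^ (p + 1) * (C / real (p + 1))) has_real_derivative \<tau> ^ p * C) (at \<tau>)"
    proof -
      have "real (p + 1) * \<tau> ^ (p + 1 - Suc 0) * (C / real (p + 1)) = \<tau> ^ p * C"
        by (simp del: of_nat_add)
      then show ?thesis
        using DERIV_cmult_right[OF DERIV_pow[of "p + 1" \<tau>], of "C / real (p + 1)"] by (simp only:)
    qed
    moreover have "((\<lambda>\<tau>. \<tau> * D x u) has_real_derivative D x u) (at \<tau>)"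
      by (auto intro!: derivative_eq_intros)
    ultimately show ?thesis
      unfolding \<phi>_def by (intro DERIV_diff)
  qed
  have "\<phi> 0 \<le> \<phi> 1"
  proof (rule DERIV_nonneg_imp_nondecreasing[of 0 1])
    fix \<tau> :: real
    assume \<tau>: "0 \<le> \<tau>" "\<tau> \<le> 1"
    have "0 \<le> D (x + \<tau> *\<^sub>R u) u - D x u - \<tau> ^ p * C"
    proof (cases "\<tau> = 0")
      case False
      have "\<tau> ^ (p + 1) * C \<le> D (x + \<tau> *\<^sub>R u) (\<tau> *\<^sub>R u) - D x (\<tau> *\<^sub>R u)"
        using prox_gradient_uniformly_monotone[where x = "x + \<tau> *\<^sub>R u - c" and y = "x - c" and m = "p - 1"] p \<tau>
        unfolding D_def C_def by (simp add: power_mult_distrib mult_ac del: B_diff_left B_diff_right B_add_left)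
      also have "\<dots> = \<tau> * (D (x + \<tau> *\<^sub>R u) u - D x u)"
        by (simp add: D_def algebra_simps)
      finally have "\<tau> * (\<tau> ^ p * C) \<le> \<tau> * (D (x + \<tau> *\<^sub>R u) u - D x u)"
        by simp
      then show ?thesis
        using False \<tau> by simp
    qed (use p in \<open>simp add: zero_power\<close>)
    then show "\<exists>y. (\<phi> has_real_derivative y) (at \<tau>) \<and> 0 \<le> y"
      using deriv by blast
  qed simp
  then show ?thesis
    unfolding bregman_prox_fun[OF p] \<phi>_def D_def u_def C_def
    by (simp del: B_diff_left B_diff_right)
qed

lemma bregman_nonneg: "p \<ge> 1 \<Longrightarrow> bregman (prox_fun B p c) x y \<ge> 0"
  by (rule order_trans[OF _ bregman_ge]) simp_all

end

section \<open>Higher derivatives as symmetric multilinear forms\<close>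

definition multilinear_form :: "nat \<Rightarrow> ('a::real_vector list \<Rightarrow> real) \<Rightarrow> bool" where
  "multilinear_form n W \<longleftrightarrow>
     (\<forall>hs1 hs2. length hs1 + length hs2 + 1 = n \<longrightarrow> linear (\<lambda>h. W (hs1 @ h # hs2)))"

lemma multilinear_formD:
  "multilinear_form n W \<Longrightarrow> length hs1 + length hs2 + 1 = n \<Longrightarrow> linear (\<lambda>h. W (hs1 @ h # hs2))"
  unfolding multilinear_form_def by blast

lemma multilinear_form_head:
  "multilinear_form (Suc n) W \<Longrightarrow> length hs = n \<Longrightarrow> linear (\<lambda>h. W (h # hs))"
  using multilinear_formD[of "Suc n" W "[]" hs] by simp

lemma multilinear_form_tail: "multilinear_form (Suc n) W \<Longrightarrow> multilinear_form n (\<lambda>hs. W (h # hs))"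
  using multilinear_formD[of "Suc n" W "h # _"] unfolding multilinear_form_def[of n] by simp

lemma multilinear_form_scale:
  assumes "multilinear_form n W" "length hs = n"
  shows "W (map (\<lambda>h. c h *\<^sub>R k h) hs) = prod_list (map c hs) * W (map k hs)"
  using assms
proof (induction n arbitrary: W hs)
  case (Suc n)
  then obtain h hs' where hs: "hs = h # hs'" "length hs' = n"
    by (cases hs) auto
  have "W (map (\<lambda>h. c h *\<^sub>R k h) hs) = c h * W (k h # map (\<lambda>h. c h *\<^sub>R k h) hs')"
    using linear_cmul[OF multilinear_form_head[OF Suc.prems(1)], of "map (\<lambda>h. c h *\<^sub>R k h) hs'"] hs
    by simp
  also have "\<dots> = c h * (prod_list (map c hs') * W (k h # map k hs'))"
    using Suc.IH[OF multilinear_form_tail[OF Suc.prems(1)] hs(2)] by simp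
  finally show ?case
    by (simp add: hs mult_ac)
qed auto

text \<open>
  Differentiating \<open>y \<mapsto> W (y, \<dots>, y)\<close> gives one term for each slot. The induction writes the first
  argument in coordinates and applies the product rule.
\<close>

lemma multilinear_form_has_derivative:
  fixes W :: "'a::euclidean_space list \<Rightarrow> real"
  assumes "multilinear_form n W"
  shows "((\<lambda>y. W (replicate n y)) has_derivative
    (\<lambda>h. \<Sum>i<n. W (replicate i y @ h # replicate (n - 1 - i) y))) (at y)"
  using assms
proof (induction n arbitrary: W)
  case (Suc n)
  have expand: "W (v # hs) = (\<Sum>b\<in>Basis. (v \<bullet> b) * W (b # hs))" if "length hs = n" for v hs
  proof -
    have lin: "linear (\<lambda>h. W (h # hs))"
      by (rule multilinear_form_head[OF Suc.prems that])
    have "W (v # hs) = W ((\<Sum>b\<in>Basis. (v \<bullet> b) *\<^sub>R b) # hs)"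
      by (simp add: euclidean_representation)
    also have "\<dots> = (\<Sum>b\<in>Basis. (v \<bullet> b) * W (b # hs))"
      using linear_sum[OF lin, of "\<lambda>b. (v \<bullet> b) *\<^sub>R b" Basis] linear_cmul[OF lin] by simp
    finally show ?thesis .
  qed
  define D where "D b h = (\<Sum>i<n. W (b # replicate i y @ h # replicate (n - 1 - i) y))" for b h
  have D: "((\<lambda>y. W (b # replicate n y)) has_derivative D b) (at y)" for b
    using Suc.IH[OF multilinear_form_tail[OF Suc.prems], of b] by (simp add: D_def[abs_def])
  have "((\<lambda>y. \<Sum>b\<in>Basis. (y \<bullet> b) * W (b # replicate n y)) has_derivative
      (\<lambda>h. \<Sum>b\<in>Basis. (y \<bullet> b) * D b h + (h \<bullet> b) * W (b # replicate n y))) (at y)"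
    by (auto intro!: derivative_eq_intros D)
  moreover have "(\<lambda>y. \<Sum>b\<in>Basis. (y \<bullet> b) * W (b # replicate n y)) = (\<lambda>y. W (replicate (Suc n) y))"
    using expand by simp
  moreover have "(\<Sum>b\<in>Basis. (y \<bullet> b) * D b h + (h \<bullet> b) * W (b # replicate n y)) =
      (\<Sum>i<Suc n. W (replicate i y @ h # replicate (Suc n - 1 - i) y))" for h
  proof -
    have "(\<Sum>b\<in>Basis. (y \<bullet> b) * D b h) =
        (\<Sum>i<n. \<Sum>b\<in>Basis. (y \<bullet> b) * W (b # replicate i y @ h # replicate (n - 1 - i) y))"
      unfolding D_def sum_distrib_left by (rule sum.swap)
    also have "\<dots> = (\<Sum>i<n. W (y # replicate i y @ h # replicate (n - 1 - i) y))"
      by (intro sum.cong refl expand[symmetric]) auto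
    finally show ?thesis
      unfolding sum.distrib sum.lessThan_Suc_shift using expand[of "replicate n y" h] by simp
  qed
  ultimately show ?case
    by simp
qed auto

context spd_geometry
begin

lemma multilinear_form_bounded:
  assumes "multilinear_form n W"
  shows "\<exists>C\<ge>0. \<forall>hs. length hs = n \<longrightarrow> \<bar>W hs\<bar> \<le> C * prod_list (map (bnorm B) hs)"
  using assms
proof (induction n arbitrary: W)
  case 0
  then show ?case
    by (intro exI[of _ "\<bar>W []\<bar>"]) auto
next
  case (Suc n)
  obtain c where c: "c > 0" "\<And>x. norm x \<le> c * bnorm B x"
    using norm_le_bnorm by blast
  have "\<exists>C\<ge>0. \<forall>hs. length hs = n \<longrightarrow> \<bar>W (b # hs)\<bar> \<le> C * prod_list (map (bnorm B) hs)" for b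
    by (rule Suc.IH[OF multilinear_form_tail[OF Suc.prems]])
  then obtain C where C: "\<And>b. C b \<ge> 0"
      "\<And>b hs. length hs = n \<Longrightarrow> \<bar>W (b # hs)\<bar> \<le> C b * prod_list (map (bnorm B) hs)"
    by metis
  have "\<bar>W hs\<bar> \<le> (\<Sum>b\<in>Basis. c * C b) * prod_list (map (bnorm B) hs)" if len: "length hs = Suc n" for hs
  proof -
    obtain h hs' where hs: "hs = h # hs'" "length hs' = n"
      using len by (cases hs) auto
    have lin: "linear (\<lambda>h. W (h # hs'))"
      by (rule multilinear_form_head[OF Suc.prems hs(2)])
    have "W hs = W ((\<Sum>b\<in>Basis. (h \<bullet> b) *\<^sub>R b) # hs')"
      by (simp add: euclidean_representation hs)
    also have "\<dots> = (\<Sum>b\<in>Basis. (h \<bullet> b) * W (b # hs'))"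
      using linear_sum[OF lin, of "\<lambda>b. (h \<bullet> b) *\<^sub>R b" Basis] linear_cmul[OF lin] by simp
    also have "\<bar>\<dots>\<bar> \<le> (\<Sum>b\<in>Basis. (c * bnorm B h) * (C b * prod_list (map (bnorm B) hs')))"
    proof (rule order_trans[OF sum_abs sum_mono])
      fix b :: 'a
      assume "b \<in> Basis"
      then have "\<bar>h \<bullet> b\<bar> \<le> c * bnorm B h"
        using Basis_le_norm[of b h] c(2)[of h] by linarith
      then show "\<bar>(h \<bullet> b) * W (b # hs')\<bar> \<le> (c * bnorm B h) * (C b * prod_list (map (bnorm B) hs'))"
        unfolding abs_mult using C(2)[OF hs(2), of b] c(1) by (intro mult_mono) auto
    qed
    also have "\<dots> = (\<Sum>b\<in>Basis. c * C b) * prod_list (map (bnorm B) hs)"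
      by (simp add: hs sum_distrib_left mult_ac)
    finally show ?thesis .
  qed
  then show ?case
    using c(1) C(1) by (intro exI[of _ "\<Sum>b\<in>Basis. c * C b"]) (auto intro!: sum_nonneg)
qed

lemma prod_list_bnorm_nonneg: "prod_list (map (bnorm B) hs) \<ge> 0"
  by (induction hs) auto

lemma prod_list_bnorm_le_one:
  "\<forall>h\<in>set hs. bnorm B h \<le> 1 \<Longrightarrow> prod_list (map (bnorm B) hs) \<le> 1"
proof (induction hs)
  case (Cons h hs)
  then show ?case
    using mult_mono[of "bnorm B h" 1 "prod_list (map (bnorm B) hs)" 1] prod_list_bnorm_nonneg[of hs]
    by simp
qed auto

text \<open>
  Multilinearity makes the supremum in the form norm finite and allows rescaling of the arguments.
  Zero arguments are covered by \<open>1 / 0 = 0\<close>.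
\<close>

lemma le_form_norm:
  assumes W: "multilinear_form n W" and len: "length hs = n"
  shows "W hs \<le> form_norm B n W * prod_list (map (bnorm B) hs)"
proof -
  let ?U = "{hs. length hs = n \<and> (\<forall>h\<in>set hs. bnorm B h \<le> 1)}"
  define k where "k h = (1 / bnorm B h) *\<^sub>R h" for h
  obtain C where C: "C \<ge> 0" "\<And>hs. length hs = n \<Longrightarrow> \<bar>W hs\<bar> \<le> C * prod_list (map (bnorm B) hs)"
    using multilinear_form_bounded[OF W] by blast
  have "W hs \<le> C * 1" if "hs \<in> ?U" for hs
    using that C(2)[of hs] mult_left_mono[OF prod_list_bnorm_le_one C(1), of hs] by fastforce
  then have "bdd_above (W ` ?U)"
    by (intro bdd_aboveI2[where M = "C * 1"])
  moreover have "map k hs \<in> ?U"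
    using len by (auto simp: k_def)
  ultimately have "W (map k hs) \<le> form_norm B n W"
    unfolding form_norm_def by (rule cSUP_upper[rotated])
  moreover have "map (\<lambda>h. bnorm B h *\<^sub>R k h) hs = hs"
    by (induction hs) (auto simp: k_def)
  then have "W hs = prod_list (map (bnorm B) hs) * W (map k hs)"
    using multilinear_form_scale[OF W len, of "bnorm B" k] by simp
  ultimately show ?thesis
    using prod_list_bnorm_nonneg[of hs] by (metis mult.commute mult_right_mono)
qed

lemma abs_le_form_norm:
  assumes W: "multilinear_form n W" and len: "length hs = n" and n: "n \<ge> 1"
  shows "\<bar>W hs\<bar> \<le> form_norm B n W * prod_list (map (bnorm B) hs)"
proof -
  obtain h hs' m where hs: "hs = h # hs'" "length hs' = m" "n = Suc m"
    using len n by (cases hs) auto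
  have "W (- h # hs') = - W hs"
    using linear_neg[OF multilinear_form_head[of m W hs'], of h] W hs by simp
  moreover have "W (- h # hs') \<le> form_norm B n W * prod_list (map (bnorm B) (- h # hs'))"
    using hs by (intro le_form_norm W) auto
  ultimately show ?thesis
    using le_form_norm[OF W len] hs by auto
qed

end

lemma nderiv_append: "nderiv g (hs1 @ hs2) = nderiv (nderiv g hs2) hs1"
  by (induction hs1) auto

lemma frechet_derivative_cong_open:
  assumes "open S" "x \<in> S" "\<And>y. y \<in> S \<Longrightarrow> f y = g y"
  shows "frechet_derivative f (at x) = frechet_derivative g (at x)"
proof -
  have "(f has_derivative D) (at x) \<longleftrightarrow> (g has_derivative D) (at x)" for D
    using assms has_derivative_transform_within_open[of f D x UNIV S g]
      has_derivative_transform_within_open[of g D x UNIV S f] by auto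
  then show ?thesis
    unfolding frechet_derivative_def by simp
qed

lemma nderiv_cong_open:
  assumes "open S" "\<And>y. y \<in> S \<Longrightarrow> f y = g y" "x \<in> S"
  shows "nderiv f hs x = nderiv g hs x"
  using assms(3)
proof (induction hs arbitrary: x)
  case (Cons h hs)
  have "frechet_derivative (nderiv f hs) (at x) = frechet_derivative (nderiv g hs) (at x)"
    by (rule frechet_derivative_cong_open[OF assms(1) Cons.prems Cons.IH])
  then show ?case
    by simp
qed (simp add: assms)

lemma times_differentiable_onD:
  "times_differentiable_on n g S \<Longrightarrow> length hs < n \<Longrightarrow> x \<in> S \<Longrightarrow>
    (nderiv g hs has_derivative frechet_derivative (nderiv g hs) (at x)) (at x)"
  unfolding times_differentiable_on_def by (auto simp: frechet_derivative_works)

text \<open>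
  An inner slot is linear at every point of the open set, hence the outer derivatives preserve
  the linear relation.
\<close>

lemma nderiv_linear_slot:
  assumes g: "times_differentiable_on p g S" and S: "open S" and x: "x \<in> S"
    and len: "length hs1 + length hs2 + 1 \<le> p"
  shows "linear (\<lambda>h. nderiv g (hs1 @ h # hs2) x)"
  using x len
proof (induction hs1 arbitrary: x)
  case Nil
  then show ?case
    using times_differentiable_onD[OF g, of hs2 x] by (simp add: has_derivative_linear)
next
  case (Cons k hs1)
  have D: "(nderiv g (hs1 @ h # hs2) has_derivative
      frechet_derivative (nderiv g (hs1 @ h # hs2)) (at x)) (at x)" for h
    using Cons.prems by (intro times_differentiable_onD[OF g]) auto
  have lin: "linear (\<lambda>h. nderiv g (hs1 @ h # hs2) y)" if "y \<in> S" for y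
    using Cons.prems that by (intro Cons.IH) auto
  show ?case
  proof (intro linearI)
    fix h1 h2
    let ?f = "\<lambda>y. nderiv g (hs1 @ h1 # hs2) y + nderiv g (hs1 @ h2 # hs2) y"
    have "frechet_derivative (nderiv g (hs1 @ (h1 + h2) # hs2)) (at x) = frechet_derivative ?f (at x)"
      using linear_add[OF lin] by (intro frechet_derivative_cong_open[OF S Cons.prems(1)]) auto
    then show "nderiv g ((k # hs1) @ (h1 + h2) # hs2) x =
        nderiv g ((k # hs1) @ h1 # hs2) x + nderiv g ((k # hs1) @ h2 # hs2) x"
      using frechet_derivative_at[OF has_derivative_add[OF D[of h1] D[of h2]], symmetric] by simp
  next
    fix c h
    let ?f = "\<lambda>y. c * nderiv g (hs1 @ h # hs2) y"
    have "frechet_derivative (nderiv g (hs1 @ (c *\<^sub>R h) # hs2)) (at x) = frechet_derivative ?f (at x)"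
      using linear_cmul[OF lin] by (intro frechet_derivative_cong_open[OF S Cons.prems(1)]) auto
    then show "nderiv g ((k # hs1) @ (c *\<^sub>R h) # hs2) x = c *\<^sub>R nderiv g ((k # hs1) @ h # hs2) x"
      using frechet_derivative_at[OF has_derivative_mult_right[OF D[of h], of c], symmetric] by simp
  qed
qed

lemma multilinear_form_nderiv:
  assumes "times_differentiable_on p g S" "open S" "x \<in> S" "n \<le> p"
  shows "multilinear_form n (\<lambda>hs. nderiv g hs x)"
  using nderiv_linear_slot[OF assms(1-3)] assms(4) unfolding multilinear_form_def by simp

lemma multilinear_form_diff:
  "multilinear_form n V \<Longrightarrow> multilinear_form n W \<Longrightarrow> multilinear_form n (\<lambda>hs. V hs - W hs)"
  unfolding multilinear_form_def by (auto intro!: linear_compose_sub)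

text \<open>
  The second difference over the parallelogram spanned by \<open>t h\<close> and \<open>t k\<close> is
  \<open>t\<^sup>2 Q k + o(t\<^sup>2)\<close> by the mean value theorem in the direction \<open>h\<close>, where \<open>Q\<close> is the derivative
  of the directional derivative \<open>P\<close> along \<open>h\<close>. As the second difference is symmetric in \<open>h\<close> and
  \<open>k\<close>, so are the second derivatives.
\<close>

lemma second_difference_tendsto:
  fixes G P :: "'a::real_normed_vector \<Rightarrow> real"
  assumes S: "open S" "x \<in> S"
    and G: "\<And>y. y \<in> S \<Longrightarrow> (G has_derivative D y) (at y)" "\<And>y. y \<in> S \<Longrightarrow> D y h = P y"
    and P: "(P has_derivative Q) (at x)"
  shows "((\<lambda>t. (G (x + t *\<^sub>R h + t *\<^sub>R k) - G (x + t *\<^sub>R h) - G (x + t *\<^sub>R k) + G x) / t ^ 2)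
    \<longlongrightarrow> Q k) (at_right 0)"
proof (rule tendstoI)
  fix e :: real
  assume e: "e > 0"
  define N where "N = 1 + norm h + norm k"
  define e' where "e' = e / (4 * N)"
  have N: "N \<ge> 1" "norm h \<le> N" "norm k \<le> N" "norm h + norm k \<le> N"
    by (auto simp: N_def)
  have e': "e' > 0"
    using e N by (simp add: e'_def)
  obtain d1 where d1: "d1 > 0" "\<And>y. norm (y - x) < d1 \<Longrightarrow> \<bar>P y - P x - Q (y - x)\<bar> \<le> e' * norm (y - x)"
    using P e' unfolding has_derivative_at_alt by auto
  obtain d2 where d2: "d2 > 0" "ball x d2 \<subseteq> S"
    using S by (auto simp: open_contains_ball)
  define d where "d = min d1 d2 / N"
  have d: "d > 0"
    using d1 d2 N by (simp add: d_def)
  have linQ: "linear Q"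
    using P by (simp add: has_derivative_linear)
  have main: "\<bar>(G (x + t *\<^sub>R h + t *\<^sub>R k) - G (x + t *\<^sub>R h) - G (x + t *\<^sub>R k) + G x) / t ^ 2 - Q k\<bar> < e"
    if t: "0 < t" "t < d" for t
  proof -
    have near: "norm w < d1 \<and> x + w \<in> S" if "norm w \<le> t * N" for w
    proof -
      have "t * N < min d1 d2"
        using t N by (simp add: d_def field_simps)
      then show ?thesis
        using that d2(2) by (auto simp: dist_norm subset_iff)
    qed
    have small: "norm ((t * \<theta>) *\<^sub>R h) \<le> t * N" "norm ((t * \<theta>) *\<^sub>R h + t *\<^sub>R k) \<le> t * N"
      if "0 \<le> \<theta>" "\<theta> \<le> 1" for \<theta>
    proof -
      have th: "\<theta> * norm h \<le> norm h"
        using that by (simp add: mult_left_le_one_le)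
      show "norm ((t * \<theta>) *\<^sub>R h) \<le> t * N"
        using th N t that by (simp add: abs_mult mult.assoc)
      have "norm ((t * \<theta>) *\<^sub>R h + t *\<^sub>R k) \<le> t * (\<theta> * norm h + norm k)"
        using norm_triangle_ineq[of "(t * \<theta>) *\<^sub>R h" "t *\<^sub>R k"] t that
        by (simp add: abs_mult algebra_simps)
      also have "\<dots> \<le> t * N"
        using th N t by (intro mult_left_mono) auto
      finally show "norm ((t * \<theta>) *\<^sub>R h + t *\<^sub>R k) \<le> t * N" .
    qed
    define \<phi> where "\<phi> \<theta> = G (x + ((t * \<theta>) *\<^sub>R h + t *\<^sub>R k)) - G (x + (t * \<theta>) *\<^sub>R h)" for \<theta>
    have deriv: "(\<phi> has_real_derivative
        t * (P (x + ((t * \<theta>) *\<^sub>R h + t *\<^sub>R k)) - P (x + (t * \<theta>) *\<^sub>R h))) (at \<theta>)"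
      if "0 \<le> \<theta>" "\<theta> \<le> 1" for \<theta>
    proof -
      have 1: "((\<lambda>\<theta>. G (x + ((t * \<theta>) *\<^sub>R h + w))) has_real_derivative
          t * P (x + ((t * \<theta>) *\<^sub>R h + w))) (at \<theta>)" if w: "x + ((t * \<theta>) *\<^sub>R h + w) \<in> S" for w
      proof -
        have "((\<lambda>\<theta>. G (x + ((t * \<theta>) *\<^sub>R h + w))) has_derivative
            (\<lambda>c. D (x + ((t * \<theta>) *\<^sub>R h + w)) ((t * c) *\<^sub>R h))) (at \<theta>)"
          by (rule has_derivative_compose[of "\<lambda>\<theta>. x + ((t * \<theta>) *\<^sub>R h + w)" "\<lambda>c. (t * c) *\<^sub>R h"
                \<theta> UNIV G, OF _ G(1)[OF w]]) (auto intro!: derivative_eq_intros)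
        moreover have "D (x + ((t * \<theta>) *\<^sub>R h + w)) ((t * c) *\<^sub>R h) = t * P (x + ((t * \<theta>) *\<^sub>R h + w)) * c" for c
          using linear_cmul[OF has_derivative_linear[OF G(1)[OF w]], of "t * c" h] G(2)[OF w] by simp
        ultimately show ?thesis
          by (simp add: has_field_derivative_def)
      qed
      have "x + ((t * \<theta>) *\<^sub>R h + t *\<^sub>R k) \<in> S" "x + ((t * \<theta>) *\<^sub>R h + 0) \<in> S"
        using near small[OF that] by auto
      from DERIV_diff[OF 1[OF this(1)] 1[OF this(2)]] show ?thesis
        unfolding \<phi>_def by (simp add: right_diff_distrib)
    qed
    obtain \<theta> where \<theta>: "0 < \<theta>" "\<theta> < 1" and
      eq: "\<phi> 1 - \<phi> 0 = t * (P (x + ((t * \<theta>) *\<^sub>R h + t *\<^sub>R k)) - P (x + (t * \<theta>) *\<^sub>R h))"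
      using MVT2[of 0 1 \<phi> "\<lambda>\<theta>. t * (P (x + ((t * \<theta>) *\<^sub>R h + t *\<^sub>R k)) - P (x + (t * \<theta>) *\<^sub>R h))", OF _ deriv]
      by auto
    define w1 where "w1 = (t * \<theta>) *\<^sub>R h + t *\<^sub>R k"
    define w2 where "w2 = (t * \<theta>) *\<^sub>R h"
    have w: "norm w1 \<le> t * N" "norm w2 \<le> t * N"
      using small[of \<theta>] \<theta> by (auto simp: w1_def w2_def)
    have b1: "\<bar>P (x + w1) - P x - Q w1\<bar> \<le> e' * (t * N)"
      by (rule order_trans[OF _ mult_left_mono[OF w(1) less_imp_le[OF e']]])
        (use d1(2)[of "x + w1"] near[OF w(1)] in simp)
    have b2: "\<bar>P (x + w2) - P x - Q w2\<bar> \<le> e' * (t * N)"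
      by (rule order_trans[OF _ mult_left_mono[OF w(2) less_imp_le[OF e']]])
        (use d1(2)[of "x + w2"] near[OF w(2)] in simp)
    have "Q w1 = Q w2 + t * Q k"
      using linQ by (simp add: w1_def w2_def linear_add linear_cmul)
    then have "\<bar>P (x + w1) - P (x + w2) - t * Q k\<bar> \<le> 2 * (e' * (t * N))"
      using b1 b2 by linarith
    also have "\<dots> = t * (e / 2)"
      using N by (simp add: e'_def field_simps)
    finally have b: "\<bar>P (x + w1) - P (x + w2) - t * Q k\<bar> \<le> t * (e / 2)" .
    have "(G (x + t *\<^sub>R h + t *\<^sub>R k) - G (x + t *\<^sub>R h) - G (x + t *\<^sub>R k) + G x) = \<phi> 1 - \<phi> 0"
      by (simp add: \<phi>_def algebra_simps)
    also have "\<dots> = t * (P (x + w1) - P (x + w2))"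
      by (simp add: eq w1_def w2_def)
    finally have "(G (x + t *\<^sub>R h + t *\<^sub>R k) - G (x + t *\<^sub>R h) - G (x + t *\<^sub>R k) + G x) / t ^ 2 - Q k
        = t * (P (x + w1) - P (x + w2)) / t ^ 2 - Q k"
      by (simp only:)
    also have "\<dots> = (P (x + w1) - P (x + w2) - t * Q k) / t"
      using t by (simp add: field_simps power2_eq_square)
    also have "\<bar>\<dots>\<bar> \<le> e / 2"
      using b t by (simp add: abs_divide divide_le_eq mult.commute)
    finally show ?thesis
      using e by linarith
  qed
  show "\<forall>\<^sub>F t in at_right 0. dist ((G (x + t *\<^sub>R h + t *\<^sub>R k) - G (x + t *\<^sub>R h) - G (x + t *\<^sub>R k) + G x) / t ^ 2) (Q k) < e"
    unfolding eventually_at_right_field using d main by (auto simp: dist_real_def intro!: exI[of _ d])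
qed

lemma nderiv_swap_head:
  assumes g: "times_differentiable_on p g S" and S: "open S" and x: "x \<in> S"
    and len: "length hs + 2 \<le> p"
  shows "nderiv g (h # k # hs) x = nderiv g (k # h # hs) x"
proof -
  let ?G = "nderiv g hs"
  let ?\<Delta> = "\<lambda>h k t. (?G (x + t *\<^sub>R h + t *\<^sub>R k) - ?G (x + t *\<^sub>R h) - ?G (x + t *\<^sub>R k) + ?G x) / t ^ 2"
  have lim: "(?\<Delta> h k \<longlongrightarrow> nderiv g (k # h # hs) x) (at_right 0)" for h k
    using second_difference_tendsto[OF S x times_differentiable_onD[OF g, of hs], of h "nderiv g (h # hs)"]
      times_differentiable_onD[OF g, of "h # hs" x] len x by simp
  have "?\<Delta> h k = ?\<Delta> k h"
    by (simp add: algebra_simps)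
  then show ?thesis
    using tendsto_unique[OF trivial_limit_at_right_real lim[of h k]] lim[of k h] by simp
qed

lemma nderiv_swap:
  assumes g: "times_differentiable_on p g S" and S: "open S" and x: "x \<in> S"
    and len: "length hs1 + length hs2 + 2 \<le> p"
  shows "nderiv g (hs1 @ h # k # hs2) x = nderiv g (hs1 @ k # h # hs2) x"
proof -
  have "nderiv (nderiv g (h # k # hs2)) hs1 x = nderiv (nderiv g (k # h # hs2)) hs1 x"
    using len by (intro nderiv_cong_open[OF S nderiv_swap_head[OF g S] x]) auto
  then show ?thesis
    by (simp only: nderiv_append)
qed

lemma nderiv_move_last:
  assumes g: "times_differentiable_on p g S" and S: "open S" and x: "x \<in> S"
    and len: "a + b + 1 \<le> p"
  shows "nderiv g (replicate a u @ h # replicate b u) x = nderiv g (replicate (a + b) u @ [h]) x"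
  using len
proof (induction b arbitrary: a)
  case (Suc b)
  have "nderiv g (replicate a u @ h # replicate (Suc b) u) x
      = nderiv g (replicate a u @ u # h # replicate b u) x"
    using nderiv_swap[OF g S x, of "replicate a u" "replicate b u" h u] Suc.prems by simp
  also have "\<dots> = nderiv g (replicate (Suc a) u @ h # replicate b u) x"
    by (simp add: replicate_append_same flip: append_Cons)
      (metis append.assoc append_Cons append_Nil replicate_append_same)
  also have "\<dots> = nderiv g (replicate (Suc a + b) u @ [h]) x"
    using Suc.prems by (intro Suc.IH) auto
  finally show ?case
    by simp
qed auto

section \<open>Taylor polynomials of functions with Lipschitz highest derivative\<close>

text \<open>
  The family \<open>\<phi>\<close> consists of a function and its derivatives. The remainder of \<open>\<phi> 0\<close> has the
  remainder of \<open>\<phi> 1\<close> as its derivative, which the induction hypothesis bounds.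
\<close>

lemma Taylor_remainder_Lipschitz:
  fixes \<phi> :: "nat \<Rightarrow> real \<Rightarrow> real"
  assumes "\<And>i t. i < n \<Longrightarrow> 0 \<le> t \<Longrightarrow> t \<le> 1 \<Longrightarrow> (\<phi> i has_real_derivative \<phi> (Suc i) t) (at t)"
    and "\<And>t. 0 \<le> t \<Longrightarrow> t \<le> 1 \<Longrightarrow> \<bar>\<phi> n t - \<phi> n 0\<bar> \<le> C * t"
    and "0 \<le> t" "t \<le> 1"
  shows "\<bar>\<phi> 0 t - (\<Sum>i\<le>n. \<phi> i 0 * t ^ i / fact i)\<bar> \<le> C * t ^ (n + 1) / fact (n + 1)"
  using assms
proof (induction n arbitrary: \<phi> t)
  case (Suc n)
  define R where "R t = \<phi> 0 t - (\<Sum>i\<le>Suc n. \<phi> i 0 * t ^ i / fact i)" for t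
  define R' where "R' t = \<phi> 1 t - (\<Sum>i\<le>n. \<phi> (Suc i) 0 * t ^ i / fact i)" for t
  have bound: "\<bar>R' t\<bar> \<le> C * t ^ (Suc n) / fact (Suc n)" if "0 \<le> t" "t \<le> 1" for t
    using Suc.IH[of "\<lambda>i. \<phi> (Suc i)" t] Suc.prems(1,2) that by (simp add: R'_def)
  have R: "(R has_real_derivative R' t) (at t)" if "0 \<le> t" "t \<le> 1" for t
  proof -
    have "((\<lambda>t. \<phi> (Suc i) 0 * t ^ Suc i / fact (Suc i)) has_real_derivative
        \<phi> (Suc i) 0 * t ^ i / fact i) (at t)" for i
      by (rule DERIV_cong[OF DERIV_cdivide[OF DERIV_cmult[OF DERIV_pow]]])
        (simp add: field_simps del: of_nat_Suc power_Suc)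
    then have "((\<lambda>t. \<phi> 0 t - (\<phi> 0 0 + (\<Sum>i\<le>n. \<phi> (Suc i) 0 * t ^ Suc i / fact (Suc i))))
        has_real_derivative \<phi> 1 t - (0 + (\<Sum>i\<le>n. \<phi> (Suc i) 0 * t ^ i / fact i))) (at t)"
      using Suc.prems(1)[of 0 t] that
      by (intro DERIV_diff DERIV_add DERIV_sum DERIV_const) auto
    moreover have "R = (\<lambda>t. \<phi> 0 t - (\<phi> 0 0 + (\<Sum>i\<le>n. \<phi> (Suc i) 0 * t ^ Suc i / fact (Suc i))))"
      by (simp add: R_def[abs_def] sum.atMost_Suc_shift del: sum.atMost_Suc power_Suc fact_Suc)
    ultimately show ?thesis
      by (simp add: R'_def)
  qed
  have Q: "((\<lambda>t. C * t ^ (Suc (Suc n)) / fact (Suc (Suc n))) has_real_derivative C * t ^ (Suc n) / fact (Suc n)) (at t)" for t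
    by (rule DERIV_cong[OF DERIV_cdivide[OF DERIV_cmult[OF DERIV_pow]]])
      (simp add: field_simps del: of_nat_Suc power_Suc)
  have R0: "R 0 = 0"
    by (simp add: R_def sum.atMost_Suc_shift del: sum.atMost_Suc)
  have "C * 0 ^ (Suc (Suc n)) / fact (Suc (Suc n)) - R 0 \<le> C * t ^ (Suc (Suc n)) / fact (Suc (Suc n)) - R t"
  proof (rule DERIV_nonneg_imp_nondecreasing[OF \<open>0 \<le> t\<close>])
    fix s
    assume "0 \<le> s" "s \<le> t"
    then show "\<exists>y. ((\<lambda>t. C * t ^ (Suc (Suc n)) / fact (Suc (Suc n)) - R t) has_real_derivative y) (at s) \<and> 0 \<le> y"
      using bound[of s] \<open>t \<le> 1\<close>
      by (intro exI[of _ "C * s ^ Suc n / fact (Suc n) - R' s"] conjI DERIV_diff Q R) auto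
  qed
  moreover have "C * 0 ^ (Suc (Suc n)) / fact (Suc (Suc n)) + R 0 \<le> C * t ^ (Suc (Suc n)) / fact (Suc (Suc n)) + R t"
  proof (rule DERIV_nonneg_imp_nondecreasing[OF \<open>0 \<le> t\<close>])
    fix s
    assume "0 \<le> s" "s \<le> t"
    then show "\<exists>y. ((\<lambda>t. C * t ^ (Suc (Suc n)) / fact (Suc (Suc n)) + R t) has_real_derivative y) (at s) \<and> 0 \<le> y"
      using bound[of s] \<open>t \<le> 1\<close>
      by (intro exI[of _ "C * s ^ Suc n / fact (Suc n) + R' s"] conjI DERIV_add Q R) auto
  qed
  ultimately have "\<bar>R t\<bar> \<le> C * t ^ (Suc (Suc n)) / fact (Suc (Suc n))"
    using R0 by (simp add: abs_le_iff del: fact_Suc power_Suc)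
  then show ?case
    by (simp add: R_def del: fact_Suc power_Suc sum.atMost_Suc)
qed auto

text \<open>
  The hypotheses on \<open>f\<close> in the form in which the contracted functions inherit them.
\<close>

locale smooth_function = spd_geometry B
  for B :: "'a::euclidean_space \<Rightarrow> 'a \<Rightarrow> real" +
  fixes p :: nat and S :: "'a set" and g :: "'a \<Rightarrow> real" and Lg :: real
  assumes p: "p \<ge> 1" and Lg_nonneg: "Lg \<ge> 0" and S_open: "open S" and S_convex: "convex S"
    and differentiable: "times_differentiable_on p g S"
    and Lipschitz: "\<And>y w. y \<in> S \<Longrightarrow> w \<in> S \<Longrightarrow>
      form_norm B p (\<lambda>hs. nderiv g hs y - nderiv g hs w) \<le> Lg * bnorm B (y - w)"
begin

lemma abs_nderiv_diff_le:
  assumes "y \<in> S" "w \<in> S" "length hs = p"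
  shows "\<bar>nderiv g hs y - nderiv g hs w\<bar> \<le> Lg * bnorm B (y - w) * prod_list (map (bnorm B) hs)"
proof -
  have "multilinear_form p (\<lambda>hs. nderiv g hs y - nderiv g hs w)"
    by (intro multilinear_form_diff multilinear_form_nderiv[OF differentiable S_open] assms order_refl)
  from abs_le_form_norm[OF this assms(3) p]
  have "\<bar>nderiv g hs y - nderiv g hs w\<bar>
      \<le> form_norm B p (\<lambda>hs. nderiv g hs y - nderiv g hs w) * prod_list (map (bnorm B) hs)" .
  also have "\<dots> \<le> Lg * bnorm B (y - w) * prod_list (map (bnorm B) hs)"
    by (intro mult_right_mono Lipschitz assms prod_list_bnorm_nonneg)
  finally show ?thesis .
qed

text \<open>
  Both the value and the derivatives of \<open>g\<close> are Taylor expanded by this lemma, with \<open>hs\<close> empty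
  and \<open>hs\<close> a single direction.
\<close>

lemma nderiv_Taylor:
  assumes x: "x \<in> S" and y: "y \<in> S" and n: "n + length hs = p"
  shows "\<bar>nderiv g hs y - (\<Sum>i\<le>n. nderiv g (replicate i (y - x) @ hs) x / fact i)\<bar>
    \<le> Lg * bnorm B (y - x) ^ (n + 1) * prod_list (map (bnorm B) hs) / fact (n + 1)"
proof -
  define u where "u = y - x"
  define \<phi> where "\<phi> i t = nderiv g (replicate i u @ hs) (x + t *\<^sub>R u)" for i and t :: real
  have seg: "x + t *\<^sub>R u \<in> S" if "0 \<le> t" "t \<le> 1" for t
    using convexD_alt[OF S_convex x y that] by (simp add: u_def algebra_simps)
  have deriv: "(\<phi> i has_real_derivative \<phi> (Suc i) t) (at t)" if "i < n" "0 \<le> t" "t \<le> 1" for i t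
  proof -
    have G: "(nderiv g (replicate i u @ hs) has_derivative
        frechet_derivative (nderiv g (replicate i u @ hs)) (at (x + t *\<^sub>R u))) (at (x + t *\<^sub>R u))"
      using seg[OF that(2,3)] that n by (intro times_differentiable_onD[OF differentiable]) auto
    have "(\<phi> i has_derivative
        (\<lambda>c. frechet_derivative (nderiv g (replicate i u @ hs)) (at (x + t *\<^sub>R u)) (c *\<^sub>R u))) (at t)"
      unfolding \<phi>_def
      by (rule has_derivative_compose[of "\<lambda>t. x + t *\<^sub>R u" "\<lambda>c. c *\<^sub>R u" t UNIV, OF _ G]) (auto intro!: derivative_eq_intros)
    then show ?thesis
      using linear_cmul[OF has_derivative_linear[OF G]]
      by (simp add: has_field_derivative_def \<phi>_def mult.commute[of _ "frechet_derivative _ _ _"] cong: if_cong)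
  qed
  have "\<bar>\<phi> n t - \<phi> n 0\<bar> \<le> (Lg * bnorm B u ^ (n + 1) * prod_list (map (bnorm B) hs)) * t"
    if "0 \<le> t" "t \<le> 1" for t
    using abs_nderiv_diff_le[OF seg[OF that] x, of "replicate n u @ hs"] n that
    by (simp add: \<phi>_def map_replicate prod_list_replicate mult_ac)
  from Taylor_remainder_Lipschitz[of n \<phi>, OF deriv this, of 1]
  show ?thesis
    by (simp add: \<phi>_def u_def)
qed

lemma abs_diff_taylor_le:
  assumes "x \<in> S" "y \<in> S"
  shows "\<bar>g y - taylor p g x y\<bar> \<le> Lg * bnorm B (y - x) ^ (p + 1) / fact (p + 1)"
proof -
  have "(\<Sum>i\<le>p. nderiv g (replicate i (y - x)) x / fact i) = taylor p g x y"
    unfolding taylor_def by (simp add: sum.atMost_shift atLeast1_lessThan_eq_remove0 lessThan_Suc_atMost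
        sum.atLeast_Suc_atMost atMost_atLeast0)
  then show ?thesis
    using nderiv_Taylor[OF assms, of p "[]"] by simp
qed

text \<open>
  By symmetry the \<open>i\<close> slots of the \<open>i\<close>-th term contribute equally, which reduces \<open>1 / i!\<close> to
  \<open>1 / (i - 1)!\<close>.
\<close>

lemma taylor_has_derivative:
  assumes x: "x \<in> S"
  shows "(taylor p g x has_derivative
    (\<lambda>h. \<Sum>i\<le>p - 1. nderiv g (replicate i (y - x) @ [h]) x / fact i)) (at y)"
proof -
  have D: "((\<lambda>y. nderiv g (replicate i (y - x)) x / fact i) has_derivative
      (\<lambda>h. nderiv g (replicate (i - 1) (y - x) @ [h]) x / fact (i - 1))) (at y)"
    if i: "i \<in> {1..p}" for i
  proof -
    have W: "multilinear_form i (\<lambda>hs. nderiv g hs x)"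
      using i by (intro multilinear_form_nderiv[OF differentiable S_open x]) auto
    have "((\<lambda>y. nderiv g (replicate i (y - x)) x / fact i) has_derivative
        (\<lambda>h. (\<Sum>j<i. nderiv g (replicate j (y - x) @ h # replicate (i - 1 - j) (y - x)) x) / fact i)) (at y)"
      by (intro bounded_linear.has_derivative[OF bounded_linear_divide]
          has_derivative_compose[of "\<lambda>y. y - x" "\<lambda>h. h" y UNIV, OF _ multilinear_form_has_derivative[OF W]])
        (auto intro!: derivative_eq_intros)
    moreover have "(\<Sum>j<i. nderiv g (replicate j (y - x) @ h # replicate (i - 1 - j) (y - x)) x) / fact i
        = nderiv g (replicate (i - 1) (y - x) @ [h]) x / fact (i - 1)" for h
    proof -
      have "(\<Sum>j<i. nderiv g (replicate j (y - x) @ h # replicate (i - 1 - j) (y - x)) x)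
          = (\<Sum>j<i. nderiv g (replicate (i - 1) (y - x) @ [h]) x)"
        using i by (intro sum.cong refl) (subst nderiv_move_last[OF differentiable S_open x], auto)
      then show ?thesis
        using i by (simp add: fact_reduce[of i])
    qed
    ultimately show ?thesis
      by simp
  qed
  have "(taylor p g x has_derivative
      (\<lambda>h. 0 + (\<Sum>i=1..p. nderiv g (replicate (i - 1) (y - x) @ [h]) x / fact (i - 1)))) (at y)"
    unfolding taylor_def by (intro has_derivative_add has_derivative_const has_derivative_sum D)
  moreover have "(\<Sum>i=1..p. nderiv g (replicate (i - 1) (y - x) @ [h]) x / fact (i - 1)) =
      (\<Sum>i\<le>p - 1. nderiv g (replicate i (y - x) @ [h]) x / fact i)" for h
    using p by (intro sum.reindex_bij_witness[of _ Suc "\<lambda>i. i - 1"]) auto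
  ultimately show ?thesis
    by simp
qed

lemma abs_diff_taylor_derivative_le:
  assumes "x \<in> S" "y \<in> S"
  shows "\<bar>frechet_derivative g (at y) h - frechet_derivative (taylor p g x) (at y) h\<bar>
    \<le> Lg * bnorm B (y - x) ^ p * bnorm B h / fact p"
  using nderiv_Taylor[OF assms, of "p - 1" "[h]"] p
    frechet_derivative_at[OF taylor_has_derivative[OF assms(1)], of y, symmetric]
  by simp

end

lemma open_affine_preimage:
  fixes U :: "'a::real_normed_vector set"
  assumes "open U"
  shows "open {y. \<alpha> *\<^sub>R y + b \<in> U}"
proof -
  have "continuous_on UNIV (\<lambda>y. \<alpha> *\<^sub>R y + b)"
    by (intro continuous_intros)
  from open_vimage[OF assms this] show ?thesis
    by (simp add: vimage_def)
qed

text \<open>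
  The contracted functions are affine substitutions of \<open>f\<close>, and \<open>\<alpha> = a / A\<close> enters the Lipschitz
  constant with the power \<open>p + 1\<close>.
\<close>

lemma nderiv_affine:
  assumes f: "times_differentiable_on p f U" and U: "open U"
    and hs: "length hs \<le> p" and y: "\<alpha> *\<^sub>R y + b \<in> U"
  shows "nderiv (\<lambda>x. c * f (\<alpha> *\<^sub>R x + b)) hs y = c * \<alpha> ^ length hs * nderiv f hs (\<alpha> *\<^sub>R y + b)"
    and "length hs < p \<Longrightarrow> nderiv (\<lambda>x. c * f (\<alpha> *\<^sub>R x + b)) hs differentiable (at y)"
proof -
  let ?g = "\<lambda>x. c * f (\<alpha> *\<^sub>R x + b)" and ?V = "{y. \<alpha> *\<^sub>R y + b \<in> U}"
  have V: "open ?V"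
    by (rule open_affine_preimage[OF U])
  have D: "((\<lambda>y. c * \<alpha> ^ length hs * nderiv f hs (\<alpha> *\<^sub>R y + b)) has_derivative
      (\<lambda>h. c * \<alpha> ^ Suc (length hs) * nderiv f (h # hs) (\<alpha> *\<^sub>R y + b))) (at y)"
    if "length hs < p" "y \<in> ?V" for hs y
  proof -
    have F: "(nderiv f hs has_derivative frechet_derivative (nderiv f hs) (at (\<alpha> *\<^sub>R y + b))) (at (\<alpha> *\<^sub>R y + b))"
      using that by (intro times_differentiable_onD[OF f]) auto
    have "((\<lambda>y. c * \<alpha> ^ length hs * nderiv f hs (\<alpha> *\<^sub>R y + b)) has_derivative
        (\<lambda>h. c * \<alpha> ^ length hs * frechet_derivative (nderiv f hs) (at (\<alpha> *\<^sub>R y + b)) (\<alpha> *\<^sub>R h))) (at y)"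
      by (intro has_derivative_mult_right
          has_derivative_compose[of "\<lambda>y. \<alpha> *\<^sub>R y + b" "\<lambda>h. \<alpha> *\<^sub>R h" y UNIV, OF _ F])
        (auto intro!: derivative_eq_intros)
    then show ?thesis
      using linear_cmul[OF has_derivative_linear[OF F], of \<alpha>] by (simp add: mult_ac)
  qed
  have eq: "nderiv ?g hs y = c * \<alpha> ^ length hs * nderiv f hs (\<alpha> *\<^sub>R y + b)"
    if "length hs \<le> p" "y \<in> ?V" for hs y
    using that
  proof (induction hs arbitrary: y)
    case (Cons h hs)
    have "frechet_derivative (nderiv ?g hs) (at y) =
        frechet_derivative (\<lambda>y. c * \<alpha> ^ length hs * nderiv f hs (\<alpha> *\<^sub>R y + b)) (at y)"
      using Cons by (intro frechet_derivative_cong_open[OF V]) auto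
    also have "\<dots> = (\<lambda>h. c * \<alpha> ^ Suc (length hs) * nderiv f (h # hs) (\<alpha> *\<^sub>R y + b))"
      using Cons.prems by (intro frechet_derivative_at[OF D, symmetric]) auto
    finally show ?case
      by simp
  qed simp
  show "nderiv ?g hs y = c * \<alpha> ^ length hs * nderiv f hs (\<alpha> *\<^sub>R y + b)"
    using eq hs y by simp
  show "nderiv ?g hs differentiable (at y)" if "length hs < p"
  proof -
    have "(nderiv ?g hs has_derivative
        (\<lambda>h. c * \<alpha> ^ Suc (length hs) * nderiv f (h # hs) (\<alpha> *\<^sub>R y + b))) (at y)"
      by (rule has_derivative_transform_within_open[OF D[OF that] V]) (use y eq that in auto)
    then show ?thesis
      by (auto simp: differentiable_def)
  qed
qed

context spd_geometry
begin

lemma form_norm_le: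
  assumes "\<And>hs. length hs = n \<Longrightarrow> prod_list (map (bnorm B) hs) \<le> 1 \<Longrightarrow> W hs \<le> K"
  shows "form_norm B n W \<le> K"
  unfolding form_norm_def
proof (rule cSUP_least)
  show "{hs. length hs = n \<and> (\<forall>h\<in>set hs. bnorm B h \<le> 1)} \<noteq> {}"
    by (intro ex_in_conv[THEN iffD1] exI[of _ "replicate n 0"]) auto
  fix hs
  assume hs: "hs \<in> {hs. length hs = n \<and> (\<forall>h\<in>set hs. bnorm B h \<le> 1)}"
  then have "prod_list (map (bnorm B) hs) \<le> 1"
    by (intro prod_list_bnorm_le_one) simp
  then show "W hs \<le> K"
    using assms hs by simp
qed

end

context smooth_function
begin

lemma smooth_function_affine:
  assumes c: "c \<ge> 0" and \<alpha>: "\<alpha> \<ge> 0"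
  shows "smooth_function B p {y. \<alpha> *\<^sub>R y + b \<in> S} (\<lambda>x. c * g (\<alpha> *\<^sub>R x + b)) (c * \<alpha> ^ (p + 1) * Lg)"
proof
  show "0 \<le> c * \<alpha> ^ (p + 1) * Lg"
    using c \<alpha> Lg_nonneg by simp
  show "open {y. \<alpha> *\<^sub>R y + b \<in> S}"
    by (rule open_affine_preimage[OF S_open])
  show "convex {y. \<alpha> *\<^sub>R y + b \<in> S}"
  proof (rule convexI)
    fix x y and u w :: real
    assume xy: "x \<in> {y. \<alpha> *\<^sub>R y + b \<in> S}" "y \<in> {y. \<alpha> *\<^sub>R y + b \<in> S}" "0 \<le> u" "0 \<le> w" "u + w = 1"
    have "\<alpha> *\<^sub>R (u *\<^sub>R x + w *\<^sub>R y) + (u + w) *\<^sub>R b = u *\<^sub>R (\<alpha> *\<^sub>R x + b) + w *\<^sub>R (\<alpha> *\<^sub>R y + b)"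
      by (simp add: algebra_simps)
    then show "u *\<^sub>R x + w *\<^sub>R y \<in> {y. \<alpha> *\<^sub>R y + b \<in> S}"
      using convexD[OF S_convex, of "\<alpha> *\<^sub>R x + b" "\<alpha> *\<^sub>R y + b" u w] xy by simp
  qed
  show "times_differentiable_on p (\<lambda>x. c * g (\<alpha> *\<^sub>R x + b)) {y. \<alpha> *\<^sub>R y + b \<in> S}"
    unfolding times_differentiable_on_def
    using nderiv_affine(2)[OF differentiable S_open] by auto
  fix y w
  assume yw: "y \<in> {y. \<alpha> *\<^sub>R y + b \<in> S}" "w \<in> {y. \<alpha> *\<^sub>R y + b \<in> S}"
  let ?g = "\<lambda>x. c * g (\<alpha> *\<^sub>R x + b)"
  show "form_norm B p (\<lambda>hs. nderiv ?g hs y - nderiv ?g hs w) \<le> c * \<alpha> ^ (p + 1) * Lg * bnorm B (y - w)"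
  proof (rule form_norm_le)
    fix hs :: "'a list"
    assume hs: "length hs = p" "prod_list (map (bnorm B) hs) \<le> 1"
    let ?y = "\<alpha> *\<^sub>R y + b" and ?w = "\<alpha> *\<^sub>R w + b"
    have L0: "0 \<le> Lg * bnorm B (?y - ?w)"
      using Lg_nonneg by simp
    have "nderiv ?g hs y - nderiv ?g hs w = c * \<alpha> ^ p * (nderiv g hs ?y - nderiv g hs ?w)"
      using nderiv_affine(1)[OF differentiable S_open, of hs \<alpha> _ b c] yw hs by (simp add: algebra_simps)
    also have "\<dots> \<le> c * \<alpha> ^ p * (Lg * bnorm B (?y - ?w) * prod_list (map (bnorm B) hs))"
      using abs_nderiv_diff_le[of ?y ?w hs] yw hs c \<alpha> by (intro mult_left_mono) auto
    also have "\<dots> \<le> c * \<alpha> ^ p * (Lg * bnorm B (?y - ?w) * 1)"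
      using c \<alpha> hs L0 by (intro mult_left_mono) auto
    also have "bnorm B (?y - ?w) = \<alpha> * bnorm B (y - w)"
      using bnorm_scale[of \<alpha> "y - w"] \<alpha> by (simp add: scaleR_right_diff_distrib)
    finally show "nderiv ?g hs y - nderiv ?g hs w \<le> c * \<alpha> ^ (p + 1) * Lg * bnorm B (y - w)"
      by (simp add: mult_ac)
  qed
qed (rule p)

end

section \<open>First-order conditions and existence of minimizers\<close>

lemma directional_derivative_tendsto:
  fixes G :: "'a::real_normed_vector \<Rightarrow> real"
  assumes "(G has_derivative D) (at x)"
  shows "((\<lambda>t. (G (x + t *\<^sub>R u) - G x) / t) \<longlongrightarrow> D u) (at_right 0)"
proof -
  have G: "(G has_derivative D) (at (x + 0 *\<^sub>R u))"
    using assms by simp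
  have "((\<lambda>t. G (x + t *\<^sub>R u)) has_derivative (\<lambda>c. D (c *\<^sub>R u))) (at 0)"
    by (rule has_derivative_compose[of "\<lambda>t. x + t *\<^sub>R u" "\<lambda>c. c *\<^sub>R u" 0 UNIV, OF _ G])
      (auto intro!: derivative_eq_intros)
  moreover have "D (c *\<^sub>R u) = D u * c" for c
    using linear_cmul[OF has_derivative_linear[OF assms]] by simp
  ultimately have "((\<lambda>t. G (x + t *\<^sub>R u)) has_real_derivative D u) (at 0)"
    by (simp add: has_field_derivative_def)
  then have "((\<lambda>t. (G (x + t *\<^sub>R u) - G x) / t) \<longlongrightarrow> D u) (at 0)"
    by (simp add: has_field_derivative_iff)
  then show ?thesis
    by (rule filterlim_mono) (auto simp: at_within_le_at)
qed

lemma convex_on_above_tangent: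
  fixes G :: "'a::real_normed_vector \<Rightarrow> real"
  assumes G: "convex_on S G" "(G has_derivative D) (at x)" and xy: "x \<in> S" "y \<in> S"
  shows "G y \<ge> G x + D (y - x)"
proof -
  have "D (y - x) \<le> G y - G x"
  proof (rule tendsto_upperbound[OF directional_derivative_tendsto[OF G(2)]])
    show "\<forall>\<^sub>F t in at_right 0. (G (x + t *\<^sub>R (y - x)) - G x) / t \<le> G y - G x"
      unfolding eventually_at_right_field
    proof (intro exI[of _ 1] conjI allI impI)
      fix t :: real
      assume t: "0 < t" "t < 1"
      have "G ((1 - t) *\<^sub>R x + t *\<^sub>R y) \<le> (1 - t) * G x + t * G y"
        using convex_onD[OF G(1), of t x y] t xy by simp
      then have "G (x + t *\<^sub>R (y - x)) - G x \<le> t * (G y - G x)"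
        by (simp add: algebra_simps)
      then show "(G (x + t *\<^sub>R (y - x)) - G x) / t \<le> G y - G x"
        using t by (simp add: divide_le_eq mult.commute)
    qed simp
  qed simp
  then show ?thesis
    by simp
qed

definition real_part :: "('a \<Rightarrow> ereal) \<Rightarrow> 'a \<Rightarrow> real" where
  "real_part \<psi> y = real_of_ereal (\<psi> y)"

locale closed_convex =
  fixes \<psi> :: "'a::euclidean_space \<Rightarrow> ereal"
  assumes psi: "proper_closed_convex \<psi>"
begin

lemma psi_eq: "y \<in> edom \<psi> \<Longrightarrow> \<psi> y = ereal (real_part \<psi> y)"
  using psi by (cases "\<psi> y") (auto simp: proper_closed_convex_def edom_def real_part_def)

lemma psi_infty: "y \<notin> edom \<psi> \<Longrightarrow> \<psi> y = \<infinity>"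
  by (simp add: edom_def)

lemma in_epi_iff: "(y, r) \<in> epi \<psi> \<longleftrightarrow> y \<in> edom \<psi> \<and> real_part \<psi> y \<le> r"
  by (cases "y \<in> edom \<psi>") (simp_all add: epi_def psi_eq psi_infty)

lemma convex_on_real_part: "convex_on (edom \<psi>) (real_part \<psi>)"
proof -
  have "u *\<^sub>R x + w *\<^sub>R y \<in> edom \<psi> \<and>
      real_part \<psi> (u *\<^sub>R x + w *\<^sub>R y) \<le> u * real_part \<psi> x + w * real_part \<psi> y"
    if "x \<in> edom \<psi>" "y \<in> edom \<psi>" "0 \<le> u" "0 \<le> w" "u + w = 1" for x y u w
  proof -
    have "u *\<^sub>R (x, real_part \<psi> x) + w *\<^sub>R (y, real_part \<psi> y) \<in> epi \<psi>"
      using that psi by (intro convexD) (auto simp: proper_closed_convex_def in_epi_iff)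
    then show ?thesis
      by (simp add: in_epi_iff)
  qed
  then show ?thesis
    by (auto simp: convex_on_def convex_def)
qed

lemma convex_edom: "convex (edom \<psi>)"
  using convex_on_real_part by (simp add: convex_on_def)

text \<open>
  On a segment leaving the minimizer the convex part changes at most linearly, so in the
  difference quotients only \<open>G\<close> is differentiated.
\<close>

lemma minimizer_subgradient:
  assumes T: "T \<in> edom \<psi>" and a: "a > 0" and G: "(G has_derivative D) (at T)"
    and min: "\<And>y. y \<in> edom \<psi> \<Longrightarrow> G T + a * real_part \<psi> T \<le> G y + a * real_part \<psi> y"
  shows "(\<lambda>h. - (D h / a)) \<in> subdifferential \<psi> T"
proof -
  have lin: "linear D"
    using G by (rule has_derivative_linear)
  have ge: "D (y - T) \<ge> a * (real_part \<psi> T - real_part \<psi> y)" if y: "y \<in> edom \<psi>" for y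
  proof (rule tendsto_lowerbound[OF directional_derivative_tendsto[OF G]])
    show "\<forall>\<^sub>F t in at_right 0. a * (real_part \<psi> T - real_part \<psi> y) \<le> (G (T + t *\<^sub>R (y - T)) - G T) / t"
      unfolding eventually_at_right_field
    proof (intro exI[of _ 1] conjI allI impI)
      fix t :: real
      assume t: "0 < t" "t < 1"
      have eq: "(1 - t) *\<^sub>R T + t *\<^sub>R y = T + t *\<^sub>R (y - T)"
        by (simp add: algebra_simps)
      have "T + t *\<^sub>R (y - T) \<in> edom \<psi>"
        using convexD_alt[OF convex_edom T y, of t] t by (simp add: eq)
      from min[OF this] have "a * real_part \<psi> T - a * real_part \<psi> (T + t *\<^sub>R (y - T))
          \<le> G (T + t *\<^sub>R (y - T)) - G T"
        by simp
      moreover have "real_part \<psi> (T + t *\<^sub>R (y - T)) \<le> (1 - t) * real_part \<psi> T + t * real_part \<psi> y"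
        using convex_onD[OF convex_on_real_part, of t T y] t T y by (simp add: eq)
      then have "a * real_part \<psi> (T + t *\<^sub>R (y - T)) \<le> a * ((1 - t) * real_part \<psi> T + t * real_part \<psi> y)"
        using a by simp
      ultimately have "t * (a * (real_part \<psi> T - real_part \<psi> y)) \<le> G (T + t *\<^sub>R (y - T)) - G T"
        by (simp add: algebra_simps)
      then show "a * (real_part \<psi> T - real_part \<psi> y) \<le> (G (T + t *\<^sub>R (y - T)) - G T) / t"
        using t by (simp add: le_divide_eq mult.commute)
    qed simp
  qed simp
  have "\<psi> T + ereal (- (D (y - T) / a)) \<le> \<psi> y" for y
  proof (cases "y \<in> edom \<psi>")
    case True
    then show ?thesis
      using ge[OF True] a by (simp add: psi_eq T field_simps)
  qed (simp add: psi_infty)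
  moreover have "linear (\<lambda>h. - (D h / a))"
    using lin by (intro linearI) (simp_all add: linear_add linear_cmul add_divide_distrib)
  ultimately show ?thesis
    by (simp add: subdifferential_def)
qed

end

text \<open>
  The minimum is taken over a compact slice of the epigraph rather than over a sublevel set of
  the domain: the height \<open>r\<close> replaces \<open>\<psi> y\<close>, which is only lower semicontinuous, and the
  slice is closed even where the domain is not.
\<close>

lemma (in spd_geometry) exists_minimizer:
  fixes \<psi> :: "'a \<Rightarrow> ereal"
  assumes psi: "proper_closed_convex \<psi>" and a: "a > 0" and \<kappa>: "\<kappa> > 0" and c: "c \<in> edom \<psi>"
    and Q_cont: "continuous_on (edom \<psi>) Q"
    and Q_ge: "\<And>y. y \<in> edom \<psi> \<Longrightarrow>
      Q y \<ge> \<kappa> * bnorm B (y - c) ^ (p + 1) - C * (1 + bnorm B (y - c) ^ p)"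
    and psi_ge: "\<And>y. y \<in> edom \<psi> \<Longrightarrow> real_part \<psi> y \<ge> - C' * (1 + bnorm B (y - c) ^ p)"
  shows "\<exists>T\<in>edom \<psi>. \<forall>y\<in>edom \<psi>. Q T + a * real_part \<psi> T \<le> Q y + a * real_part \<psi> y"
proof -
  interpret closed_convex \<psi>
    by unfold_locales (rule psi)
  define m where "m = Q c + a * real_part \<psi> c"
  \<comment> \<open>Beyond radius \<open>R\<close> the term of degree \<open>p + 1\<close> exceeds all others, whose coefficients add up to \<open>K\<close>.\<close>
  define K where "K = \<bar>C\<bar> + a * \<bar>C'\<bar> + \<bar>m\<bar>"
  define R where "R = 1 + 2 * K / \<kappa>"
  define R1 where "R1 = \<bar>C'\<bar> * (1 + R ^ p)"
  define R2 where "R2 = (\<bar>m\<bar> + \<bar>C\<bar> * (1 + R ^ p)) / a"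
  have K: "K \<ge> 0"
    using a by (simp add: K_def)
  have R: "R \<ge> 1"
    using K \<kappa> by (simp add: R_def)
  define E where "E = epi \<psi> \<inter> {z. bnorm B (fst z - c) \<le> R} \<inter> {z. snd z \<in> {- R1..R2}}"
  have sub: "bnorm B (y - c) \<le> R \<and> real_part \<psi> y \<in> {- R1..R2}"
    if y: "y \<in> edom \<psi>" and le: "Q y + a * real_part \<psi> y \<le> m" for y
  proof -
    let ?r = "bnorm B (y - c)"
    have C1: "C * (1 + ?r ^ p) \<le> \<bar>C\<bar> * (1 + ?r ^ p)" "- (\<bar>C'\<bar> * (1 + ?r ^ p)) \<le> - C' * (1 + ?r ^ p)"
      using mult_right_mono[OF abs_ge_self[of C], of "1 + ?r ^ p"]
        mult_right_mono[OF abs_ge_self[of C'], of "1 + ?r ^ p"] by simp_all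
    have r: "?r \<le> R"
    proof (rule ccontr)
      assume "\<not> ?r \<le> R"
      then have "?r > R" by simp
      then have "?r > 1" "K * 2 < \<kappa> * ?r"
        using R K \<kappa> by (linarith, simp add: R_def field_simps)
      have "a * (- (\<bar>C'\<bar> * (1 + ?r ^ p))) \<le> a * real_part \<psi> y"
        using psi_ge[OF y] C1(2) a by (intro mult_left_mono) auto
      then have "\<kappa> * ?r ^ (p + 1) \<le> \<bar>C\<bar> * (1 + ?r ^ p) + a * (\<bar>C'\<bar> * (1 + ?r ^ p)) + \<bar>m\<bar>"
        using Q_ge[OF y] C1(1) le by linarith
      also have "\<bar>m\<bar> \<le> \<bar>m\<bar> * (1 + ?r ^ p)"
        using mult_left_mono[of 1 "1 + ?r ^ p" "\<bar>m\<bar>"] by simp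
      also have "\<bar>C\<bar> * (1 + ?r ^ p) + a * (\<bar>C'\<bar> * (1 + ?r ^ p)) + \<bar>m\<bar> * (1 + ?r ^ p) = K * (1 + ?r ^ p)"
        by (simp add: K_def algebra_simps)
      also have "\<dots> \<le> K * (2 * ?r ^ p)"
        using one_le_power[of ?r p] \<open>?r > 1\<close> K by (intro mult_left_mono) auto
      also have "\<dots> < \<kappa> * ?r * ?r ^ p"
        using mult_strict_right_mono[OF \<open>K * 2 < \<kappa> * ?r\<close> zero_less_power[of ?r p]] \<open>?r > 1\<close>
        unfolding mult.assoc by linarith
      finally show False
        by simp
    qed
    have rp: "1 + ?r ^ p \<le> 1 + R ^ p"
      using r by (simp add: power_mono)
    have "\<bar>C'\<bar> * (1 + ?r ^ p) \<le> R1" "\<bar>C\<bar> * (1 + ?r ^ p) \<le> \<bar>C\<bar> * (1 + R ^ p)"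
      unfolding R1_def using rp by (intro mult_left_mono; simp)+
    moreover have "0 \<le> \<kappa> * ?r ^ (p + 1)"
      using \<kappa> by simp
    ultimately have "- R1 \<le> real_part \<psi> y" "a * real_part \<psi> y \<le> \<bar>m\<bar> + \<bar>C\<bar> * (1 + R ^ p)"
      using psi_ge[OF y] Q_ge[OF y] C1 le by linarith+
    then show ?thesis
      using r a by (simp add: R2_def le_divide_eq mult.commute)
  qed
  have "closed {z. bnorm B (fst z - c) \<le> R}"
    by (intro closed_Collect_le continuous_intros)
  moreover have "closed {z. snd z \<in> {- R1..R2}}" for R1 R2 :: real
    unfolding atLeastAtMost_iff by (intro closed_Collect_conj closed_Collect_le continuous_intros)
  ultimately have "closed E"
    using psi unfolding E_def proper_closed_convex_def by (intro closed_Int) auto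
  moreover have "bounded E"
  proof -
    have "bounded (cbox (- R1) R2)" "bounded {y. bnorm B (y - c) \<le> R}"
      using bounded_if_bnorm_bounded[of "{y. bnorm B (y - c) \<le> R}" c R] by auto
    then have "bounded ({y. bnorm B (y - c) \<le> R} \<times> cbox (- R1) R2)"
      by (intro bounded_Times)
    then show ?thesis
      by (rule bounded_subset) (auto simp: E_def)
  qed
  ultimately have "compact E"
    by (simp add: compact_eq_bounded_closed)
  moreover have "(c, real_part \<psi> c) \<in> E"
    using sub[OF c] c by (auto simp: E_def in_epi_iff m_def)
  moreover have "continuous_on E (\<lambda>z. Q (fst z) + a * snd z)"
    by (intro continuous_intros continuous_on_compose2[OF Q_cont])
      (auto simp: E_def in_epi_iff)
  ultimately obtain z where z: "z \<in> E" "\<And>w. w \<in> E \<Longrightarrow> Q (fst z) + a * snd z \<le> Q (fst w) + a * snd w"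
    using continuous_attains_inf[of E "\<lambda>z. Q (fst z) + a * snd z"] by blast
  have T: "fst z \<in> edom \<psi>" "real_part \<psi> (fst z) \<le> snd z"
    using z(1) in_epi_iff[of "fst z" "snd z"] by (auto simp: E_def)
  then have "Q (fst z) + a * real_part \<psi> (fst z) \<le> Q (fst z) + a * snd z"
    using a by simp
  moreover have "Q (fst z) + a * snd z \<le> Q y + a * real_part \<psi> y" if y: "y \<in> edom \<psi>" for y
  proof (cases "Q y + a * real_part \<psi> y \<le> m")
    case True
    then have "(y, real_part \<psi> y) \<in> E"
      using sub[OF y True] y by (simp add: E_def in_epi_iff)
    then show ?thesis
      using z(2) by fastforce
  next
    case False
    then show ?thesis
      using z(2)[OF \<open>(c, real_part \<psi> c) \<in> E\<close>] by (simp add: m_def)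
  qed
  ultimately show ?thesis
    using T(1) by (meson order_trans)
qed

lemma power_le_one_plus_power:
  fixes r :: real
  assumes "0 \<le> r" "i \<le> p"
  shows "r ^ i \<le> 1 + r ^ p"
proof (cases "r \<le> 1")
  case True
  then show ?thesis
    using power_le_one[OF assms(1) True, of i] zero_le_power[OF assms(1), of p] by linarith
next
  case False
  then show ?thesis
    using power_increasing[OF assms(2), of r] by linarith
qed

section \<open>Tensor steps on a regularized subproblem\<close>

text \<open>
  A subproblem of the method: the smooth part \<open>g\<close>, the nonsmooth part \<open>a \<psi>\<close> and a Bregman
  distance weighted by \<open>\<gamma>\<close>. The minorant of \<open>\<psi>\<close> is there for the existence of minimizers.
\<close>

locale subproblem = smooth_function B p S g Lg + closed_convex \<psi>
  for B :: "'a::euclidean_space \<Rightarrow> 'a \<Rightarrow> real" and p S g Lg \<psi> +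
  fixes a \<gamma> \<sigma> :: real and x0 v :: 'a
  assumes Lg_pos: "Lg > 0" and a_pos: "a > 0" and gamma_pos: "\<gamma> > 0" and sigma_pos: "\<sigma> > 0"
    and g_convex: "convex_on S g" and edom_sub: "edom \<psi> \<subseteq> S" and v_in: "v \<in> edom \<psi>"
    and sigma: "relatively_strongly_convex (prox_fun B p x0) \<sigma> \<psi>"
    and minorant: "\<exists>s c. linear s \<and> (\<forall>y\<in>edom \<psi>. real_part \<psi> y \<ge> s y + (c::real))"
begin

abbreviation "\<beta> \<equiv> bregman (prox_fun B p x0)"

definition "h y = g y + a * real_part \<psi> y + \<gamma> * \<beta> v y"

abbreviation "\<mu> \<equiv> \<gamma> + a * \<sigma>"

lemma linear_le_bnorm_power:
  assumes "linear (s :: 'a \<Rightarrow> real)"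
  shows "s u \<ge> - dual_norm B s * (1 + bnorm B u ^ p)"
proof -
  have "bnorm B u \<le> 1 + bnorm B u ^ p"
    using power_le_one_plus_power[of "bnorm B u" 1 p] p by simp
  then have "- s u \<le> dual_norm B s * (1 + bnorm B u ^ p)"
    using le_dual_norm[OF assms, of "- u"] dual_norm_nonneg[OF assms] linear_neg[OF assms, of u]
      mult_left_mono[of "bnorm B u" "1 + bnorm B u ^ p" "dual_norm B s"] by simp
  then show ?thesis
    by simp
qed

lemma psi_lower_bound: "\<exists>C. \<forall>y\<in>edom \<psi>. real_part \<psi> y \<ge> - C * (1 + bnorm B (y - x) ^ p)"
proof -
  obtain s c where s: "linear s" "\<And>y. y \<in> edom \<psi> \<Longrightarrow> real_part \<psi> y \<ge> s y + c"
    using minorant by blast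
  define m where "m = \<bar>s x + c\<bar>"
  have m: "0 \<le> m" "- (s x + c) \<le> m"
    by (auto simp: m_def)
  have "real_part \<psi> y \<ge> - (dual_norm B s + m) * (1 + bnorm B (y - x) ^ p)" if "y \<in> edom \<psi>" for y
  proof -
    have "- (dual_norm B s + m) * (1 + bnorm B (y - x) ^ p)
        = - dual_norm B s * (1 + bnorm B (y - x) ^ p) - m * (1 + bnorm B (y - x) ^ p)"
      by (simp add: algebra_simps)
    moreover have "m \<le> m * (1 + bnorm B (y - x) ^ p)"
      using m(1) by (simp add: algebra_simps)
    ultimately show ?thesis
      using s(2)[OF that] linear_le_bnorm_power[OF s(1), of "y - x"] linear_diff[OF s(1), of y x] m(2)
      by linarith
  qed
  then show ?thesis
    by blast
qed

lemma g_has_derivative: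
  assumes "x \<in> S"
  shows "(g has_derivative frechet_derivative g (at x)) (at x)"
  using times_differentiable_onD[OF differentiable, of "[]" x] p assms by simp

text \<open>
  The optimality condition at \<open>T\<close> gives a subgradient of \<open>\<psi>\<close>, along which \<open>\<psi>\<close> is relatively
  strongly convex; the three-point identity for \<open>\<beta>\<close> and the tangent inequality for \<open>g\<close> do the
  rest.
\<close>

lemma minimizer_strong_convexity:
  assumes T: "T \<in> edom \<psi>" and q: "(q has_derivative D) (at T)"
    and min: "\<And>y. y \<in> edom \<psi> \<Longrightarrow>
      q T + a * real_part \<psi> T + \<gamma> * \<beta> v T \<le> q y + a * real_part \<psi> y + \<gamma> * \<beta> v y"
    and y: "y \<in> edom \<psi>"
  shows "h y \<ge> h T + (frechet_derivative g (at T) (y - T) - D (y - T)) + \<mu> * \<beta> T y"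
proof -
  define d' where "d' w h = bnorm B (w - x0) ^ (p - 1) * B (w - x0) h" for w h
  have "((\<lambda>y. q y + \<gamma> * \<beta> v y) has_derivative (\<lambda>h. D h + \<gamma> * (d' T h - d' v h))) (at T)"
  proof -
    have "(\<beta> v has_derivative (\<lambda>h. d' T h - 0 - d' v h)) (at T)"
      unfolding bregman_prox_fun[OF p, abs_def] d'_def
      by (intro has_derivative_diff has_derivative_prox_fun[OF p] has_derivative_const
          has_derivative_mult_right
          bounded_linear.has_derivative[OF bounded_bilinear.bounded_linear_right[OF bounded_bilinear_B]])
        (auto intro!: derivative_eq_intros)
    then show ?thesis
      by (intro has_derivative_add has_derivative_mult_right q) simp
  qed
  then have sub: "(\<lambda>h. - ((D h + \<gamma> * (d' T h - d' v h)) / a)) \<in> subdifferential \<psi> T"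
    using min by (intro minimizer_subgradient[OF T a_pos]) (auto simp: algebra_simps)
  have "real_part \<psi> y - real_part \<psi> T + (D (y - T) + \<gamma> * (d' T (y - T) - d' v (y - T))) / a \<ge> \<sigma> * \<beta> T y"
  proof -
    have "\<sigma> * \<beta> T y \<le> real_part \<psi> y - real_part \<psi> T - - ((D (y - T) + \<gamma> * (d' T (y - T) - d' v (y - T))) / a)"
      using bspec[OF bspec[OF bspec[OF sigma[unfolded relatively_strongly_convex_def] T] y] sub]
      unfolding real_part_def .
    then show ?thesis
      by simp
  qed
  then have "a * (\<sigma> * \<beta> T y) \<le>
      a * (real_part \<psi> y - real_part \<psi> T + (D (y - T) + \<gamma> * (d' T (y - T) - d' v (y - T))) / a)"
    using a_pos by (intro mult_left_mono) auto
  also have "\<dots> = a * real_part \<psi> y - a * real_part \<psi> T + (D (y - T) + \<gamma> * (d' T (y - T) - d' v (y - T)))"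
    using a_pos by (simp add: field_simps)
  finally have 1: "a * (\<sigma> * \<beta> T y) \<le> \<dots>" .
  have 2: "g y \<ge> g T + frechet_derivative g (at T) (y - T)"
    using T y edom_sub by (intro convex_on_above_tangent[OF g_convex g_has_derivative]) auto
  have "\<beta> v y = \<beta> v T + \<beta> T y + (d' T (y - T) - d' v (y - T))"
    unfolding d'_def by (rule bregman_three_points[OF p])
  then have 3: "\<gamma> * \<beta> v y = \<gamma> * \<beta> v T + \<gamma> * \<beta> T y + \<gamma> * (d' T (y - T) - d' v (y - T))"
    by (simp only: distrib_left)
  show ?thesis
  proof -
    have "\<mu> * \<beta> T y = \<gamma> * \<beta> T y + a * (\<sigma> * \<beta> T y)"
      by (simp add: algebra_simps)
    then show ?thesis
      unfolding h_def using 1 2 3 by linarith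
  qed
qed

lemma exists_exact_minimizer:
  "\<exists>T\<in>edom \<psi>. \<forall>y\<in>edom \<psi>. h y \<ge> h T + \<mu> * \<beta> T y"
proof -
  let ?Q = "\<lambda>y. g y + \<gamma> * \<beta> v y"
  let ?D = "frechet_derivative g (at v)"
  define \<kappa> where "\<kappa> = \<gamma> / (2 ^ (p - 1) * real (p + 1))"
  have \<kappa>: "\<kappa> > 0"
    using gamma_pos by (simp add: \<kappa>_def)
  obtain C' where C': "\<And>y. y \<in> edom \<psi> \<Longrightarrow> real_part \<psi> y \<ge> - C' * (1 + bnorm B (y - v) ^ p)"
    using psi_lower_bound by blast
  have vS: "v \<in> S"
    using v_in edom_sub by blast
  have "continuous_on (edom \<psi>) g"
    using edom_sub by (intro continuous_at_imp_continuous_on ballI has_derivative_continuous[OF g_has_derivative]) auto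
  then have cont: "continuous_on (edom \<psi>) ?Q"
    by (intro continuous_intros continuous_on_bregman[OF p])
  have lin: "linear ?D"
    using g_has_derivative[OF vS] by (rule has_derivative_linear)
  have low: "?Q y \<ge> \<kappa> * bnorm B (y - v) ^ (p + 1) - (dual_norm B ?D + \<bar>g v\<bar>) * (1 + bnorm B (y - v) ^ p)"
    if y: "y \<in> edom \<psi>" for y
  proof -
    have "g y \<ge> g v + ?D (y - v)"
      using y vS edom_sub by (intro convex_on_above_tangent[OF g_convex g_has_derivative]) auto
    moreover have "\<bar>g v\<bar> * 1 \<le> \<bar>g v\<bar> * (1 + bnorm B (y - v) ^ p)"
      by (intro mult_left_mono) auto
    moreover have "\<gamma> * \<beta> v y \<ge> \<gamma> * (bnorm B (y - v) ^ (p + 1) / (2 ^ (p - 1) * real (p + 1)))"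
      using bregman_ge[OF p, where x = v and y = y and c = x0] gamma_pos by (intro mult_left_mono) auto
    moreover have "\<gamma> * (bnorm B (y - v) ^ (p + 1) / (2 ^ (p - 1) * real (p + 1))) = \<kappa> * bnorm B (y - v) ^ (p + 1)"
      by (simp add: \<kappa>_def)
    moreover have "(dual_norm B ?D + \<bar>g v\<bar>) * (1 + bnorm B (y - v) ^ p)
        = - (- dual_norm B ?D * (1 + bnorm B (y - v) ^ p)) + \<bar>g v\<bar> * (1 + bnorm B (y - v) ^ p)"
      by (simp add: algebra_simps)
    ultimately show ?thesis
      using linear_le_bnorm_power[OF lin, of "y - v"] by linarith
  qed
  obtain T where T: "T \<in> edom \<psi>"
      "\<And>y. y \<in> edom \<psi> \<Longrightarrow> ?Q T + a * real_part \<psi> T \<le> ?Q y + a * real_part \<psi> y"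
    using exists_minimizer[OF psi a_pos \<kappa> v_in cont low C'] by auto
  have "h y \<ge> h T + \<mu> * \<beta> T y" if y: "y \<in> edom \<psi>" for y
    using minimizer_strong_convexity[OF T(1) g_has_derivative _ y] T edom_sub by (force simp: algebra_simps)
  then show ?thesis
    using T(1) by blast
qed

definition "Mreg = real p * Lg"

definition "step x = tensor_step B p Mreg g (sub_composite (prox_fun B p x0) \<psi> a \<gamma> v) x"

definition "grad x T = tensor_subgrad B p Mreg g x T"

text \<open>
  The Bregman term is left out, because \<open>minimizer_strong_convexity\<close> treats it together with \<open>\<psi>\<close>.
\<close>

definition "model x y = taylor p g x y + Mreg / fact (p + 1) * bnorm B (y - x) ^ (p + 1)"

lemma tensor_model_eq:
  "y \<in> edom \<psi> \<Longrightarrow> tensor_model B p Mreg g (sub_composite (prox_fun B p x0) \<psi> a \<gamma> v) x y =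
     ereal (model x y + a * real_part \<psi> y + \<gamma> * \<beta> v y)"
  by (simp add: tensor_model_def sub_composite_def model_def psi_eq add.assoc)

lemma tensor_model_infty:
  "y \<notin> edom \<psi> \<Longrightarrow> tensor_model B p Mreg g (sub_composite (prox_fun B p x0) \<psi> a \<gamma> v) x y = \<infinity>"
  using a_pos by (simp add: tensor_model_def sub_composite_def psi_infty)

lemma Mreg_pos: "Mreg > 0"
  using p Lg_pos by (simp add: Mreg_def)

lemma model_has_derivative:
  assumes x: "x \<in> S"
  shows "(model x has_derivative (\<lambda>h. frechet_derivative (taylor p g x) (at T) h
    + Mreg / fact p * bnorm B (T - x) ^ (p - 1) * B (T - x) h)) (at T)"
proof -
  have "taylor p g x differentiable (at T)"
    by (rule differentiableI[OF taylor_has_derivative[OF x]])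
  then have "(taylor p g x has_derivative frechet_derivative (taylor p g x) (at T)) (at T)"
    by (simp add: frechet_derivative_works)
  then have "(model x has_derivative (\<lambda>h. frechet_derivative (taylor p g x) (at T) h
      + Mreg / fact (p + 1) * (real (p + 1) * bnorm B (T - x) ^ (p - 1) * B (T - x) h))) (at T)"
    unfolding model_def
    by (intro has_derivative_add has_derivative_mult_right has_derivative_bnorm_power p)
  moreover have "Mreg / fact (p + 1) * (real (p + 1) * c * e) = Mreg / fact p * c * e" for c e :: real
  proof -
    have "q \<noteq> 0 \<Longrightarrow> Mreg / (q * fact p) * (q * c * e) = Mreg / fact p * c * e" for q :: real
      by simp
    then show ?thesis
      using fact_Suc[of p, where 'a = real] by (metis Suc_eq_plus1 of_nat_eq_0_iff nat.distinct(1))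
  qed
  ultimately show ?thesis
    by (simp only:)
qed

lemma taylor_lower_bound:
  assumes x: "x \<in> S"
  shows "\<exists>C. \<forall>y. taylor p g x y \<ge> - C * (1 + bnorm B (y - x) ^ p)"
proof -
  have "\<exists>C\<ge>0. \<forall>hs. length hs = i \<longrightarrow> \<bar>nderiv g hs x\<bar> \<le> C * prod_list (map (bnorm B) hs)" if "i \<le> p" for i
    by (rule multilinear_form_bounded[OF multilinear_form_nderiv[OF differentiable S_open x that]])
  then obtain C where C: "\<And>i. i \<le> p \<Longrightarrow> C i \<ge> 0"
      "\<And>i hs. i \<le> p \<Longrightarrow> length hs = i \<Longrightarrow> \<bar>nderiv g hs x\<bar> \<le> C i * prod_list (map (bnorm B) hs)"
    by metis
  define K where "K = \<bar>g x\<bar> + (\<Sum>i=1..p. C i)"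
  have "taylor p g x y \<ge> - K * (1 + bnorm B (y - x) ^ p)" for y
  proof -
    let ?r = "bnorm B (y - x)"
    have term_ge: "- (C i * (1 + ?r ^ p)) \<le> nderiv g (replicate i (y - x)) x / fact i" if i: "i \<in> {1..p}" for i
    proof -
      have "?r ^ i \<le> 1 + ?r ^ p"
        using i by (intro power_le_one_plus_power) auto
      then have "C i * ?r ^ i \<le> C i * (1 + ?r ^ p)"
        using C(1)[of i] i by (intro mult_left_mono) auto
      moreover have "\<bar>nderiv g (replicate i (y - x)) x\<bar> \<le> C i * ?r ^ i"
        using C(2)[of i "replicate i (y - x)"] i by (simp add: map_replicate prod_list_replicate)
      moreover have "\<bar>nderiv g (replicate i (y - x)) x / fact i\<bar> \<le> \<bar>nderiv g (replicate i (y - x)) x\<bar>"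
        using fact_ge_1[of i, where 'a = real] mult_left_mono[of 1 "fact i :: real" "\<bar>nderiv g (replicate i (y - x)) x\<bar>"]
        by (simp add: abs_divide divide_le_eq)
      ultimately show ?thesis
        by linarith
    qed
    have "- K * (1 + ?r ^ p) = - (\<bar>g x\<bar> * (1 + ?r ^ p)) + (\<Sum>i=1..p. - (C i * (1 + ?r ^ p)))"
      unfolding K_def sum_negf sum_distrib_right[symmetric] by (simp add: algebra_simps)
    also have "\<dots> \<le> g x + (\<Sum>i=1..p. nderiv g (replicate i (y - x)) x / fact i)"
    proof (intro add_mono sum_mono term_ge)
      have "\<bar>g x\<bar> * 1 \<le> \<bar>g x\<bar> * (1 + ?r ^ p)"
        by (intro mult_left_mono) auto
      then show "- (\<bar>g x\<bar> * (1 + ?r ^ p)) \<le> g x"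
        by linarith
    qed
    finally show ?thesis
      by (simp add: taylor_def)
  qed
  then show ?thesis
    by blast
qed

lemma step_minimizes:
  assumes x: "x \<in> edom \<psi>"
  shows "step x \<in> edom \<psi>"
    and "\<And>y. y \<in> edom \<psi> \<Longrightarrow> model x (step x) + a * real_part \<psi> (step x) + \<gamma> * \<beta> v (step x)
      \<le> model x y + a * real_part \<psi> y + \<gamma> * \<beta> v y"
proof -
  let ?m = "tensor_model B p Mreg g (sub_composite (prox_fun B p x0) \<psi> a \<gamma> v) x"
  let ?Q = "\<lambda>y. model x y + \<gamma> * \<beta> v y"
  define \<kappa> where "\<kappa> = Mreg / fact (p + 1)"
  have \<kappa>: "\<kappa> > 0"
    using Mreg_pos by (simp add: \<kappa>_def)
  have xS: "x \<in> S"
    using x edom_sub by blast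
  obtain C' where C': "\<And>y. y \<in> edom \<psi> \<Longrightarrow> real_part \<psi> y \<ge> - C' * (1 + bnorm B (y - x) ^ p)"
    using psi_lower_bound by blast
  obtain C where C: "\<And>y. taylor p g x y \<ge> - C * (1 + bnorm B (y - x) ^ p)"
    using taylor_lower_bound[OF xS] by blast
  have "continuous_on (edom \<psi>) (model x)"
    by (intro continuous_at_imp_continuous_on ballI has_derivative_continuous[OF model_has_derivative[OF xS]])
  then have cont: "continuous_on (edom \<psi>) ?Q"
    by (intro continuous_intros continuous_on_bregman[OF p])
  have low: "?Q y \<ge> \<kappa> * bnorm B (y - x) ^ (p + 1) - C * (1 + bnorm B (y - x) ^ p)" for y
    using C[of y] mult_nonneg_nonneg[OF less_imp_le[OF gamma_pos] bregman_nonneg[OF p, where c = x0 and x = v and y = y]]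
    by (simp add: model_def \<kappa>_def)
  obtain T where T: "T \<in> edom \<psi>"
      "\<And>y. y \<in> edom \<psi> \<Longrightarrow> ?Q T + a * real_part \<psi> T \<le> ?Q y + a * real_part \<psi> y"
    using exists_minimizer[OF psi a_pos \<kappa> x cont low C'] by auto
  have "?m T \<le> ?m y" for y
    using T by (cases "y \<in> edom \<psi>") (auto simp: tensor_model_eq tensor_model_infty algebra_simps)
  then have "is_arg_min ?m (\<lambda>_. True) T"
    by (simp add: is_arg_min_def leD)
  then have "is_arg_min ?m (\<lambda>_. True) (step x)"
    unfolding step_def tensor_step_def arg_min_def by (rule someI)
  then have min: "?m (step x) \<le> ?m y" for y
    by (simp add: is_arg_min_def not_less)
  have "?m (step x) \<noteq> \<infinity>"
    using min[of T] T(1) by (auto simp: tensor_model_eq)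
  then show S: "step x \<in> edom \<psi>"
    using tensor_model_infty[of "step x" x] by blast
  show "model x (step x) + a * real_part \<psi> (step x) + \<gamma> * \<beta> v (step x)
      \<le> model x y + a * real_part \<psi> y + \<gamma> * \<beta> v y" if "y \<in> edom \<psi>" for y
    using min[of y] S that by (simp add: tensor_model_eq)
qed

text \<open>
  The scale of the tensor step: a step of length \<open>r\<close> ends with a subgradient of norm at most
  \<open>\<Lambda> r\<^sup>p\<close>.
\<close>

definition "\<Lambda> = real (p + 1) * Lg / fact p"

lemma Lambda_pos: "\<Lambda> > 0"
  using Lg_pos by (simp add: \<Lambda>_def)

text \<open>
  The model overestimates \<open>h\<close> at the new point. At \<open>y\<close> it exceeds \<open>h\<close> by at most the regularization
  and the Taylor error, with the constants \<open>p Lg\<close> and \<open>Lg\<close>, which add up to \<open>(p + 1) Lg\<close>.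
\<close>

lemma step_le:
  assumes x: "x \<in> edom \<psi>" and y: "y \<in> edom \<psi>"
  shows "h (step x) \<le> h y + \<Lambda> / real (p + 1) * bnorm B (y - x) ^ (p + 1)"
proof -
  let ?T = "step x"
  have S: "x \<in> S" "y \<in> S" "?T \<in> S"
    using x y step_minimizes(1)[OF x] edom_sub by auto
  have M: "Lg \<le> Mreg"
    using p Lg_pos by (simp add: Mreg_def)
  have "g ?T \<le> taylor p g x ?T + Lg * bnorm B (?T - x) ^ (p + 1) / fact (p + 1)"
    using abs_diff_taylor_le[OF S(1,3)] by (simp add: abs_le_iff)
  also have "Lg * bnorm B (?T - x) ^ (p + 1) / fact (p + 1) \<le> Mreg / fact (p + 1) * bnorm B (?T - x) ^ (p + 1)"
    using M by (auto intro!: divide_right_mono mult_right_mono)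
  finally have 1: "g ?T \<le> model x ?T"
    by (simp add: model_def)
  have 2: "taylor p g x y \<le> g y + Lg * bnorm B (y - x) ^ (p + 1) / fact (p + 1)"
    using abs_diff_taylor_le[OF S(1,2)] by (simp add: abs_le_iff)
  have fp: "fact (p + 1) = real (p + 1) * (fact p :: real)"
    by simp
  have "Lg * c / fact (p + 1) + Mreg / fact (p + 1) * c = \<Lambda> / real (p + 1) * c" for c
  proof -
    have "Lg * c / (q * F) + (q - 1) * Lg / (q * F) * c = q * Lg / F / q * c" if "q \<noteq> 0" "F \<noteq> 0" for q F :: real
      using that by (simp add: field_simps)
    from this[of "real (p + 1)" "fact p"] show ?thesis
      unfolding fp \<Lambda>_def Mreg_def by simp
  qed
  from this[of "bnorm B (y - x) ^ (p + 1)"] show ?thesis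
    using 1 2 step_minimizes(2)[OF x y] unfolding h_def model_def by linarith
qed

lemma linear_grad:
  assumes "x \<in> S" "T \<in> S"
  shows "linear (grad x T)"
proof -
  have 1: "linear (frechet_derivative g (at T))"
    by (rule has_derivative_linear[OF g_has_derivative[OF assms(2)]])
  have 2: "linear (frechet_derivative (taylor p g x) (at T))"
    by (rule linear_frechet_derivative[OF differentiableI[OF taylor_has_derivative[OF assms(1)]]])
  have 3: "linear (\<lambda>h. Mreg / fact p * bnorm B (T - x) ^ (p - 1) * B (T - x) h)"
    by (intro linearI) (simp_all add: distrib_left add_divide_distrib mult_ac del: B_diff_left)
  show ?thesis
    unfolding grad_def tensor_subgrad_def by (intro linear_compose_sub 1 2 3)
qed

lemma step_strong_convexity:
  assumes x: "x \<in> edom \<psi>" and y: "y \<in> edom \<psi>"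
  shows "h y \<ge> h (step x) + grad x (step x) (y - step x) + \<mu> * \<beta> (step x) y"
  using minimizer_strong_convexity[OF step_minimizes(1)[OF x] model_has_derivative _ y, of x]
    step_minimizes(2)[OF x] x edom_sub
  unfolding grad_def tensor_subgrad_def by (auto simp: algebra_simps)

text \<open>Up to the Taylor error of \<open>g\<close> the subgradient is the gradient of the regularization.\<close>

lemma grad_deviation_le:
  assumes "x \<in> S" "T \<in> S"
  shows "\<bar>grad x T w + \<Lambda> * real p / real (p + 1) * bnorm B (T - x) ^ (p - 1) * B (T - x) w\<bar>
    \<le> \<Lambda> / real (p + 1) * bnorm B (T - x) ^ p * bnorm B w"
proof -
  have "\<Lambda> * real p / real (p + 1) = Mreg / fact p" "\<Lambda> / real (p + 1) = Lg / fact p"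
    by (simp_all add: \<Lambda>_def Mreg_def)
  then show ?thesis
    using abs_diff_taylor_derivative_le[OF assms, of w]
    unfolding grad_def tensor_subgrad_def by (simp del: B_diff_left)
qed

end

section \<open>Linear convergence of the inner loop\<close>

lemma Young_power:
  fixes x y :: real
  assumes "0 \<le> x" "0 \<le> y"
  shows "real (p + 1) * (x ^ p * y) \<le> real p * x ^ (p + 1) + y ^ (p + 1)"
proof (cases "x = 0")
  case False
  have "1 + real (p + 1) * (y / x - 1) \<le> (1 + (y / x - 1)) ^ (p + 1)"
    using assms False by (intro Bernoulli_inequality) simp
  then have "x ^ (p + 1) * (1 + real (p + 1) * (y / x - 1)) \<le> x ^ (p + 1) * (y / x) ^ (p + 1)"
    using assms by (intro mult_left_mono) auto
  also have "\<dots> = y ^ (p + 1)"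
    using False by (simp add: power_divide)
  also have "x ^ (p + 1) * (1 + real (p + 1) * (y / x - 1)) = real (p + 1) * (x ^ p * y) - real p * x ^ (p + 1)"
    using False by (simp add: field_simps)
  finally show ?thesis
    by simp
qed (use assms in \<open>cases p; simp\<close>)

text \<open>
  Weighted AM-GM for \<open>t\<^bsup>2p\<^esup>\<close> and \<open>1\<close> with the weights \<open>(p + 1) / 2p\<close> and \<open>(p - 1) / 2p\<close>.
\<close>

lemma power_AM_GM:
  fixes t :: real
  assumes "p \<ge> 1" "0 \<le> t" "t \<le> 1"
  shows "2 * real p * t ^ (p + 1) \<le> real (p + 1) * t ^ (2 * p) + real (p - 1)"
proof -
  define f where "f t = real (p + 1) * t ^ (2 * p) - 2 * real p * t ^ (p + 1) + real (p - 1)" for t :: real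
  obtain m where m: "p = Suc m"
    using assms(1) by (cases p) auto
  have "f 1 \<le> f t"
  proof (rule DERIV_nonpos_imp_nonincreasing[OF assms(3)])
    fix s
    assume s: "t \<le> s" "s \<le> 1"
    have "(f has_real_derivative real (p + 1) * (real (2 * p) * s ^ (2 * p - Suc 0))
        - 2 * real p * (real (p + 1) * s ^ (p + 1 - Suc 0)) + 0) (at s)"
      unfolding f_def by (intro DERIV_add DERIV_diff DERIV_cmult DERIV_pow DERIV_const)
    moreover have "real (p + 1) * (real (2 * p) * s ^ (2 * p - Suc 0))
        - 2 * real p * (real (p + 1) * s ^ (p + 1 - Suc 0)) + 0 = 2 * real p * real (p + 1) * (s ^ p * (s ^ m - 1))"
    proof -
      have "2 * p - Suc 0 = p + m"
        by (simp add: m)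
      then show ?thesis
        by (simp add: power_add algebra_simps)
    qed
    moreover have "2 * real p * real (p + 1) * (s ^ p * (s ^ m - 1)) \<le> 0"
      using s assms power_le_one[of s m] by (intro mult_nonneg_nonpos) auto
    ultimately show "\<exists>y. (f has_real_derivative y) (at s) \<and> y \<le> 0"
      by auto
  qed
  moreover have "f 1 = 0"
    using assms(1) by (simp add: f_def of_nat_diff)
  ultimately show ?thesis
    by (simp add: f_def)
qed

text \<open>
  The residual of the inner loop contracts by \<open>exp (- inner_rate p)\<close>. The value is dictated by
  the final bound: \<open>(1 + ln 2 / p) / inner_rate p\<close> is the coefficient \<open>1 + e / ((e - 1) p)\<close>.
\<close>

definition inner_rate :: "nat \<Rightarrow> real" where
  "inner_rate p = (real p + ln 2) / (real p + exp 1 / (exp 1 - 1))"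

lemma e_bounds: "exp 1 > (2::real)" "exp 1 < (272/100::real)"
  using e_less_272 exp_lower_Taylor_quadratic[of "1::real"] by auto

text \<open>For the numerical bounds below, with \<open>1 - c\<close> close to \<open>1\<close>.\<close>

lemma exp_minus_ge:
  assumes "0 \<le> c"
  shows "exp (- (1 - c)) \<ge> (1 + c + c\<^sup>2 / 2) / (272/100 :: real)"
proof -
  have "(1 + c + c\<^sup>2 / 2) / (272/100) \<le> exp c / exp 1"
    using exp_lower_Taylor_quadratic[OF assms] e_bounds assms by (intro frac_le) auto
  then show ?thesis
    by (simp add: exp_diff)
qed

lemma inner_rate_pos: "p \<ge> 1 \<Longrightarrow> inner_rate p > 0"
  using e_bounds unfolding inner_rate_def by (intro divide_pos_pos add_pos_pos) auto

lemma inner_rate_le: "inner_rate p \<le> 1 - (272/172 - 25/36) / (real p + 272/172)"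
proof -
  have "(272/172 :: real) \<le> exp 1 / (exp 1 - 1)"
    using e_bounds by (simp add: field_simps)
  then have "inner_rate p \<le> (real p + ln 2) / (real p + 272/172)"
    unfolding inner_rate_def by (intro divide_left_mono) (auto intro!: mult_pos_pos add_nonneg_pos)
  also have "\<dots> \<le> (real p + 25/36) / (real p + 272/172)"
    using ln2_le_25_over_36 by (intro divide_right_mono) auto
  also have "\<dots> = 1 - (272/172 - 25/36) / (real p + 272/172)"
    by (simp add: field_simps)
  finally show ?thesis .
qed

text \<open>
  For small \<open>p\<close> the rate \<open>p / (2 p + 2)\<close> of the gradient estimate is good enough, for large \<open>p\<close>
  the rate \<open>1 / 3 + (2 / 3) ^ (p + 1)\<close> of the proximal estimate. The margin is smallest
  for \<open>p = 5\<close>.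
\<close>

lemma inner_rate_bound:
  assumes "p \<ge> 1"
  shows "real p / (2 * real p + 2) \<le> exp (- inner_rate p) \<or> 1/3 + (2/3) ^ (p + 1) \<le> exp (- inner_rate p)"
proof -
  have exp_09: "exp (- inner_rate p) \<ge> 2/5" if "inner_rate p \<le> 9/10"
  proof -
    have "(2/5::real) \<le> exp (- (9/10))"
      using exp_minus_ge[of "1/10"] by (simp add: power2_eq_square)
    also have "\<dots> \<le> exp (- inner_rate p)"
      using that by simp
    finally show ?thesis .
  qed
  have rate: "inner_rate p \<le> c" if "(1 - c) * (real p + 272/172) \<le> 272/172 - 25/36" for c
  proof -
    have "1 - c \<le> (272/172 - 25/36) / (real p + 272/172)"
      using that by (subst le_divide_eq) (auto simp: add_nonneg_pos)
    then show ?thesis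
      using inner_rate_le[of p] by linarith
  qed
  consider "p \<le> 4" | "p = 5" | "p = 6 \<or> p = 7" | "p \<ge> 8"
    by linarith
  then show ?thesis
  proof cases
    case 1
    then have "real p / (2 * real p + 2) \<le> 2/5"
      by (simp add: field_simps)
    moreover have "inner_rate p \<le> 9/10"
      using 1 by (intro rate) simp
    ultimately show ?thesis
      using exp_09 by linarith
  next
    case 2
    have "(5/12::real) \<le> exp (- (87/100))"
      using exp_minus_ge[of "13/100"] by (simp add: power2_eq_square)
    also have "\<dots> \<le> exp (- inner_rate p)"
      using rate[of "87/100"] 2 by simp
    finally show ?thesis
      using 2 by simp
  next
    case 3
    then have "inner_rate p \<le> 9/10"
      by (intro rate) auto
    moreover have "(1/3 + (2/3) ^ (p + 1) :: real) \<le> 2/5"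
      using 3 by (auto simp: power_divide)
    ultimately show ?thesis
      using exp_09 by linarith
  next
    case 4
    have "(2/3::real) ^ (p + 1) \<le> (2/3) ^ 9"
      using 4 by (intro power_decreasing) auto
    also have "1/3 + (2/3::real) ^ 9 \<le> 1 / (272/100)"
      by (simp add: power_divide)
    also have "\<dots> \<le> exp (- 1)"
      using exp_minus_ge[of 0] by simp
    also have "\<dots> \<le> exp (- inner_rate p)"
      using rate[of 1] by simp
    finally show ?thesis
      by simp
  qed
qed

context subproblem
begin

text \<open>
  With \<open>\<theta>\<close> the radius for which the dual norm is \<open>\<Lambda> \<theta>\<^sup>p\<close>: by Riesz the gradient estimate says
  that the gradient, as a vector, lies in a ball of radius \<open>e\<close> around \<open>k (x - T)\<close> where the norm
  of \<open>k (x - T)\<close> is \<open>p e\<close>. Expanding the square bounds the pairing with \<open>x - T\<close> from below by a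
  combination of \<open>\<theta>\<^sup>2\<^sup>p\<close> and \<open>r\<^sup>2\<^sup>p\<close>, and weighted AM-GM turns this into \<open>\<theta>\<^bsup>p+1\<^esup>\<close>.
\<close>

lemma grad_estimates:
  assumes S: "x \<in> S" "T \<in> S" and \<theta>: "\<theta> \<ge> 0" "dual_norm B (grad x T) = \<Lambda> * \<theta> ^ p"
  shows "\<theta> \<le> bnorm B (T - x)" and "grad x T (x - T) \<ge> \<Lambda> * \<theta> ^ (p + 1)"
proof -
  define r where "r = bnorm B (T - x)"
  define e where "e = \<Lambda> / real (p + 1) * r ^ p"
  define k where "k = \<Lambda> * real p / real (p + 1) * r ^ (p - 1)"
  obtain w where w: "grad x T = B w"
    using Riesz_B[OF linear_grad[OF S]] by blast
  have \<nu>: "bnorm B w = \<Lambda> * \<theta> ^ p"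
    using \<theta>(2) by (simp add: w dual_norm_B)
  have e0: "e \<ge> 0"
    using Lambda_pos by (simp add: e_def r_def)
  have kr: "k * r = real p * e"
    using p power_Suc2[of r "p - 1"] by (simp add: k_def e_def mult_ac)
  have pe: "real (p + 1) * e = \<Lambda> * r ^ p"
    by (simp add: e_def del: of_nat_add)
  let ?u = "w + k *\<^sub>R (T - x)"
  have "bnorm B ?u ^ 2 \<le> e * bnorm B ?u"
  proof -
    have "\<bar>B w ?u + k * B (T - x) ?u\<bar> \<le> e * bnorm B ?u"
      using grad_deviation_le[OF S, of ?u] unfolding w k_def e_def r_def .
    moreover have "bnorm B ?u ^ 2 = B w ?u + k * B (T - x) ?u"
      unfolding bnorm_power2 by (simp only: B_add_left B_scale_left)
    ultimately show ?thesis
      by linarith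
  qed
  then have u: "bnorm B ?u \<le> e"
    using e0 by (cases "bnorm B ?u = 0") (auto simp: power2_eq_square)
  have "bnorm B w \<le> bnorm B ?u + bnorm B (- (k *\<^sub>R (T - x)))"
    using bnorm_triangle[of ?u "- (k *\<^sub>R (T - x))"] by simp
  also have "bnorm B (- (k *\<^sub>R (T - x))) = real p * e"
    using Lambda_pos by (subst bnorm_minus) (simp add: kr[symmetric] r_def k_def del: bnorm_minus)
  finally have "\<Lambda> * \<theta> ^ p \<le> \<Lambda> * r ^ p"
    using u pe \<nu> by (simp add: algebra_simps)
  then show le: "\<theta> \<le> bnorm B (T - x)"
    using Lambda_pos \<theta> p power_mono_iff[of \<theta> r p] by (simp add: r_def)
  show "grad x T (x - T) \<ge> \<Lambda> * \<theta> ^ (p + 1)"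
  proof (cases "r = 0")
    case True
    then have "\<theta> = 0" "x = T"
      using le \<theta>(1) by (auto simp: r_def)
    then show ?thesis
      using linear_0[OF linear_grad[OF S]] by simp
  next
    case False
    then have r: "r > 0"
      using r_def bnorm_nonneg[of "T - x"] by linarith
    let ?G = "B w (x - T)"
    have "bnorm B ?u ^ 2 = bnorm B w ^ 2 - 2 * k * ?G + k ^ 2 * r ^ 2"
      unfolding bnorm_power2 r_def
      by (simp add: B_commute[of T x] B_commute[of T w] B_commute[of x w] algebra_simps power2_eq_square)
    moreover have "bnorm B ?u ^ 2 \<le> e ^ 2"
      using u by (intro power_mono) auto
    moreover have "k ^ 2 * r ^ 2 = (real p * e) ^ 2"
      using kr by (simp flip: power_mult_distrib)
    ultimately have upper: "(\<Lambda> * \<theta> ^ p) ^ 2 + (real p * e) ^ 2 - e ^ 2 \<le> 2 * k * ?G"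
      using \<nu> by simp
    define t where "t = \<theta> / r"
    have t: "0 \<le> t" "t \<le> 1" "\<theta> = t * r"
      using le r \<theta> by (auto simp: t_def r_def)
    have expand: "(\<Lambda> * \<theta> ^ p) ^ 2 + (real p * e) ^ 2 - e ^ 2
        = real (p + 1) * e ^ 2 * (real (p + 1) * t ^ (2 * p) + real (p - 1))"
    proof -
      have "\<Lambda> * \<theta> ^ p = real (p + 1) * e * t ^ p"
        unfolding pe t(3) power_mult_distrib by simp
      moreover have "real p ^ 2 - 1 = real (p + 1) * real (p - 1)"
        using p by (simp add: of_nat_diff algebra_simps power2_eq_square)
      ultimately show ?thesis
        by (simp add: power_mult_distrib power_mult power2_eq_square algebra_simps of_nat_diff p)
    qed
    have "2 * (real p * e) * (real (p + 1) * e * t ^ (p + 1)) = real (p + 1) * e ^ 2 * (2 * real p * t ^ (p + 1))"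
      by (simp add: power2_eq_square mult_ac del: of_nat_add)
    also have "\<dots> \<le> real (p + 1) * e ^ 2 * (real (p + 1) * t ^ (2 * p) + real (p - 1))"
      using power_AM_GM[OF p t(1,2)] by (intro mult_left_mono) auto
    also have "\<dots> \<le> 2 * k * ?G"
      using upper expand by simp
    also have "\<dots> = 2 * (real p * e) * (?G / r)"
      using r by (simp flip: kr)
    finally have "2 * (real p * e) * (real (p + 1) * e * t ^ (p + 1)) \<le> 2 * (real p * e) * (?G / r)" .
    moreover have "0 < 2 * (real p * e)"
      using p Lambda_pos r by (auto simp: e_def intro!: mult_pos_pos divide_pos_pos)
    ultimately have "real (p + 1) * e * t ^ (p + 1) \<le> ?G / r"
      by (rule mult_left_le_imp_le)
    then have "r * (real (p + 1) * e * t ^ (p + 1)) \<le> ?G"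
      using r by (simp add: le_divide_eq mult.commute)
    moreover have "r * (real (p + 1) * e * t ^ (p + 1)) = \<Lambda> * \<theta> ^ (p + 1)"
      unfolding pe t(3) by (simp add: power_mult_distrib)
    ultimately show ?thesis
      by (simp add: w)
  qed
qed

lemma step_in_S: "x \<in> edom \<psi> \<Longrightarrow> x \<in> S \<and> step x \<in> S"
  using step_minimizes(1) edom_sub by blast

lemma grad_radius:
  assumes "x \<in> S" "T \<in> S"
  obtains \<theta> where "\<theta> \<ge> 0" "dual_norm B (grad x T) = \<Lambda> * \<theta> ^ p"
proof
  have "0 \<le> dual_norm B (grad x T) / \<Lambda>"
    using dual_norm_nonneg[OF linear_grad[OF assms]] Lambda_pos by simp
  then show "root p (dual_norm B (grad x T) / \<Lambda>) \<ge> 0"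
    "dual_norm B (grad x T) = \<Lambda> * root p (dual_norm B (grad x T) / \<Lambda>) ^ p"
    using p Lambda_pos by auto
qed

end

text \<open>
  The condition number of the subproblem is bounded: the uniform convexity dominates the
  smoothness. This is what the choice of the contraction coefficients is for.
\<close>

locale well_conditioned_subproblem = subproblem +
  assumes condition: "\<Lambda> \<le> \<mu> / 2 ^ (p - 1)"
begin

lemma uniform_convexity: "\<mu> * \<beta> T y \<ge> \<Lambda> / real (p + 1) * bnorm B (y - T) ^ (p + 1)"
proof -
  have "\<Lambda> / real (p + 1) * bnorm B (y - T) ^ (p + 1) \<le> \<mu> / 2 ^ (p - 1) / real (p + 1) * bnorm B (y - T) ^ (p + 1)"
    using condition by (intro mult_right_mono divide_right_mono) auto
  also have "\<dots> = \<mu> * (bnorm B (y - T) ^ (p + 1) / (2 ^ (p - 1) * real (p + 1)))"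
    by simp
  also have "\<dots> \<le> \<mu> * \<beta> T y"
    using bregman_ge[OF p, where x = T and y = y and c = x0] gamma_pos a_pos sigma_pos
    by (intro mult_left_mono) (auto intro!: add_nonneg_nonneg)
  finally show ?thesis .
qed

text \<open>
  The two halves of the gradient estimate: a large final gradient certifies progress, a small one
  certifies a small residual.
\<close>

lemma step_decrease:
  assumes x: "x \<in> edom \<psi>" and \<theta>: "\<theta> \<ge> 0" "dual_norm B (grad x (step x)) = \<Lambda> * \<theta> ^ p"
  shows "h x - h (step x) \<ge> \<Lambda> * \<theta> ^ (p + 1) * (real (p + 2) / real (p + 1))"
proof -
  have S: "x \<in> S" "step x \<in> S"
    using step_in_S[OF x] by auto
  have "\<Lambda> / real (p + 1) * \<theta> ^ (p + 1) \<le> \<Lambda> / real (p + 1) * bnorm B (step x - x) ^ (p + 1)"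
    using grad_estimates(1)[OF S \<theta>] \<theta>(1) Lambda_pos by (intro mult_left_mono power_mono) auto
  also have "\<dots> \<le> \<mu> * \<beta> (step x) x"
    using uniform_convexity[of x "step x"] by (simp add: bnorm_minus_commute)
  finally have "\<Lambda> * \<theta> ^ (p + 1) + \<Lambda> / real (p + 1) * \<theta> ^ (p + 1) \<le> h x - h (step x)"
    using step_strong_convexity[OF x x] grad_estimates(2)[OF S \<theta>] by linarith
  moreover have "\<Lambda> * \<theta> ^ (p + 1) + \<Lambda> / real (p + 1) * \<theta> ^ (p + 1) = \<Lambda> * \<theta> ^ (p + 1) * (real (p + 2) / real (p + 1))"
    by (simp add: field_simps)
  ultimately show ?thesis
    by simp
qed

lemma gradient_dominance:
  assumes x: "x \<in> edom \<psi>" and y: "y \<in> edom \<psi>"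
    and \<theta>: "\<theta> \<ge> 0" "dual_norm B (grad x (step x)) = \<Lambda> * \<theta> ^ p"
  shows "h (step x) - h y \<le> \<Lambda> * \<theta> ^ (p + 1) * (real p / real (p + 1))"
proof -
  have S: "x \<in> S" "step x \<in> S"
    using step_in_S[OF x] by auto
  let ?d = "bnorm B (y - step x)"
  have "- grad x (step x) (y - step x) \<le> \<Lambda> * \<theta> ^ p * ?d"
    using le_dual_norm[OF linear_grad[OF S], of "step x - y"] \<theta>(2)
      linear_diff[OF linear_grad[OF S], of y "step x"] linear_diff[OF linear_grad[OF S], of "step x" y]
    by (simp add: bnorm_minus_commute)
  then have "h (step x) - h y \<le> \<Lambda> * \<theta> ^ p * ?d - \<Lambda> / real (p + 1) * ?d ^ (p + 1)"
    using step_strong_convexity[OF x y] uniform_convexity[of y "step x"] by linarith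
  also have "\<dots> = \<Lambda> / real (p + 1) * (real (p + 1) * (\<theta> ^ p * ?d) - ?d ^ (p + 1))"
    by (simp add: field_simps del: of_nat_add)
  also have "\<dots> \<le> \<Lambda> / real (p + 1) * (real p * \<theta> ^ (p + 1))"
    using Young_power[OF \<theta>(1), of ?d p] Lambda_pos by (intro mult_left_mono) auto
  finally show ?thesis
    by (simp add: mult_ac)
qed

lemma contraction_gradient:
  assumes x: "x \<in> edom \<psi>" and y: "y \<in> edom \<psi>"
  shows "h (step x) - h y \<le> real p / (2 * real p + 2) * (h x - h y)"
proof -
  obtain \<theta> where \<theta>: "\<theta> \<ge> 0" "dual_norm B (grad x (step x)) = \<Lambda> * \<theta> ^ p"
    using grad_radius step_in_S[OF x] by blast
  have "real (p + 1) * (h (step x) - h y) \<le> real p * (\<Lambda> * \<theta> ^ (p + 1))"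
    using gradient_dominance[OF x y \<theta>] by (simp add: field_simps)
  moreover have "real (p + 2) * (\<Lambda> * \<theta> ^ (p + 1)) \<le> real (p + 1) * (h x - h (step x))"
    using step_decrease[OF x \<theta>] by (simp add: field_simps)
  ultimately have "real (p + 2) * (real (p + 1) * (h (step x) - h y)) \<le> real p * (real (p + 1) * (h x - h (step x)))"
    using mult_left_mono[of _ _ "real (p + 2)"] mult_left_mono[of _ _ "real p"]
    by (smt (verit) mult.left_commute of_nat_0_le_iff)
  then have "real (p + 1) * (real (p + 2) * (h (step x) - h y)) \<le> real (p + 1) * (real p * (h x - h (step x)))"
    by (simp only: mult.left_commute)
  then have "real (p + 2) * (h (step x) - h y) \<le> real p * (h x - h (step x))"
    by (subst (asm) mult_le_cancel_left_pos) auto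
  then have "(2 * real p + 2) * (h (step x) - h y) \<le> real p * (h x - h y)"
    by (simp add: algebra_simps)
  then show ?thesis
    by (simp add: le_divide_eq mult.commute add_pos_nonneg)
qed

lemma h_convex:
  assumes "x \<in> edom \<psi>" "y \<in> edom \<psi>" "0 \<le> \<tau>" "\<tau> \<le> 1"
  shows "h ((1 - \<tau>) *\<^sub>R x + \<tau> *\<^sub>R y) \<le> (1 - \<tau>) * h x + \<tau> * h y"
proof -
  let ?w = "(1 - \<tau>) *\<^sub>R x + \<tau> *\<^sub>R y"
  define d' where "d' w h = bnorm B (w - x0) ^ (p - 1) * B (w - x0) h" for w h
  have 3: "\<beta> v u = \<beta> v ?w + \<beta> ?w u + (d' ?w (u - ?w) - d' v (u - ?w))" for u
    unfolding d'_def by (rule bregman_three_points[OF p])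
  have zero: "(1 - \<tau>) *\<^sub>R (x - ?w) + \<tau> *\<^sub>R (y - ?w) = 0"
    by (simp add: algebra_simps)
  have lin: "(1 - \<tau>) * d' z (x - ?w) + \<tau> * d' z (y - ?w) = 0" for z
  proof -
    have "(1 - \<tau>) * d' z (x - ?w) + \<tau> * d' z (y - ?w) = d' z ((1 - \<tau>) *\<^sub>R (x - ?w) + \<tau> *\<^sub>R (y - ?w))"
      unfolding d'_def B_add_right B_scale_right by (simp add: distrib_left mult_ac del: B_diff_left B_diff_right)
    then show ?thesis
      unfolding zero by (simp add: d'_def)
  qed
  have "(1 - \<tau>) * \<beta> v x + \<tau> * \<beta> v y = \<beta> v ?w + ((1 - \<tau>) * \<beta> ?w x + \<tau> * \<beta> ?w y)
      + (((1 - \<tau>) * d' ?w (x - ?w) + \<tau> * d' ?w (y - ?w)) - ((1 - \<tau>) * d' v (x - ?w) + \<tau> * d' v (y - ?w)))"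
  proof -
    have "(1 - \<tau>) * (b + c + (d - e)) + \<tau> * (b + c' + (d' - e'))
        = b + ((1 - \<tau>) * c + \<tau> * c') + (((1 - \<tau>) * d + \<tau> * d') - ((1 - \<tau>) * e + \<tau> * e'))"
      for b c c' d d' e e' :: real
      by (simp add: algebra_simps)
    then show ?thesis
      unfolding 3[of x] 3[of y] .
  qed
  also have "\<dots> \<ge> \<beta> v ?w"
    using assms bregman_nonneg[OF p] by (simp only: lin) simp
  finally have 1: "\<gamma> * \<beta> v ?w \<le> \<gamma> * ((1 - \<tau>) * \<beta> v x + \<tau> * \<beta> v y)"
    using gamma_pos by (intro mult_left_mono) auto
  have 2: "g ?w \<le> (1 - \<tau>) * g x + \<tau> * g y"
    using convex_onD[OF g_convex, of \<tau> x y] assms edom_sub by auto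
  have "a * real_part \<psi> ?w \<le> a * ((1 - \<tau>) * real_part \<psi> x + \<tau> * real_part \<psi> y)"
    using convex_onD[OF convex_on_real_part, of \<tau> x y] assms a_pos by (intro mult_left_mono) auto
  with 1 2 show ?thesis
    unfolding h_def by (simp add: algebra_simps)
qed

text \<open>
  The model is compared with the point two thirds of the way to the minimizer, and uniform
  convexity bounds the distance to the minimizer by the residual. The fraction that minimizes
  \<open>1 - \<tau> + \<tau>\<^bsup>p+1\<^esup>\<close> depends on \<open>p\<close>; two thirds is good enough for \<open>p \<ge> 6\<close>.
\<close>

lemma contraction_prox:
  assumes x: "x \<in> edom \<psi>" and y: "y \<in> edom \<psi>"
    and min: "h x \<ge> h y + \<mu> * \<beta> y x"
  shows "h (step x) - h y \<le> (1/3 + (2/3) ^ (p + 1)) * (h x - h y)"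
proof -
  let ?w = "(1 - 2/3) *\<^sub>R x + (2/3) *\<^sub>R y"
  have w: "?w \<in> edom \<psi>"
    using convex_edom x y by (intro convexD) auto
  have "(1 - \<tau>) *\<^sub>R x + \<tau> *\<^sub>R y - x = \<tau> *\<^sub>R (y - x)" for \<tau>
    by (simp add: algebra_simps)
  from this[of "2/3"] have "bnorm B (?w - x) ^ (p + 1) = (2/3) ^ (p + 1) * bnorm B (y - x) ^ (p + 1)"
    by (simp only: bnorm_scale power_mult_distrib abs_of_nonneg)
  then have "h (step x) \<le> h ?w + (2/3) ^ (p + 1) * (\<Lambda> / real (p + 1) * bnorm B (x - y) ^ (p + 1))"
    using step_le[OF x w] unfolding bnorm_minus_commute[of x y] by (simp only: mult.left_commute)
  also have "\<dots> \<le> h ?w + (2/3) ^ (p + 1) * (h x - h y)"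
    using uniform_convexity[of x y] min by (intro add_left_mono mult_left_mono) auto
  also have "h ?w \<le> (1 - 2/3) * h x + 2/3 * h y"
    by (rule h_convex[OF x y]) auto
  finally show ?thesis
    by (simp add: algebra_simps)
qed

lemma contraction:
  assumes x: "x \<in> edom \<psi>" and y: "y \<in> edom \<psi>"
    and min: "h x \<ge> h y + \<mu> * \<beta> y x"
  shows "h (step x) - h y \<le> exp (- inner_rate p) * (h x - h y)"
proof -
  have "0 \<le> \<Lambda> / real (p + 1) * bnorm B (x - y) ^ (p + 1)"
    using Lambda_pos by simp
  then have "h x - h y \<ge> 0"
    using min uniform_convexity[of x y] by linarith
  then show ?thesis
    using inner_rate_bound[OF p] contraction_gradient[OF x y] contraction_prox[OF assms]
    by (meson mult_right_mono order_trans)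
qed

text \<open>
  The first step brings the residual down to the distance from the minimizer, the following
  ones contract it, and the last one passes the test: a step that starts with a small residual
  ends with a small gradient.
\<close>

lemma inner_loop_terminates:
  assumes z: "z 0 = v" "\<And>j. z (Suc j) = step (z j)"
    and y: "y \<in> edom \<psi>" "\<And>x. x \<in> edom \<psi> \<Longrightarrow> h x \<ge> h y + \<mu> * \<beta> y x"
    and \<delta>: "\<delta> > 0" and Y: "Y \<ge> 1"
    and dist: "bnorm B (v - y) ^ (p + 1) \<le> Y * root p (\<delta> / \<Lambda>) ^ (p + 1)"
  obtains j where "inner_stop B p Mreg g \<delta> z j" "real j \<le> 3 + ln Y / inner_rate p"
proof -
  define n where "n = nat \<lceil>ln Y / inner_rate p\<rceil>"
  define \<theta>\<delta> where "\<theta>\<delta> = root p (\<delta> / \<Lambda>)"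
  have \<theta>\<delta>: "\<theta>\<delta> > 0" "\<Lambda> * \<theta>\<delta> ^ p = \<delta>"
    using \<delta> Lambda_pos p by (auto simp: \<theta>\<delta>_def)
  have dom: "z j \<in> edom \<psi>" for j
    by (induction j) (auto simp: z v_in step_minimizes)
  have res: "h (z (Suc i)) - h y \<le> exp (- inner_rate p) ^ i * (\<Lambda> / real (p + 1) * bnorm B (v - y) ^ (p + 1))" for i
  proof (induction i)
    case 0
    then show ?case
      using step_le[OF v_in y(1)] by (simp add: z bnorm_minus_commute)
  next
    case (Suc i)
    have "h (z (Suc (Suc i))) - h y \<le> exp (- inner_rate p) * (h (z (Suc i)) - h y)"
      using contraction[OF dom y(1) y(2)[OF dom], of "Suc i"] z(2)[of "Suc i"] by simp
    also have "\<dots> \<le> exp (- inner_rate p) * (exp (- inner_rate p) ^ i * (\<Lambda> / real (p + 1) * bnorm B (v - y) ^ (p + 1)))"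
      using Suc by (intro mult_left_mono) auto
    finally show ?case
      by simp
  qed
  have "ln Y / inner_rate p \<le> real n"
    unfolding n_def by linarith
  then have "ln Y \<le> real n * inner_rate p"
    using inner_rate_pos[OF p] by (simp add: divide_le_eq)
  then have "exp (- inner_rate p) ^ n \<le> exp (- ln Y)"
    by (simp flip: exp_of_nat_mult)
  then have n: "exp (- inner_rate p) ^ n \<le> 1 / Y"
    using Y by (simp add: exp_minus field_simps)
  have "h (z (Suc n)) - h y \<le> 1 / Y * (\<Lambda> / real (p + 1) * (Y * \<theta>\<delta> ^ (p + 1)))"
    using Lambda_pos dist n Y
    by (intro order_trans[OF res] mult_mono mult_left_mono) (auto simp: \<theta>\<delta>_def)
  also have "\<dots> = \<Lambda> * \<theta>\<delta> ^ (p + 1) * (1 / real (p + 1))"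
    using Y by simp
  finally have small: "h (z (Suc n)) - h y \<le> \<Lambda> * \<theta>\<delta> ^ (p + 1) * (1 / real (p + 1))" .
  have S: "z (Suc n) \<in> S" "step (z (Suc n)) \<in> S"
    using step_in_S[OF dom] by auto
  obtain \<theta> where \<theta>: "\<theta> \<ge> 0" "dual_norm B (grad (z (Suc n)) (step (z (Suc n)))) = \<Lambda> * \<theta> ^ p"
    using grad_radius[OF S] by blast
  have "\<theta> \<le> \<theta>\<delta>"
  proof (rule ccontr)
    assume "\<not> \<theta> \<le> \<theta>\<delta>"
    then have "\<Lambda> * \<theta>\<delta> ^ (p + 1) < \<Lambda> * \<theta> ^ (p + 1)"
      using \<theta>\<delta> Lambda_pos by (intro mult_strict_left_mono power_strict_mono) auto
    then have "\<Lambda> * \<theta>\<delta> ^ (p + 1) * (1 / real (p + 1)) < \<Lambda> * \<theta> ^ (p + 1) * (1 / real (p + 1))"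
      by (intro mult_strict_right_mono) auto
    also have "\<dots> \<le> \<Lambda> * \<theta> ^ (p + 1) * (real (p + 2) / real (p + 1))"
      using Lambda_pos \<theta>(1) by (intro mult_left_mono divide_right_mono) auto
    also have "\<dots> \<le> h (z (Suc n)) - h (step (z (Suc n)))"
      by (rule step_decrease[OF dom \<theta>])
    also have "\<dots> \<le> h (z (Suc n)) - h y"
    proof -
      have "0 \<le> \<Lambda> / real (p + 1) * bnorm B (step (z (Suc n)) - y) ^ (p + 1)"
        using Lambda_pos by simp
      then show ?thesis
        using y(2)[OF step_minimizes(1)[OF dom], of "Suc n"] uniform_convexity[of "step (z (Suc n))" y]
        by linarith
    qed
    finally show False
      using small by simp
  qed
  then have "\<Lambda> * \<theta> ^ p \<le> \<Lambda> * \<theta>\<delta> ^ p"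
    using \<theta>(1) Lambda_pos by (intro mult_left_mono power_mono) auto
  then have "inner_stop B p Mreg g \<delta> z (Suc (Suc n))"
    using \<theta>(2) \<theta>\<delta>(2) by (simp add: inner_stop_def grad_def z(2)[of "Suc n"])
  moreover have "real (Suc (Suc n)) \<le> 3 + ln Y / inner_rate p"
  proof -
    have "0 \<le> ln Y / inner_rate p"
      using Y inner_rate_pos[OF p] by simp
    then show ?thesis
      unfolding n_def by linarith
  qed
  ultimately show ?thesis
    by (rule that)
qed

end

section \<open>The outer iteration\<close>

locale contracting_method = spd_geometry B + closed_convex \<psi>
  for B :: "'a::euclidean_space \<Rightarrow> 'a \<Rightarrow> real" and \<psi> :: "'a \<Rightarrow> ereal" +
  fixes f :: "'a \<Rightarrow> real" and domf :: "'a set" and p :: nat and L \<sigma> \<gamma>0 \<epsilon> \<omega> \<delta> :: real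
    and x0 xs :: 'a and x v :: "nat \<Rightarrow> 'a" and a A \<gamma> :: "nat \<Rightarrow> real"
    and z :: "nat \<Rightarrow> nat \<Rightarrow> 'a" and t :: "nat \<Rightarrow> nat"
  assumes p: "p \<ge> 1"
    and f_dom: "open domf"
    and f_convex: "convex_on domf f"
    and f_diff: "times_differentiable_on p f domf"
    and L_pos: "L > 0"
    and f_Lipschitz: "\<And>y w. y \<in> domf \<Longrightarrow> w \<in> domf \<Longrightarrow>
      form_norm B p (\<lambda>hs. nderiv f hs y - nderiv f hs w) \<le> L * bnorm B (y - w)"
    and dom: "edom \<psi> \<subseteq> domf"
    and solution: "is_arg_min (composite f \<psi>) (\<lambda>_. True) xs"
    and x0: "x0 \<in> edom (composite f \<psi>)"
    and sigma_pos: "\<sigma> > 0"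
    and sigma: "relatively_strongly_convex (prox_fun B p x0) \<sigma> \<psi>"
    and gamma0: "\<gamma>0 > 0"
    and eps: "\<epsilon> > 0"
    and omega: "\<omega> = min ((\<sigma> * fact p / (L * real (p + 1) * 2 ^ (p - 1))) powr (1 / real (p + 1)))
                        (1 / 2)"
    and delta: "\<delta> = (fact p * \<epsilon> / L) powr (real p / real (p + 1))
                  * (\<gamma>0 * real p * \<omega>
                     / (2 ^ p * real (p + 1) powr ((real (p + 1) ^ 2 + 1) / real (p + 1))))"
    and run: "contracting_prox_tensor_method B p f \<psi> L \<sigma> x0 \<delta> \<gamma>0 \<omega> x v a A \<gamma> z t"
begin

abbreviation "\<beta> \<equiv> bregman (prox_fun B p x0)"

text \<open>The value of both \<open>a 1\<close> and \<open>A 1\<close>.\<close>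

definition "A1 = fact p * \<gamma>0 / (2 ^ (p - 1) * real (p + 1) ^ (p + 1) * L)"

abbreviation "gk k \<equiv> sub_smooth f (a (Suc k)) (A k) (x k)"

lemma init: "x 0 = x0" "v 0 = x0" "A 0 = 0" "\<gamma> 0 = \<gamma>0"
  and a_Suc: "a (Suc k) = (if k = 0 then A1 else \<omega> / (1 - \<omega>) * A k)"
  and A_Suc: "A (Suc k) = A k + a (Suc k)"
  and z_0: "z k 0 = v k"
  and z_Suc: "z k (Suc j) = tensor_step B p (sub_reg p L (a (Suc k)) (A k)) (gk k)
      (sub_composite (prox_fun B p x0) \<psi> (a (Suc k)) (\<gamma> k) (v k)) (z k j)"
  and t_eq: "t k = (LEAST j. inner_stop B p (sub_reg p L (a (Suc k)) (A k)) (gk k) \<delta> (z k) j)"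
  and v_Suc: "v (Suc k) = z k (t k)"
  and x_Suc: "x (Suc k) = (1 / A (Suc k)) *\<^sub>R (a (Suc k) *\<^sub>R v (Suc k) + A k *\<^sub>R x k)"
  and gamma_Suc: "\<gamma> (Suc k) = \<gamma> k + a (Suc k) * \<sigma>"
proof -
  have "fact p * \<gamma>0 / (2 ^ (p - 1) * real (p + 1) ^ (p + 2) * L) * real (p + 1) = A1"
  proof -
    have "N / (s * q ^ (p + 2) * L) * q = N / (s * q ^ (p + 1) * L)" if "q \<noteq> 0" for N s q :: real
      using that by simp
    then show ?thesis
      unfolding A1_def by (metis of_nat_eq_0_iff add_is_0 one_neq_zero)
  qed
  then show "x 0 = x0" "v 0 = x0" "A 0 = 0" "\<gamma> 0 = \<gamma>0"
    "a (Suc k) = (if k = 0 then A1 else \<omega> / (1 - \<omega>) * A k)"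
    "A (Suc k) = A k + a (Suc k)" "z k 0 = v k"
    "z k (Suc j) = tensor_step B p (sub_reg p L (a (Suc k)) (A k)) (gk k)
      (sub_composite (prox_fun B p x0) \<psi> (a (Suc k)) (\<gamma> k) (v k)) (z k j)"
    "t k = (LEAST j. inner_stop B p (sub_reg p L (a (Suc k)) (A k)) (gk k) \<delta> (z k) j)"
    "v (Suc k) = z k (t k)"
    "x (Suc k) = (1 / A (Suc k)) *\<^sub>R (a (Suc k) *\<^sub>R v (Suc k) + A k *\<^sub>R x k)"
    "\<gamma> (Suc k) = \<gamma> k + a (Suc k) * \<sigma>"
    using run unfolding contracting_prox_tensor_method_def Let_def by auto
qed

lemma A1_pos: "A1 > 0"
  using gamma0 L_pos by (simp add: A1_def)

lemma omega_pos: "\<omega> > 0" and omega_le: "\<omega> \<le> 1/2"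
  using sigma_pos L_pos by (auto simp: omega)

text \<open>
  The property of \<open>\<omega>\<close> behind the conditioning of the subproblems: \<open>\<sigma> A\<close> dominates the Lipschitz
  constant \<open>L \<omega>\<^bsup>p+1\<^esup> A\<close>.
\<close>

lemma omega_power_le: "\<omega> ^ (p + 1) * (L * real (p + 1) * 2 ^ (p - 1)) \<le> \<sigma> * fact p"
proof -
  let ?c = "\<sigma> * fact p / (L * real (p + 1) * 2 ^ (p - 1))"
  have c: "?c > 0"
    using sigma_pos L_pos by simp
  have "\<omega> ^ (p + 1) \<le> (?c powr (1 / real (p + 1))) ^ (p + 1)"
    using omega_pos by (intro power_mono) (auto simp: omega)
  also have "\<dots> = ?c"
  proof -
    have "(?c powr (1 / real (p + 1))) ^ (p + 1) = ?c powr (real (p + 1) * (1 / real (p + 1)))"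
      using sigma_pos L_pos by (intro powr_power) simp
    also have "real (p + 1) * (1 / real (p + 1)) = 1"
      by (simp del: of_nat_add)
    finally show ?thesis
      unfolding powr_one[OF less_imp_le[OF c]] .
  qed
  finally show ?thesis
    using L_pos by (simp add: le_divide_eq del: of_nat_add)
qed

lemma A_eq: "A (Suc k) = A1 / (1 - \<omega>) ^ k"
proof (induction k)
  case (Suc k)
  have "A (Suc (Suc k)) = A (Suc k) / (1 - \<omega>)"
    using omega_le unfolding A_Suc[of "Suc k"] a_Suc by (simp add: field_simps)
  then show ?case
    using Suc by simp
qed (simp add: A_Suc a_Suc init)

lemma A_pos: "A (Suc k) > 0" and A_nonneg: "A k \<ge> 0"
proof -
  have pos: "A (Suc k) > 0" for k
    using A1_pos omega_le by (simp add: A_eq)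
  then show "A (Suc k) > 0" .
  show "A k \<ge> 0"
    using pos by (cases k) (auto simp: init intro: less_imp_le)
qed

lemma a_eq: "a (Suc k) = (if k = 0 then A1 else \<omega> * A (Suc k))"
proof (cases k)
  case (Suc m)
  then show ?thesis
    using omega_le A_Suc[of k] a_Suc[of k] by (simp add: field_simps)
qed (simp add: a_Suc)

lemma a_pos: "a (Suc k) > 0"
  using A1_pos A_pos[of k] omega_pos by (simp add: a_eq)

lemma gamma_eq: "\<gamma> k = \<gamma>0 + \<sigma> * A k"
  by (induction k) (simp_all add: init gamma_Suc A_Suc algebra_simps)

lemma gamma_ge: "\<gamma> k \<ge> \<gamma>0"
  using sigma_pos A_nonneg[of k] by (simp add: gamma_eq)

lemma gamma_pos: "\<gamma> k > 0"
  using gamma_ge[of k] gamma0 by linarith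

lemma delta_pos: "\<delta> > 0"
  using eps L_pos gamma0 p omega_pos unfolding delta
  by (intro mult_pos_pos divide_pos_pos) auto

definition "F y = f y + real_part \<psi> y"

lemma composite_eq: "y \<in> edom \<psi> \<Longrightarrow> composite f \<psi> y = ereal (F y)"
  by (simp add: composite_def psi_eq F_def)

lemma edom_composite: "edom (composite f \<psi>) = edom \<psi>"
proof -
  have "composite f \<psi> y < \<infinity> \<longleftrightarrow> \<psi> y < \<infinity>" for y
    by (cases "\<psi> y") (auto simp: composite_def)
  then show ?thesis
    by (simp add: edom_def)
qed

lemma x0_in: "x0 \<in> edom \<psi>"
  using x0 by (simp add: edom_composite)

lemma xs_in: "xs \<in> edom \<psi>"
  and F_min: "y \<in> edom \<psi> \<Longrightarrow> F xs \<le> F y"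
proof -
  have le: "composite f \<psi> xs \<le> composite f \<psi> y" for y
    using solution by (simp add: is_arg_min_def not_less)
  show xs: "xs \<in> edom \<psi>"
    using le[of x0] x0 unfolding edom_composite[symmetric] by (auto simp: edom_def)
  show "F xs \<le> F y" if "y \<in> edom \<psi>"
    using le[of y] by (simp add: composite_eq that xs)
qed

sublocale f: smooth_function B p domf f L
  using p L_pos f_dom f_convex f_diff f_Lipschitz
  by unfold_locales (auto simp: convex_on_def)

text \<open>
  By optimality of the solution the negative gradient of \<open>f\<close> there is a subgradient of \<open>\<psi>\<close>.
\<close>

lemma psi_minorant: "\<exists>s c. linear s \<and> (\<forall>y\<in>edom \<psi>. real_part \<psi> y \<ge> s y + (c::real))"
proof -
  have D: "(f has_derivative frechet_derivative f (at xs)) (at xs)"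
    using times_differentiable_onD[OF f_diff, of "[]" xs] p xs_in dom by auto
  have "(\<lambda>h. - (frechet_derivative f (at xs) h / 1)) \<in> subdifferential \<psi> xs"
    using F_min unfolding F_def by (intro minimizer_subgradient[OF xs_in _ D]) auto
  then obtain s where s: "linear s" "\<And>y. \<psi> xs + ereal (s (y - xs)) \<le> \<psi> y"
    unfolding subdifferential_def by blast
  have "real_part \<psi> y \<ge> s y + (real_part \<psi> xs - s xs)" if "y \<in> edom \<psi>" for y
    using s(2)[of y] psi_eq[OF that] psi_eq[OF xs_in] linear_diff[OF s(1), of y xs] by simp
  then show ?thesis
    using s(1) by blast
qed

definition "gk_dom k = {y. (a (Suc k) / A (Suc k)) *\<^sub>R y + (A k / A (Suc k)) *\<^sub>R x k \<in> domf}"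

definition "gk_lip k = L * (a (Suc k) ^ (p + 1) / A (Suc k) ^ p)"

definition "contracted k w = (1 / A (Suc k)) *\<^sub>R (a (Suc k) *\<^sub>R w + A k *\<^sub>R x k)"

lemma contracted_eq: "contracted k w = (a (Suc k) / A (Suc k)) *\<^sub>R w + (A k / A (Suc k)) *\<^sub>R x k"
  by (simp add: contracted_def scaleR_add_right)

lemma gk_eq: "gk k w = A (Suc k) * f (contracted k w)"
  by (simp add: sub_smooth_def contracted_def A_Suc)

lemma contracted_convex_comb:
  "0 \<le> a (Suc k) / A (Suc k)" "0 \<le> A k / A (Suc k)" "a (Suc k) / A (Suc k) + A k / A (Suc k) = 1"
  using a_pos[of k] A_pos[of k] A_nonneg[of k]
  by (auto simp: A_Suc add_divide_distrib[symmetric] add.commute intro!: divide_nonneg_nonneg)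

lemma contracted_in:
  assumes "convex C" "x k \<in> C" "w \<in> C"
  shows "contracted k w \<in> C"
  unfolding contracted_eq using contracted_convex_comb by (intro convexD assms)

lemma Lambda_k:
  "real (p + 1) * gk_lip k / fact p =
    \<gamma>0 * (if k = 0 then 1 else \<omega> ^ (p + 1) / (1 - \<omega>) ^ k) / (2 ^ (p - 1) * real (p + 1) ^ p)"
proof -
  have "a (Suc k) ^ (p + 1) / A (Suc k) ^ p = (if k = 0 then 1 else \<omega> ^ (p + 1)) * A (Suc k)"
    using A_pos[of k] A1_pos A_eq[of 0] by (simp add: a_eq power_mult_distrib)
  then have "real (p + 1) * gk_lip k / fact p =
      (if k = 0 then 1 else \<omega> ^ (p + 1)) * (real (p + 1) * L * A1 / fact p) / (1 - \<omega>) ^ k"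
    unfolding gk_lip_def by (simp add: A_eq mult_ac)
  also have "real (p + 1) * L * A1 / fact p = \<gamma>0 / (2 ^ (p - 1) * real (p + 1) ^ p)"
    using L_pos by (simp add: A1_def)
  finally show ?thesis
    by (simp add: mult_ac)
qed

lemma well_conditioned: "real (p + 1) * gk_lip k / fact p \<le> (\<gamma> k + a (Suc k) * \<sigma>) / 2 ^ (p - 1)"
proof (cases k)
  case 0
  have "\<gamma>0 / (2 ^ (p - 1) * real (p + 1) ^ p) \<le> \<gamma>0 / 2 ^ (p - 1)"
    using gamma0 one_le_power[of "real (p + 1)" p]
    by (intro divide_left_mono) auto
  also have "\<dots> \<le> (\<gamma> 0 + a (Suc 0) * \<sigma>) / 2 ^ (p - 1)"
    using a_pos[of 0] sigma_pos by (intro divide_right_mono) (auto simp: init)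
  finally show ?thesis
    unfolding Lambda_k using 0 by simp
next
  case (Suc m)
  have "\<gamma>0 * (\<omega> ^ (p + 1) / (1 - \<omega>) ^ k) / (2 ^ (p - 1) * real (p + 1) ^ p)
      = \<omega> ^ (p + 1) * (L * real (p + 1) * 2 ^ (p - 1)) / fact p * A (Suc k) / 2 ^ (p - 1)"
    unfolding A_eq A1_def using L_pos omega_le by (simp add: mult_ac del: of_nat_add)
  also have "\<dots> \<le> \<sigma> * A (Suc k) / 2 ^ (p - 1)"
    using omega_power_le A_pos[of k] by (intro divide_right_mono mult_right_mono) (auto simp: divide_le_eq)
  also have "\<dots> \<le> \<gamma> (Suc k) / 2 ^ (p - 1)"
    using gamma0 by (intro divide_right_mono) (auto simp: gamma_eq)
  finally show ?thesis
    unfolding Lambda_k using Suc by (simp add: gamma_Suc)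
qed

lemma subproblem_k:
  assumes xk: "x k \<in> edom \<psi>" and vk: "v k \<in> edom \<psi>"
  shows "well_conditioned_subproblem B p (gk_dom k) (gk k) (gk_lip k) \<psi> (a (Suc k)) (\<gamma> k) \<sigma> x0 (v k)"
proof -
  have gk_fun: "gk k = (\<lambda>w. A (Suc k) * f ((a (Suc k) / A (Suc k)) *\<^sub>R w + (A k / A (Suc k)) *\<^sub>R x k))"
    by (simp add: fun_eq_iff gk_eq contracted_eq)
  have lip: "gk_lip k = A (Suc k) * (a (Suc k) / A (Suc k)) ^ (p + 1) * L"
    using A_pos[of k] by (simp add: gk_lip_def power_divide)
  interpret g: smooth_function B p "gk_dom k" "gk k" "gk_lip k"
    unfolding gk_fun lip gk_dom_def
    using A_pos[of k] a_pos[of k] by (intro f.smooth_function_affine) auto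
  have "convex_on (gk_dom k) (gk k)"
    unfolding convex_on_def
  proof (intro conjI ballI allI impI)
    show "convex (gk_dom k)"
      by (rule g.S_convex)
    fix y w :: 'a and r s :: real
    assume yw: "y \<in> gk_dom k" "w \<in> gk_dom k" and rs: "0 \<le> r" "0 \<le> s" "r + s = 1"
    have "contracted k (r *\<^sub>R y + s *\<^sub>R w) = r *\<^sub>R contracted k y + s *\<^sub>R contracted k w"
    proof -
      have "r *\<^sub>R (\<alpha> *\<^sub>R y + e) + s *\<^sub>R (\<alpha> *\<^sub>R w + e) = \<alpha> *\<^sub>R (r *\<^sub>R y + s *\<^sub>R w) + (r + s) *\<^sub>R e"
        for \<alpha> and e :: 'a
        by (simp add: algebra_simps)
      then show ?thesis
        unfolding contracted_eq rs(3) by simp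
    qed
    moreover have "f (r *\<^sub>R contracted k y + s *\<^sub>R contracted k w) \<le> r * f (contracted k y) + s * f (contracted k w)"
      using f_convex yw rs unfolding convex_on_def gk_dom_def contracted_eq by blast
    ultimately have "A (Suc k) * f (contracted k (r *\<^sub>R y + s *\<^sub>R w)) \<le> A (Suc k) * (r * f (contracted k y) + s * f (contracted k w))"
      using A_pos[of k] by simp
    then show "gk k (r *\<^sub>R y + s *\<^sub>R w) \<le> r * gk k y + s * gk k w"
      unfolding gk_eq by (simp add: algebra_simps)
  qed
  moreover have "edom \<psi> \<subseteq> gk_dom k"
    using contracted_in[OF convex_edom xk] dom unfolding gk_dom_def contracted_eq by blast
  moreover have "gk_lip k > 0"
    using L_pos a_pos[of k] A_pos[of k] by (simp add: gk_lip_def)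
  ultimately interpret sp: subproblem B p "gk_dom k" "gk k" "gk_lip k" \<psi> "a (Suc k)" "\<gamma> k" \<sigma> x0 "v k"
    using a_pos gamma_pos sigma_pos vk sigma psi_minorant by unfold_locales auto
  show ?thesis
    using well_conditioned[of k] by unfold_locales (simp add: sp.\<Lambda>_def)
qed

text \<open>The potential of the method: it would decrease if the subproblems were solved exactly.\<close>

definition "energy k = A k * (F (x k) - F xs) + \<gamma> k * \<beta> (v k) xs"

text \<open>
  Convexity bounds the subproblem at the solution from above and at the new point \<open>w\<close> from
  below by multiples of \<open>F\<close>; \<open>c\<close> is the inaccuracy of \<open>w\<close> as a minimizer.
\<close>

lemma energy_step:
  assumes xk: "x k \<in> edom \<psi>" and vk: "v k \<in> edom \<psi>" and w: "w \<in> edom \<psi>"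
    and ge: "gk k xs + a (Suc k) * real_part \<psi> xs + \<gamma> k * \<beta> (v k) xs \<ge>
      gk k w + a (Suc k) * real_part \<psi> w + \<gamma> k * \<beta> (v k) w - c + \<gamma> (Suc k) * \<beta> w xs"
  shows "A (Suc k) * (F (contracted k w) - F xs) + \<gamma> (Suc k) * \<beta> w xs + \<gamma> k * \<beta> (v k) w \<le> energy k + c"
proof -
  note AS = A_pos[of k]
  have cancel: "A (Suc k) * (a (Suc k) / A (Suc k) * r + A k / A (Suc k) * s) = a (Suc k) * r + A k * s" for r s
    using AS by (simp add: distrib_left)
  have "f (contracted k xs) \<le> a (Suc k) / A (Suc k) * f xs + A k / A (Suc k) * f (x k)"
    using f_convex contracted_convex_comb xs_in xk dom unfolding convex_on_def contracted_eq by blast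
  then have "A (Suc k) * f (contracted k xs) \<le> A (Suc k) * (a (Suc k) / A (Suc k) * f xs + A k / A (Suc k) * f (x k))"
    using AS by simp
  then have 1: "gk k xs \<le> a (Suc k) * f xs + A k * f (x k)"
    unfolding cancel gk_eq .
  have "real_part \<psi> (contracted k w) \<le> a (Suc k) / A (Suc k) * real_part \<psi> w + A k / A (Suc k) * real_part \<psi> (x k)"
    using convex_on_real_part contracted_convex_comb w xk unfolding convex_on_def contracted_eq by blast
  then have "A (Suc k) * real_part \<psi> (contracted k w) \<le> A (Suc k) * (a (Suc k) / A (Suc k) * real_part \<psi> w + A k / A (Suc k) * real_part \<psi> (x k))"
    using AS by simp
  then have 2: "A (Suc k) * real_part \<psi> (contracted k w) \<le> a (Suc k) * real_part \<psi> w + A k * real_part \<psi> (x k)"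
    unfolding cancel .
  show ?thesis
    using 1 2 ge unfolding energy_def F_def gk_eq[of k w] A_Suc by (simp add: algebra_simps)
qed

lemma bregman_lower: "\<gamma> k * bnorm B (w - y) ^ (p + 1) \<le> 2 ^ (p - 1) * real (p + 1) * (\<gamma> k * \<beta> w y)"
proof -
  have "bnorm B (w - y) ^ (p + 1) \<le> 2 ^ (p - 1) * real (p + 1) * \<beta> w y"
    using bregman_ge[OF p, where x = w and y = y and c = x0]
    by (simp add: divide_le_eq bnorm_minus_commute[of w y] mult.commute del: of_nat_add)
  from mult_left_mono[OF this less_imp_le[OF gamma_pos[of k]]] show ?thesis
    by (simp only: mult.left_commute)
qed

text \<open>
  Bounding the distance from \<open>v\<^sub>k\<close> to the exact solution is where the term \<open>\<gamma>\<^sub>k \<beta> v\<^sub>k w\<close> of the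
  potential inequality is used.
\<close>

lemma exact_solution:
  assumes xk: "x k \<in> edom \<psi>" and vk: "v k \<in> edom \<psi>"
  obtains y where "y \<in> edom \<psi>"
    "\<And>w. w \<in> edom \<psi> \<Longrightarrow> gk k w + a (Suc k) * real_part \<psi> w + \<gamma> k * \<beta> (v k) w \<ge>
      gk k y + a (Suc k) * real_part \<psi> y + \<gamma> k * \<beta> (v k) y + \<gamma> (Suc k) * \<beta> y w"
    "\<gamma> k * \<beta> (v k) y \<le> energy k"
proof -
  interpret sp: well_conditioned_subproblem B p "gk_dom k" "gk k" "gk_lip k" \<psi> "a (Suc k)" "\<gamma> k" \<sigma> x0 "v k"
    by (rule subproblem_k[OF assms])
  obtain y where y: "y \<in> edom \<psi>"
    and ge: "\<And>w. w \<in> edom \<psi> \<Longrightarrow> sp.h w \<ge> sp.h y + (\<gamma> k + a (Suc k) * \<sigma>) * \<beta> y w"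
    using sp.exists_exact_minimizer by blast
  have ge': "gk k w + a (Suc k) * real_part \<psi> w + \<gamma> k * \<beta> (v k) w \<ge>
      gk k y + a (Suc k) * real_part \<psi> y + \<gamma> k * \<beta> (v k) y + \<gamma> (Suc k) * \<beta> y w" if "w \<in> edom \<psi>" for w
    using ge[OF that] by (simp add: sp.h_def gamma_Suc)
  have "A (Suc k) * (F (contracted k y) - F xs) \<ge> 0"
    using A_pos[of k] F_min[OF contracted_in[OF convex_edom xk y]] by simp
  moreover have "\<gamma> (Suc k) * \<beta> y xs \<ge> 0"
    using gamma_pos bregman_nonneg[OF p] by (simp add: less_imp_le)
  moreover have "A (Suc k) * (F (contracted k y) - F xs) + \<gamma> (Suc k) * \<beta> y xs + \<gamma> k * \<beta> (v k) y \<le> energy k + 0"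
    using ge'[OF xs_in] by (intro energy_step[OF xk vk y]) simp
  ultimately have "\<gamma> k * \<beta> (v k) y \<le> energy k"
    by linarith
  with y ge' show ?thesis
    by (rule that)
qed

abbreviation "stops k \<equiv> inner_stop B p (sub_reg p L (a (Suc k)) (A k)) (gk k) \<delta> (z k)"

text \<open>
  \<open>R\<close> bounds the \<open>(p+1)\<close>-st power of the distance to the solution of the subproblem. The
  hypothesis relating it to \<open>Y\<close> is raised to the power \<open>p\<close> to avoid roots.
\<close>

lemma inner_loop:
  assumes xk: "x k \<in> edom \<psi>" and vk: "v k \<in> edom \<psi>" and Y: "Y \<ge> 1"
    and R: "2 ^ (p - 1) * real (p + 1) * energy k \<le> \<gamma> k * R"
    and RY: "R ^ p * (real (p + 1) * gk_lip k / fact p) ^ (p + 1) \<le> Y ^ p * \<delta> ^ (p + 1)"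
  obtains j where "stops k j" "real j \<le> 3 + ln Y / inner_rate p"
proof -
  interpret sp: well_conditioned_subproblem B p "gk_dom k" "gk k" "gk_lip k" \<psi> "a (Suc k)" "\<gamma> k" \<sigma> x0 "v k"
    by (rule subproblem_k[OF xk vk])
  obtain y where y: "y \<in> edom \<psi>"
    "\<And>w. w \<in> edom \<psi> \<Longrightarrow> gk k w + a (Suc k) * real_part \<psi> w + \<gamma> k * \<beta> (v k) w \<ge>
      gk k y + a (Suc k) * real_part \<psi> y + \<gamma> k * \<beta> (v k) y + \<gamma> (Suc k) * \<beta> y w"
    and E: "\<gamma> k * \<beta> (v k) y \<le> energy k"
    using exact_solution[OF xk vk] by metis
  have M: "sp.Mreg = sub_reg p L (a (Suc k)) (A k)"
    unfolding sp.Mreg_def unfolding sub_reg_def gk_lip_def A_Suc by simp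
  let ?r = "bnorm B (v k - y)"
  define \<theta> where "\<theta> = root p (\<delta> / sp.\<Lambda>)"
  have \<theta>: "\<theta> \<ge> 0" "\<delta> / sp.\<Lambda> = \<theta> ^ p"
    using delta_pos sp.Lambda_pos p by (auto simp: \<theta>_def)
  have "\<gamma> k * ?r ^ (p + 1) \<le> 2 ^ (p - 1) * real (p + 1) * (\<gamma> k * \<beta> (v k) y)"
    by (rule bregman_lower)
  also have "\<dots> \<le> 2 ^ (p - 1) * real (p + 1) * energy k"
    using E by (intro mult_left_mono) auto
  also note R
  finally have r: "?r ^ (p + 1) \<le> R"
    using gamma_pos[of k] by simp
  have "(?r ^ (p + 1)) ^ p * sp.\<Lambda> ^ (p + 1) \<le> R ^ p * sp.\<Lambda> ^ (p + 1)"
    using r sp.Lambda_pos by (intro mult_right_mono power_mono) auto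
  also have "\<dots> \<le> Y ^ p * \<delta> ^ (p + 1)"
    using RY by (simp add: sp.\<Lambda>_def)
  finally have "(?r ^ (p + 1)) ^ p \<le> Y ^ p * (\<delta> / sp.\<Lambda>) ^ (p + 1)"
    using sp.Lambda_pos by (simp add: power_divide le_divide_eq)
  also have "\<dots> = (Y * \<theta> ^ (p + 1)) ^ p"
    unfolding \<theta>(2) power_mult_distrib power_mult[symmetric] by (simp only: mult.commute)
  finally have dist: "?r ^ (p + 1) \<le> Y * root p (\<delta> / sp.\<Lambda>) ^ (p + 1)"
    unfolding \<theta>_def[symmetric] using Y \<theta>(1) p
    by (subst (asm) power_mono_iff) (auto intro!: mult_nonneg_nonneg zero_le_power)
  show ?thesis
  proof (rule sp.inner_loop_terminates[of "z k" y \<delta> Y])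
    show "z k 0 = v k"
      by (rule z_0)
    show "z k (Suc j) = sp.step (z k j)" for j
      by (simp add: z_Suc sp.step_def M)
    show "sp.h w \<ge> sp.h y + (\<gamma> k + a (Suc k) * \<sigma>) * \<beta> y w" if "w \<in> edom \<psi>" for w
      using y(2)[OF that] by (simp add: sp.h_def gamma_Suc)
  qed (use y(1) delta_pos Y dist that M in auto)
qed

lemma iterate_step:
  assumes xk: "x k \<in> edom \<psi>" and vk: "v k \<in> edom \<psi>"
  shows "stops k (t k)" "x (Suc k) \<in> edom \<psi>" "v (Suc k) \<in> edom \<psi>"
    and "energy (Suc k) \<le> energy k + \<delta> * bnorm B (v (Suc k) - xs)"
proof -
  interpret sp: well_conditioned_subproblem B p "gk_dom k" "gk k" "gk_lip k" \<psi> "a (Suc k)" "\<gamma> k" \<sigma> x0 "v k"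
    by (rule subproblem_k[OF assms])
  have M: "sp.Mreg = sub_reg p L (a (Suc k)) (A k)"
    unfolding sp.Mreg_def unfolding sub_reg_def gk_lip_def A_Suc by simp
  \<comment> \<open>Any sufficiently large \<open>Y\<close> proves that the inner loop terminates.\<close>
  define R where "R = 2 ^ (p - 1) * real (p + 1) * energy k / \<gamma> k"
  define c where "c = \<bar>R ^ p * (real (p + 1) * gk_lip k / fact p) ^ (p + 1) / \<delta> ^ (p + 1)\<bar>"
  define Y where "Y = 1 + root p c"
  have root_c: "root p c \<ge> 0" "c = root p c ^ p"
    using p by (auto simp: c_def simp del: of_nat_add power_Suc)
  have "c \<le> Y ^ p"
    by (subst root_c(2)) (use root_c(1) in \<open>auto simp: Y_def intro!: power_mono\<close>)
  then have "R ^ p * (real (p + 1) * gk_lip k / fact p) ^ (p + 1) / \<delta> ^ (p + 1) \<le> Y ^ p"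
    by (simp only: c_def abs_le_iff)
  then have "R ^ p * (real (p + 1) * gk_lip k / fact p) ^ (p + 1) \<le> Y ^ p * \<delta> ^ (p + 1)"
    using delta_pos by (simp add: pos_divide_le_eq del: of_nat_add power_Suc)
  moreover have "Y \<ge> 1" "2 ^ (p - 1) * real (p + 1) * energy k \<le> \<gamma> k * R"
    using gamma_pos[of k] root_c(1) by (auto simp: Y_def R_def)
  ultimately obtain j where "stops k j"
    using inner_loop[OF assms] by metis
  then show stop: "stops k (t k)"
    unfolding t_eq by (rule LeastI)
  have step: "z k (Suc j) = sp.step (z k j)" for j
    by (simp add: z_Suc sp.step_def M)
  have dom_z: "z k j \<in> edom \<psi>" for j
    by (induction j) (auto simp: z_0 vk step sp.step_minimizes)
  then show vS: "v (Suc k) \<in> edom \<psi>"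
    by (simp add: v_Suc)
  have xS: "x (Suc k) = contracted k (v (Suc k))"
    by (simp add: x_Suc contracted_def)
  then show "x (Suc k) \<in> edom \<psi>"
    using contracted_in[OF convex_edom xk vS] by simp
  obtain j where j: "t k = Suc j"
    using stop by (cases "t k") (auto simp: inner_stop_def)
  have vj: "v (Suc k) = sp.step (z k j)"
    by (simp add: v_Suc j step)
  let ?\<xi> = "sp.grad (z k j) (v (Suc k))"
  have lin: "linear ?\<xi>"
    unfolding vj using sp.step_in_S[OF dom_z] by (intro sp.linear_grad) auto
  have "dual_norm B ?\<xi> \<le> \<delta>"
    using stop unfolding inner_stop_def j by (simp add: sp.grad_def M v_Suc j)
  then have "dual_norm B ?\<xi> * bnorm B (v (Suc k) - xs) \<le> \<delta> * bnorm B (v (Suc k) - xs)"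
    by (intro mult_right_mono) auto
  then have "?\<xi> (v (Suc k) - xs) \<le> \<delta> * bnorm B (v (Suc k) - xs)"
    using le_dual_norm[OF lin, of "v (Suc k) - xs"] by linarith
  moreover have "?\<xi> (xs - v (Suc k)) = - ?\<xi> (v (Suc k) - xs)"
    using linear_diff[OF lin] by simp
  ultimately have "sp.h xs \<ge> sp.h (v (Suc k)) - \<delta> * bnorm B (v (Suc k) - xs) + \<gamma> (Suc k) * \<beta> (v (Suc k)) xs"
    using sp.step_strong_convexity[OF dom_z xs_in, of j] by (simp add: gamma_Suc flip: vj)
  then have "A (Suc k) * (F (contracted k (v (Suc k))) - F xs) + \<gamma> (Suc k) * \<beta> (v (Suc k)) xs + \<gamma> k * \<beta> (v k) (v (Suc k))
      \<le> energy k + \<delta> * bnorm B (v (Suc k) - xs)"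
    by (intro energy_step[OF xk vk vS]) (simp add: sp.h_def)
  moreover have "\<gamma> k * \<beta> (v k) (v (Suc k)) \<ge> 0"
    using gamma_pos[of k] bregman_nonneg[OF p] by (simp add: less_imp_le)
  ultimately show "energy (Suc k) \<le> energy k + \<delta> * bnorm B (v (Suc k) - xs)"
    unfolding energy_def[of "Suc k"] xS by linarith
qed

lemma iterates_in: "x k \<in> edom \<psi>" "v k \<in> edom \<psi>"
proof -
  have "x k \<in> edom \<psi> \<and> v k \<in> edom \<psi>"
    by (induction k) (auto simp: init x0_in iterate_step)
  then show "x k \<in> edom \<psi>" "v k \<in> edom \<psi>"
    by auto
qed

lemma energy_ge:
  shows "A k * (F (x k) - F xs) \<le> energy k" "\<gamma> k * \<beta> (v k) xs \<le> energy k" "energy k \<ge> 0"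
proof -
  have "A k * (F (x k) - F xs) \<ge> 0" "\<gamma> k * \<beta> (v k) xs \<ge> 0"
    using A_nonneg[of k] F_min[OF iterates_in(1), of k] gamma_pos[of k] bregman_nonneg[OF p]
    by (auto intro!: mult_nonneg_nonneg less_imp_le)
  then show "A k * (F (x k) - F xs) \<le> energy k" "\<gamma> k * \<beta> (v k) xs \<le> energy k" "energy k \<ge> 0"
    by (auto simp: energy_def)
qed

end

section \<open>Complexity bounds\<close>

lemma minus_ln_one_minus_le:
  assumes "0 \<le> s" "s \<le> (1/2 :: real)"
  shows "- ln (1 - s) \<le> 2 * ln 2 * s"
proof -
  have "exp ((1 - 2 * s) *\<^sub>R 0 + (2 * s) *\<^sub>R (- ln 2)) \<le> (1 - 2 * s) * exp 0 + (2 * s) * exp (- ln (2::real))"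
    using assms by (intro convex_onD[OF exp_convex]) auto
  also have "\<dots> = 1 - s"
    by (simp add: exp_minus field_simps)
  finally have "exp (- (2 * ln 2 * s)) \<le> 1 - s"
    by (simp add: mult_ac)
  moreover have "1 - s > 0"
    using assms by simp
  ultimately have "- (2 * ln 2 * s) \<le> ln (1 - s)"
    by (simp add: ln_ge_iff)
  then show ?thesis
    by simp
qed

context contracting_method
begin

definition "ell = ln (max (real (p + 1) ^ p / \<omega> ^ (p + 1))
  (L * \<beta> x0 xs * real (p + 1) ^ (p + 1) * 2 powr (real p + 1 / real p) / (fact p * \<epsilon>)))"

lemma exp_ell: "exp ell = max (real (p + 1) ^ p / \<omega> ^ (p + 1))
  (L * \<beta> x0 xs * real (p + 1) ^ (p + 1) * 2 powr (real p + 1 / real p) / (fact p * \<epsilon>))"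
proof -
  have "real (p + 1) ^ p / \<omega> ^ (p + 1) > 0"
    using omega_pos by (intro divide_pos_pos zero_less_power) auto
  then show ?thesis
    unfolding ell_def by (intro exp_ln) (simp only: less_max_iff_disj simp_thms)
qed

lemma omega_exp_ell: "real (p + 1) ^ p \<le> \<omega> ^ (p + 1) * exp ell"
proof -
  have "real (p + 1) ^ p / \<omega> ^ (p + 1) \<le> exp ell"
    unfolding exp_ell by simp
  then show ?thesis
    using omega_pos by (simp add: pos_divide_le_eq mult.commute del: of_nat_add power_Suc)
qed

lemma ell_pos: "ell > 0"
proof -
  have "1 < real (p + 1) ^ p"
    using p by (intro one_less_power) auto
  also have "\<dots> \<le> \<omega> ^ (p + 1) * exp ell"
    by (rule omega_exp_ell)
  also have "\<dots> \<le> 1 * exp ell"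
    using omega_pos omega_le by (intro mult_right_mono power_le_one) auto
  finally show ?thesis
    by simp
qed

abbreviation "X \<equiv> fact p * \<epsilon> / L"
abbreviation "N \<equiv> real (p + 1)"

lemma eps_A1: "\<epsilon> * A1 = X * \<gamma>0 / (2 ^ (p - 1) * N ^ (p + 1))"
  by (simp add: A1_def mult_ac)

lemma energy_0: "2 powr ((real p + 1) / real p) * energy 0 \<le> \<epsilon> * A1 * exp ell"
proof -
  have pw: "2 powr (real p + 1 / real p) = 2 powr ((real p + 1) / real p) * 2 ^ (p - 1)"
  proof -
    have "real p + 1 / real p = (real p + 1) / real p + real (p - 1)"
      using p by (simp add: of_nat_diff add_divide_distrib)
    then show ?thesis
      by (simp only: powr_add powr_realpow zero_less_numeral)
  qed
  have "L * \<beta> x0 xs * N ^ (p + 1) * 2 powr (real p + 1 / real p) / (fact p * \<epsilon>) \<le> exp ell"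
    unfolding exp_ell by simp
  then have "\<epsilon> * A1 * (L * \<beta> x0 xs * N ^ (p + 1) * 2 powr (real p + 1 / real p) / (fact p * \<epsilon>)) \<le> \<epsilon> * A1 * exp ell"
    using eps A1_pos by (intro mult_left_mono) auto
  moreover have "\<epsilon> * A1 * (L * \<beta> x0 xs * N ^ (p + 1) * 2 powr (real p + 1 / real p) / (fact p * \<epsilon>))
      = 2 powr ((real p + 1) / real p) * energy 0"
    unfolding pw A1_def energy_def using eps L_pos by (simp add: init del: of_nat_add power_Suc)
  ultimately show ?thesis
    by simp
qed

lemma delta_power:
  "\<delta> ^ (p + 1) = X ^ p * (\<gamma>0 * real p * \<omega>) ^ (p + 1) / (2 ^ (p * (p + 1)) * N ^ ((p + 1)\<^sup>2 + 1))"
proof -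
  have X: "X > 0"
    using eps L_pos by simp
  have "(X powr (real p / N)) ^ (p + 1) = X powr (N * (real p / N))"
    using eps L_pos by (intro powr_power) simp
  also have "N * (real p / N) = real p"
    by (simp del: of_nat_add)
  finally have 1: "(X powr (real p / N)) ^ (p + 1) = X ^ p"
    using X by (simp only: powr_realpow)
  have "(N powr ((N ^ 2 + 1) / N)) ^ (p + 1) = N powr (N * ((N ^ 2 + 1) / N))"
    by (intro powr_power) simp
  also have "N * ((N ^ 2 + 1) / N) = real ((p + 1)\<^sup>2 + 1)"
    by simp
  finally have 2: "(N powr ((N ^ 2 + 1) / N)) ^ (p + 1) = N ^ ((p + 1)\<^sup>2 + 1)"
    by (simp only: powr_realpow of_nat_0_less_iff)
  show ?thesis
    unfolding delta power_mult_distrib power_divide 1 2 power_mult[symmetric] by simp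
qed

lemma exponent_identities:
  fixes c :: real
  shows "c ^ (p * (p + 1)) = c ^ (p - 1) * (c ^ (p + 1) * c ^ ((p - 1) * p))"
    and "c ^ ((p + 1)\<^sup>2 + 1) = c * (c ^ (p + 1) * c ^ ((p + 1) * p))"
    and "c ^ (p * (p + 1)) * c ^ p = c ^ (2 * p + 1) * c ^ ((p - 1) * (p + 1))"
    and "c ^ ((p + 1)\<^sup>2 + 1) = c ^ (p + 2) * c ^ (p * (p + 1))"
proof -
  obtain m where m: "p = Suc m"
    using p by (cases p) auto
  show "c ^ (p * (p + 1)) = c ^ (p - 1) * (c ^ (p + 1) * c ^ ((p - 1) * p))"
    unfolding power_add[symmetric] by (rule arg_cong[where f = "power c"]) (simp add: m)
  have "c * (c ^ (p + 1) * c ^ ((p + 1) * p)) = c ^ (1 + ((p + 1) + (p + 1) * p))"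
    by (simp only: power_add power_one_right)
  also have "1 + ((p + 1) + (p + 1) * p) = (p + 1)\<^sup>2 + 1"
    by (simp add: power2_eq_square)
  finally show "c ^ ((p + 1)\<^sup>2 + 1) = c * (c ^ (p + 1) * c ^ ((p + 1) * p))" ..
  show "c ^ (p * (p + 1)) * c ^ p = c ^ (2 * p + 1) * c ^ ((p - 1) * (p + 1))"
    unfolding power_add[symmetric] by (rule arg_cong[where f = "power c"]) (simp add: m)
  show "c ^ ((p + 1)\<^sup>2 + 1) = c ^ (p + 2) * c ^ (p * (p + 1))"
    unfolding power_add[symmetric] by (rule arg_cong[where f = "power c"]) (simp add: power2_eq_square)
qed

text \<open>
  The inner accuracy \<open>\<delta>\<close> is tuned so that one iteration increases the \<open>p / (p+1)\<close>-th power of the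
  potential by at most the fraction \<open>u / 2\<close> of that power of \<open>\<epsilon> A\<^sub>1\<close>, with \<open>u\<close> so small that \<open>k u\<close>
  stays below the growth of that power of the scaling coefficients.
\<close>

definition "u = \<omega> * real p / N"

text \<open>The distance to the solution is at most \<open>dist_const\<close> times the \<open>(p+1)\<close>-st root of the energy.\<close>

definition "dist_const = root (p + 1) (2 ^ (p - 1) * N / \<gamma>0)"

definition "target = root (p + 1) (\<epsilon> * A1)"

lemma root_power: "y \<ge> 0 \<Longrightarrow> root (p + 1) y ^ (p + 1) = y"
  by (intro real_root_pow_pos2) auto

text \<open>Both sides are compared after raising them to the power \<open>p + 1\<close>, which removes all roots.\<close>

lemma delta_dist_const: "\<delta> * dist_const = u / 2 * target ^ p"
proof (rule power_eq_imp_eq_base)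
  have N: "N > 0"
    by simp
  have "(\<delta> * dist_const) ^ (p + 1) = \<delta> ^ (p + 1) * (2 ^ (p - 1) * N / \<gamma>0)"
    unfolding power_mult_distrib dist_const_def using gamma0 by (subst root_power) auto
  also have "\<dots> = X ^ p * (\<gamma>0 ^ (p + 1) * (real p * \<omega>) ^ (p + 1))
      / ((2 ^ (p - 1) * (2 ^ (p + 1) * 2 ^ ((p - 1) * p))) * (N * (N ^ (p + 1) * N ^ ((p + 1) * p))))
      * (2 ^ (p - 1) * N / \<gamma>0)"
    unfolding delta_power exponent_identities(1,2) by (simp only: power_mult_distrib mult.assoc)
  also have "\<dots> = (real p * \<omega>) ^ (p + 1) / (2 ^ (p + 1) * N ^ (p + 1)) * (X ^ p * \<gamma>0 ^ p / (2 ^ ((p - 1) * p) * N ^ ((p + 1) * p)))"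
  proof -
    have "Xp * (g * gp * W) / ((b * (b1 * b2)) * (n * (n1 * n2))) * (b * n / g) = W / (b1 * n1) * (Xp * gp / (b2 * n2))"
      if "g \<noteq> 0" "b \<noteq> 0" "n \<noteq> 0" for Xp g gp W b b1 b2 n n1 n2 :: real
      using that by (simp add: mult_ac)
    from this[of \<gamma>0 "2 ^ (p - 1)" N "X ^ p" "\<gamma>0 ^ p" "(real p * \<omega>) ^ (p + 1)" "2 ^ (p + 1)"
        "2 ^ ((p - 1) * p)" "N ^ (p + 1)" "N ^ ((p + 1) * p)"]
    show ?thesis
      using gamma0 N power_Suc[of \<gamma>0 p] by (simp only: Suc_eq_plus1) simp
  qed
  also have "\<dots> = (u / 2) ^ (p + 1) * (\<epsilon> * A1) ^ p"
  proof -
    have "u / 2 = real p * \<omega> / (2 * N)"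
      by (simp add: u_def mult.commute)
    then show ?thesis
      unfolding eps_A1 by (simp only: power_mult_distrib power_divide power_mult)
  qed
  also have "\<dots> = (u / 2 * target ^ p) ^ (p + 1)"
  proof -
    have "(target ^ p) ^ (p + 1) = (target ^ (p + 1)) ^ p"
      by (simp only: power_mult[symmetric] mult.commute)
    also have "target ^ (p + 1) = \<epsilon> * A1"
      unfolding target_def using eps A1_pos by (intro root_power) simp
    finally show ?thesis
      by (simp only: power_mult_distrib)
  qed
  finally show "(\<delta> * dist_const) ^ (p + 1) = (u / 2 * target ^ p) ^ (p + 1)" .
  show "0 \<le> \<delta> * dist_const" "0 \<le> u / 2 * target ^ p"
    using delta_pos gamma0 omega_pos eps A1_pos
    by (auto simp: dist_const_def target_def u_def)
qed simp

text \<open>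
  By uniform convexity of the prox-function the error term is at most \<open>\<delta>\<close> times a constant times
  the \<open>(p+1)\<close>-st root of the new energy. Dividing by this root shows that
  the \<open>p / (p+1)\<close>-th power of the energy grows only linearly.
\<close>

lemma energy_growth: "root (p + 1) (energy k) ^ p \<le> root (p + 1) (energy 0) ^ p + real k * (u / 2 * target ^ p)"
proof (induction k)
  case (Suc k)
  define e0 where "e0 = root (p + 1) (energy k)"
  define e1 where "e1 = root (p + 1) (energy (Suc k))"
  have e: "e0 \<ge> 0" "e1 \<ge> 0" "e0 ^ (p + 1) = energy k" "e1 ^ (p + 1) = energy (Suc k)"
    unfolding e0_def e1_def using energy_ge(3) by (auto simp del: power_Suc intro!: root_power)
  have dc: "dist_const \<ge> 0" "dist_const ^ (p + 1) = 2 ^ (p - 1) * N / \<gamma>0"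
    unfolding dist_const_def using gamma0 by (auto intro!: root_power simp del: power_Suc)
  have "\<gamma>0 * bnorm B (v (Suc k) - xs) ^ (p + 1) \<le> \<gamma> (Suc k) * bnorm B (v (Suc k) - xs) ^ (p + 1)"
    using gamma_ge[of "Suc k"] by (intro mult_right_mono) auto
  also have "\<dots> \<le> 2 ^ (p - 1) * N * (\<gamma> (Suc k) * \<beta> (v (Suc k)) xs)"
    by (rule bregman_lower)
  also have "\<dots> \<le> 2 ^ (p - 1) * N * energy (Suc k)"
    using energy_ge(2) by (intro mult_left_mono) auto
  finally have "bnorm B (v (Suc k) - xs) ^ (p + 1) \<le> 2 ^ (p - 1) * N / \<gamma>0 * energy (Suc k)"
    using gamma0 by (simp add: pos_le_divide_eq mult.commute del: of_nat_add power_Suc)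
  then have "bnorm B (v (Suc k) - xs) ^ (p + 1) \<le> (dist_const * e1) ^ (p + 1)"
    unfolding power_mult_distrib dc(2) e(4) .
  then have "bnorm B (v (Suc k) - xs) \<le> dist_const * e1"
    using dc(1) e(2) by (subst (asm) power_mono_iff) auto
  then have "\<delta> * bnorm B (v (Suc k) - xs) \<le> \<delta> * (dist_const * e1)"
    using delta_pos by (intro mult_left_mono) auto
  then have E: "e1 ^ (p + 1) \<le> e0 ^ (p + 1) + \<delta> * dist_const * e1"
    using iterate_step(4)[OF iterates_in, of k] unfolding e(3,4) by simp
  have nonneg: "\<delta> * dist_const \<ge> 0"
    using delta_pos dc(1) by simp
  have "e1 ^ p \<le> e0 ^ p + \<delta> * dist_const"
  proof (cases "e1 \<le> e0")
    case True
    then show ?thesis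
      using power_mono[OF True e(2), of p] nonneg by linarith
  next
    case False
    then have "e1 > 0" "e0 ^ p * e0 \<le> e0 ^ p * e1"
      using e by (auto intro!: mult_left_mono)
    then have "e1 ^ p * e1 \<le> (e0 ^ p + \<delta> * dist_const) * e1"
      using E by (simp add: algebra_simps)
    then show ?thesis
      using \<open>e1 > 0\<close> by simp
  qed
  then show ?case
    using Suc unfolding e0_def e1_def delta_dist_const of_nat_Suc distrib_right mult_1 by linarith
qed simp

text \<open>
  The initial energy and the accumulated errors each contribute one half of the \<open>p / (p+1)\<close>-th
  power of the bound. For the errors,
  \<open>k u \<le> 1 + u (k - 1) \<le> exp (u (k - 1))\<close>.
\<close>

lemma energy_bound:
  assumes m: "ell \<le> m" "\<omega> * (real k - 1) \<le> m"
  shows "energy k \<le> \<epsilon> * A1 * exp m"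
proof -
  have N: "N > 0" "real p \<le> N"
    by auto
  define G where "G = exp (m / N)"
  have G: "G > 0" "G ^ (p + 1) = exp m"
    by (simp_all only: G_def exp_gt_zero exp_of_nat_mult[symmetric]) (simp del: of_nat_add)
  have T: "target \<ge> 0" "target ^ (p + 1) = \<epsilon> * A1"
    unfolding target_def using eps A1_pos by (auto intro!: root_power simp del: power_Suc)
  have u: "0 \<le> u" "u \<le> 1"
  proof -
    show "0 \<le> u"
      using omega_pos by (simp add: u_def)
    have "\<omega> * real p \<le> 1 * N"
      using omega_pos omega_le N by (intro mult_mono) auto
    then show "u \<le> 1"
      using N by (simp add: u_def pos_divide_le_eq)
  qed
  have "2 powr (1 / real p) * root (p + 1) (energy 0) \<le> target * G"
  proof (rule power_le_imp_le_base)
    have "(2 powr (1 / real p)) ^ (p + 1) = 2 powr (N * (1 / real p))"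
      by (intro powr_power) simp
    moreover have "N * (1 / real p) = (real p + 1) / real p"
      by simp
    moreover have "root (p + 1) (energy 0) ^ (p + 1) = energy 0"
      by (intro root_power energy_ge)
    ultimately have "(2 powr (1 / real p) * root (p + 1) (energy 0)) ^ (p + 1) = 2 powr ((real p + 1) / real p) * energy 0"
      by (simp only: power_mult_distrib)
    also have "\<dots> \<le> \<epsilon> * A1 * exp ell"
      by (rule energy_0)
    also have "\<dots> \<le> \<epsilon> * A1 * exp m"
      using eps A1_pos m(1) by (intro mult_left_mono) auto
    also have "\<dots> = (target * G) ^ (p + 1)"
      by (simp only: power_mult_distrib T(2) G(2))
    finally show "(2 powr (1 / real p) * root (p + 1) (energy 0)) ^ Suc p \<le> (target * G) ^ Suc p"
      by simp
  qed (use T G in simp)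
  then have "(2 powr (1 / real p) * root (p + 1) (energy 0)) ^ p \<le> (target * G) ^ p"
    using energy_ge(3)[of 0] by (intro power_mono) auto
  moreover have "(2 powr (1 / real p)) ^ p = 2"
    using p powr_power[where z = "2::real" and n = p and u = "1 / real p"] by simp
  ultimately have 0: "root (p + 1) (energy 0) ^ p \<le> (target * G) ^ p / 2"
    by (simp add: power_mult_distrib)
  have "real k * u \<le> 1 + u * (real k - 1)"
    using u by (simp add: algebra_simps)
  also have "\<dots> \<le> exp (u * (real k - 1))"
    by (rule exp_ge_add_one_self)
  also have "u * (real k - 1) = real p * (\<omega> * (real k - 1) / N)"
    by (simp add: u_def)
  also have "exp \<dots> = exp (\<omega> * (real k - 1) / N) ^ p"
    by (rule exp_of_nat_mult)
  also have "\<dots> \<le> G ^ p"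
    unfolding G_def using m(2) N by (intro power_mono) (auto intro: divide_right_mono)
  finally have "real k * u * (target ^ p / 2) \<le> G ^ p * (target ^ p / 2)"
    using T(1) by (intro mult_right_mono) auto
  then have "root (p + 1) (energy k) ^ p \<le> (target * G) ^ p"
    using energy_growth[of k] 0 by (simp add: power_mult_distrib algebra_simps)
  then have "root (p + 1) (energy k) \<le> target * G"
    using energy_ge(3)[of k] T(1) G(1) p by (subst (asm) power_mono_iff) auto
  then have "root (p + 1) (energy k) ^ (p + 1) \<le> (target * G) ^ (p + 1)"
    using energy_ge(3)[of k] by (intro power_mono) auto
  then show ?thesis
    unfolding root_power[OF energy_ge(3)] power_mult_distrib T(2) G(2) .
qed

lemma objective_bound:
  assumes "ell \<le> \<omega> * real k"
  shows "F (x (Suc k)) - F xs \<le> \<epsilon>"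
proof -
  have "(1 - \<omega>) ^ k \<le> exp (- \<omega>) ^ k"
    using omega_le exp_ge_add_one_self[of "- \<omega>"] by (intro power_mono) auto
  then have "A1 * exp (\<omega> * real k) * (1 - \<omega>) ^ k \<le> A1 * exp (\<omega> * real k) * exp (- \<omega>) ^ k"
    using A1_pos by (intro mult_left_mono) auto
  also have "\<dots> = A1"
    by (simp add: exp_of_nat_mult[symmetric] mult_exp_exp mult.commute flip: exp_add)
  finally have A: "A1 * exp (\<omega> * real k) \<le> A (Suc k)"
    using omega_le unfolding A_eq by (subst pos_le_divide_eq) auto
  have "A (Suc k) * (F (x (Suc k)) - F xs) \<le> energy (Suc k)"
    by (rule energy_ge)
  also have "\<dots> \<le> \<epsilon> * A1 * exp (\<omega> * real k)"
    using assms by (intro energy_bound) auto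
  also have "\<dots> \<le> \<epsilon> * A (Suc k)"
    using A eps by (simp add: mult.assoc)
  finally show ?thesis
    using A_pos[of k] by (simp add: mult.commute)
qed

lemma sigma_A1_ge: "\<gamma>0 * (\<omega> ^ (p + 1) / N ^ p) \<le> \<sigma> * A1"
proof -
  have "\<omega> ^ (p + 1) * (L * N * 2 ^ (p - 1)) * \<gamma>0 \<le> \<sigma> * fact p * \<gamma>0"
    using omega_power_le gamma0 by (intro mult_right_mono) auto
  then have "\<omega> ^ (p + 1) * (L * N * 2 ^ (p - 1)) * \<gamma>0 / (2 ^ (p - 1) * N ^ (p + 1) * L)
      \<le> \<sigma> * fact p * \<gamma>0 / (2 ^ (p - 1) * N ^ (p + 1) * L)"
    using L_pos by (intro divide_right_mono) auto
  moreover have "\<omega> ^ (p + 1) * (L * N * 2 ^ (p - 1)) * \<gamma>0 / (2 ^ (p - 1) * N ^ (p + 1) * L) = \<gamma>0 * (\<omega> ^ (p + 1) / N ^ p)"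
    using L_pos by (simp del: of_nat_add)
  ultimately show ?thesis
    by (simp add: A1_def mult_ac)
qed

abbreviation "Xk k \<equiv> if k = 0 then 1 else \<omega> ^ (p + 1) / (1 - \<omega>) ^ k"

definition "\<zeta> k = (if k = 0 then ell else real k * - ln (1 - \<omega>))"

text \<open>
  The Lipschitz constant of the subproblem enters the number of steps with the power \<open>p + 1\<close>, and
  the growth of \<open>\<gamma>\<close> offsets \<open>p\<close> of these factors; the remaining one is \<open>exp (\<zeta> k)\<close>. In the initial
  iteration the Lipschitz constant lacks the factor \<open>\<omega>\<^bsup>p+1\<^esup>\<close>, whose inverse is at most
  \<open>exp ell\<close>.
\<close>

lemma conditioning_growth: "(\<gamma>0 / \<gamma> k) ^ p * Xk k ^ (p + 1) / (N ^ p) ^ p \<le> 2 ^ p * \<omega> ^ (p + 1) * exp (\<zeta> k)"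
proof (cases k)
  case 0
  have N1: "1 \<le> N ^ p"
    by (intro one_le_power) simp
  have "(\<gamma>0 / \<gamma> k) ^ p * Xk k ^ (p + 1) / (N ^ p) ^ p = 1 / (N ^ p) ^ p"
    using 0 gamma0 by (simp add: init del: of_nat_add)
  also have "\<dots> \<le> 1"
    using one_le_power[OF N1, of p] by (simp del: of_nat_add)
  also have "1 \<le> 2 ^ p * (\<omega> ^ (p + 1) * exp ell)"
  proof -
    have "1 \<le> \<omega> ^ (p + 1) * exp ell"
      using N1 omega_exp_ell by linarith
    then show ?thesis
      using mult_mono[of 1 "2 ^ p" 1 "\<omega> ^ (p + 1) * exp ell"] by simp
  qed
  finally show ?thesis
    using 0 by (simp add: \<zeta>_def mult.assoc)
next
  case (Suc m)
  let ?G = "1 / (1 - \<omega>) ^ m"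
  have w: "1 - \<omega> > 0" "?G > 0"
    using omega_le by auto
  have Xk: "Xk k = \<omega> ^ (p + 1) * (?G / (1 - \<omega>))"
    by (simp add: Suc)
  have "?G / (1 - \<omega>) \<le> 2 * ?G"
    using mult_left_mono[of 1 "2 * (1 - \<omega>)" ?G] omega_le w by (subst pos_divide_le_eq) (auto simp: mult_ac)
  then have "\<gamma>0 * (\<omega> ^ (p + 1) / N ^ p) * (?G / (1 - \<omega>)) \<le> \<gamma>0 * (\<omega> ^ (p + 1) / N ^ p) * (2 * ?G)"
    using gamma0 omega_pos by (intro mult_left_mono) auto
  also have "\<dots> \<le> \<sigma> * A1 * (2 * ?G)"
    using sigma_A1_ge w by (intro mult_right_mono) auto
  also have "\<dots> = 2 * (\<sigma> * A k)"
    by (simp add: Suc A_eq)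
  also have "\<dots> \<le> 2 * \<gamma> k"
    using gamma0 by (simp add: gamma_eq)
  finally have "\<gamma>0 * (\<omega> ^ (p + 1) / N ^ p) * (?G / (1 - \<omega>)) / \<gamma> k \<le> 2"
    by (subst pos_divide_le_eq[OF gamma_pos])
  moreover have "\<gamma>0 / \<gamma> k * (Xk k / N ^ p) = \<gamma>0 * (\<omega> ^ (p + 1) / N ^ p) * (?G / (1 - \<omega>)) / \<gamma> k"
    unfolding Xk by (simp del: of_nat_add power_Suc)
  ultimately have "\<gamma>0 / \<gamma> k * (Xk k / N ^ p) \<le> 2"
    by simp
  then have "(\<gamma>0 / \<gamma> k * (Xk k / N ^ p)) ^ p \<le> 2 ^ p"
    unfolding Xk using gamma0 gamma_pos[of k] omega_pos w by (intro power_mono) auto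
  then have "(\<gamma>0 / \<gamma> k * (Xk k / N ^ p)) ^ p * Xk k \<le> 2 ^ p * Xk k"
    unfolding Xk using omega_pos w by (intro mult_right_mono) auto
  moreover have "(\<gamma>0 / \<gamma> k * (Xk k / N ^ p)) ^ p * Xk k = (\<gamma>0 / \<gamma> k) ^ p * Xk k ^ (p + 1) / (N ^ p) ^ p"
    by (simp only: power_mult_distrib power_divide power_add power_one_right) (simp only: times_divide_eq_right times_divide_eq_left mult.assoc)
  moreover have "exp (\<zeta> k) = 1 / (1 - \<omega>) ^ k"
    using w Suc exp_of_nat_mult[of k "- ln (1 - \<omega>)"] by (simp add: \<zeta>_def exp_minus power_inverse field_simps)
  ultimately show ?thesis
    using Suc by simp
qed

definition "degree_const = N powr ((real p + 2) / real p) / real p powr ((real p + 1) / real p)"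

lemma degree_const_power: "degree_const ^ p = N ^ (p + 2) / real p ^ (p + 1)"
proof -
  have "(N powr ((real p + 2) / real p)) ^ p = N powr (real p * ((real p + 2) / real p))"
    by (intro powr_power) simp
  also have "real p * ((real p + 2) / real p) = real (p + 2)"
    using p by simp
  finally have 1: "(N powr ((real p + 2) / real p)) ^ p = N ^ (p + 2)"
    by (simp only: powr_realpow of_nat_0_less_iff)
  have "(real p powr ((real p + 1) / real p)) ^ p = real p powr (real p * ((real p + 1) / real p))"
    using p by (intro powr_power) simp
  also have "real p * ((real p + 1) / real p) = real (p + 1)"
    using p by simp
  finally have 2: "(real p powr ((real p + 1) / real p)) ^ p = real p ^ (p + 1)"
    using p by (simp only: powr_realpow of_nat_0_less_iff)
  show ?thesis
    unfolding degree_const_def power_divide 1 2 ..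
qed

lemma degree_const_bounds: "1 \<le> degree_const" "degree_const \<le> 8"
proof -
  have P: "real p > 0" "real p \<le> N" "N > 0" "N \<le> 2 ^ p"
  proof -
    show "N \<le> 2 ^ p"
      using less_exp[of p] by (metis Suc_eq_plus1 Suc_leI of_nat_le_iff of_nat_numeral of_nat_power)
  qed (use p in auto)
  have pos: "degree_const > 0"
    unfolding degree_const_def using p by simp
  have "real p ^ (p + 1) \<le> N ^ (p + 1) * N"
    by (rule order_trans[OF power_mono[of "real p" N "p + 1"]])
      (use P mult_left_mono[of 1 N "N ^ (p + 1)"] in auto)
  then have "1 ^ p \<le> degree_const ^ p"
    unfolding degree_const_power using P by (subst pos_le_divide_eq) (auto simp: power_add mult_ac)
  then show "1 \<le> degree_const"
    using p pos by (subst (asm) power_mono_iff) auto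
  have "N ^ (p + 1) \<le> (2 * real p) ^ (p + 1)"
    using p by (intro power_mono) auto
  then have "N ^ (p + 1) * N \<le> (2 * real p) ^ (p + 1) * 2 ^ p"
    using P by (intro mult_mono) auto
  also have "\<dots> = real p ^ (p + 1) * (2 ^ (p + 1) * 2 ^ p)"
    by (simp only: power_mult_distrib mult_ac)
  also have "\<dots> \<le> real p ^ (p + 1) * 8 ^ p"
  proof -
    have "(2::real) ^ (p + 1) * 2 ^ p \<le> 2 ^ (3 * p)"
      using p by (simp only: power_add[symmetric]) (intro power_increasing; simp)
    also have "(2::real) ^ (3 * p) = 8 ^ p"
      by (simp add: power_mult)
    finally show ?thesis
      by (intro mult_left_mono) auto
  qed
  finally have "degree_const ^ p \<le> 8 ^ p"
    unfolding degree_const_power using P by (subst pos_divide_le_eq) (auto simp: power_add mult_ac)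
  then show "degree_const \<le> 8"
    using p pos by (subst (asm) power_mono_iff) auto
qed

text \<open>The bound on the ratio of initial to final residual to which \<open>inner_loop\<close> is applied.\<close>

definition "Y k = degree_const * 2 powr ((2 * real p + 1) / real p) * exp (ell + \<zeta> k / real p)"

lemma zeta_nonneg: "\<zeta> k \<ge> 0"
proof -
  have "ln (1 - \<omega>) \<le> 0"
    using omega_pos omega_le by simp
  then show ?thesis
    using ell_pos by (auto simp: \<zeta>_def mult_nonneg_nonpos)
qed

lemma Y_ge: "Y k \<ge> 1"
proof -
  have "1 * 1 * 1 \<le> Y k"
    unfolding Y_def using degree_const_bounds(1) ell_pos zeta_nonneg[of k]
    by (intro mult_mono) (auto intro!: ge_one_powr_ge_zero add_nonneg_nonneg)
  then show ?thesis
    by simp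
qed

lemma Y_power: "Y k ^ p = N ^ (p + 2) / real p ^ (p + 1) * 2 ^ (2 * p + 1) * (exp ell ^ p * exp (\<zeta> k))"
proof -
  have "(2 powr ((2 * real p + 1) / real p)) ^ p = 2 powr (real p * ((2 * real p + 1) / real p))"
    by (intro powr_power) simp
  also have "real p * ((2 * real p + 1) / real p) = real (2 * p + 1)"
    using p by simp
  finally have 1: "(2 powr ((2 * real p + 1) / real p)) ^ p = 2 ^ (2 * p + 1)"
    by (simp only: powr_realpow zero_less_numeral)
  have "exp (ell + \<zeta> k / real p) ^ p = exp ell ^ p * exp (real p * (\<zeta> k / real p))"
    by (simp only: exp_add power_mult_distrib exp_of_nat_mult)
  also have "real p * (\<zeta> k / real p) = \<zeta> k"
    using p by simp
  finally show ?thesis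
    unfolding Y_def power_mult_distrib degree_const_power 1 by simp
qed

text \<open>
  The hypothesis of \<open>inner_loop\<close> is an inequality between products of powers; all of them cancel
  except those of \<open>conditioning_growth\<close>.
\<close>

lemma inner_steps_le:
  assumes k: "\<omega> * (real k - 1) \<le> ell"
  shows "real (t k) \<le> 3 + ln (Y k) / inner_rate p"
proof -
  define R where "R = X * (\<gamma>0 / \<gamma> k) * exp ell / N ^ p"
  have "2 ^ (p - 1) * N * energy k \<le> 2 ^ (p - 1) * N * (\<epsilon> * A1 * exp ell)"
    using energy_bound[OF order_refl k] by (intro mult_left_mono) auto
  also have "\<dots> = \<gamma> k * R"
    unfolding R_def eps_A1 using gamma_pos[of k] by (simp del: of_nat_add)
  finally have R: "2 ^ (p - 1) * N * energy k \<le> \<gamma> k * R" .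
  have "R ^ p * (\<gamma>0 * Xk k / (2 ^ (p - 1) * N ^ p)) ^ (p + 1) \<le> Y k ^ p * \<delta> ^ (p + 1)"
  proof -
    define S where "S = X ^ p * exp ell ^ p * \<gamma>0 ^ (p + 1) / (2 ^ ((p - 1) * (p + 1)) * N ^ (p * (p + 1)))"
    have "R ^ p * (\<gamma>0 * Xk k / (2 ^ (p - 1) * N ^ p)) ^ (p + 1)
        = S * ((\<gamma>0 / \<gamma> k) ^ p * Xk k ^ (p + 1) / (N ^ p) ^ p)"
      unfolding R_def S_def power_mult_distrib power_divide power_mult
      by (simp del: of_nat_add power_Suc add: mult_ac)
    also have "\<dots> \<le> S * (2 ^ p * \<omega> ^ (p + 1) * exp (\<zeta> k))"
      using conditioning_growth[of k] eps L_pos gamma0 by (intro mult_left_mono) (auto simp: S_def)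
    also have "\<dots> = Y k ^ p * \<delta> ^ (p + 1)"
    proof -
      have two: "2 ^ p / 2 ^ ((p - 1) * (p + 1)) = (2 ^ (2 * p + 1) / 2 ^ (p * (p + 1)) :: real)"
        using exponent_identities(3)[of 2] by (simp add: field_simps)
      have n: "1 / N ^ (p * (p + 1)) = N ^ (p + 2) / N ^ ((p + 1)\<^sup>2 + 1)"
        unfolding exponent_identities(4)[of N] by (simp del: of_nat_add)
      have "S * (2 ^ p * \<omega> ^ (p + 1) * exp (\<zeta> k))
          = X ^ p * exp ell ^ p * \<gamma>0 ^ (p + 1) * \<omega> ^ (p + 1) * exp (\<zeta> k)
            * (2 ^ p / 2 ^ ((p - 1) * (p + 1))) * (1 / N ^ (p * (p + 1)))"
        unfolding S_def by (simp del: of_nat_add power_Suc)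
      also have "\<dots> = Y k ^ p * \<delta> ^ (p + 1)"
      proof -
        have "Xp * e * g * w * z * (b2 / b1) * (n2 / n1) = n2 / P * b2 * (e * z) * (Xp * (g * P * w) / (b1 * n1))"
          if "P \<noteq> 0" for Xp e g w z b1 b2 n1 n2 P :: real
          using that by simp
        then show ?thesis
          unfolding two n Y_power delta_power power_mult_distrib using p by simp
      qed
      finally show ?thesis .
    qed
    finally show ?thesis .
  qed
  then have RY: "R ^ p * (N * gk_lip k / fact p) ^ (p + 1) \<le> Y k ^ p * \<delta> ^ (p + 1)"
    unfolding Lambda_k .
  obtain j where j: "stops k j" "real j \<le> 3 + ln (Y k) / inner_rate p"
    using inner_loop[OF iterates_in Y_ge R RY] by metis
  have "t k \<le> j"
    unfolding t_eq by (rule Least_le) (rule j(1))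
  then show ?thesis
    using j(2) by linarith
qed

lemma ln_Y: "ln (Y k) = ln degree_const + (2 + 1 / real p) * ln 2 + ell + \<zeta> k / real p"
  unfolding Y_def using degree_const_bounds(1) p
  by (simp add: ln_mult ln_powr add_divide_distrib)

text \<open>
  Averaging over the iterations halves the contribution of \<open>\<zeta> k\<close>, which grows linearly in \<open>k\<close>:
  a bound for the last iteration alone would have \<open>2 ln 2\<close> in place of \<open>ln 2\<close>.
\<close>

lemma sum_zeta_le:
  assumes K: "1 + ell / \<omega> \<le> real K" "real K \<le> 2 + ell / \<omega>"
  shows "(\<Sum>k<K. \<zeta> k) \<le> real K * (ln 2 * (ell + 1/2) + 1/2)"
proof -
  define lam where "lam = - ln (1 - \<omega>)"
  have lam: "0 \<le> lam" "lam \<le> 2 * ln 2 * \<omega>"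
    using minus_ln_one_minus_le[of \<omega>] omega_pos omega_le by (auto simp: lam_def)
  obtain m where m: "K = Suc m"
    using K(1) ell_pos omega_pos by (cases K) (auto simp: field_simps)
  have "(\<Sum>k<K. \<zeta> k) = ell + (\<Sum>k<m. real (Suc k)) * lam"
    unfolding m sum.lessThan_Suc_shift by (simp add: \<zeta>_def lam_def sum_distrib_right sum_negf)
  also have "(\<Sum>k<m. real (Suc k)) = real K * real m / 2"
    unfolding m by (induction m) (auto simp: field_simps)
  also have "ell + real K * real m / 2 * lam \<le> real K * (1/2) + real K * (ln 2 * (ell + 1/2))"
  proof (rule add_mono)
    have "2 * ell \<le> ell / \<omega>"
      using mult_left_mono[of "2 * \<omega>" 1 ell] omega_le ell_pos omega_pos by (subst pos_le_divide_eq) (auto simp: mult_ac)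
    then show "ell \<le> real K * (1/2)"
      using K(1) by linarith
    have "\<omega> * real m \<le> \<omega> * (1 + ell / \<omega>)"
      using K(2) omega_pos m by (intro mult_left_mono) auto
    also have "\<dots> = \<omega> + ell"
      using omega_pos by (simp add: field_simps)
    finally have "\<omega> * real m \<le> ell + 1/2"
      using omega_le by linarith
    then have "ln 2 * (\<omega> * real m) \<le> ln 2 * (ell + 1/2)"
      by (intro mult_left_mono) auto
    moreover have "real m * lam \<le> real m * (2 * ln 2 * \<omega>)"
      using lam by (intro mult_left_mono) auto
    moreover have "real m * (2 * ln 2 * \<omega>) = 2 * (ln 2 * (\<omega> * real m))"
      by simp
    ultimately have "real m * lam / 2 \<le> ln 2 * (ell + 1/2)"
      by linarith
    then have "real K * (real m * lam / 2) \<le> real K * (ln 2 * (ell + 1/2))"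
      by (intro mult_left_mono) auto
    then show "real K * real m / 2 * lam \<le> real K * (ln 2 * (ell + 1/2))"
      by (simp add: mult_ac)
  qed
  finally show ?thesis
    by (simp add: algebra_simps)
qed

text \<open>
  By the definition of the inner rate the coefficients of \<open>ell\<close> agree; the remaining constants are
  compared using \<open>1 / inner_rate p \<le> 8 / 5\<close>.
\<close>

lemma constants_le:
  "(ln degree_const + (2 + 1 / real p) * ln 2 + ell + (ln 2 * (ell + 1/2) + 1/2) / real p) / inner_rate p
   \<le> (1 + exp 1 / ((exp 1 - 1) * real p)) * (1 + ell) + ln degree_const
     + (2 * real p ^ 2 + real p + 4) / real p * ln 2"
proof -
  define y where "y = 1 / real p"
  define q :: real where "q = exp 1 / (exp 1 - 1)"
  define \<Theta> where "\<Theta> = 1 + q * y"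
  define r where "r = 1 / inner_rate p"
  have y: "0 < y" "y \<le> 1" "real p * y = 1"
    using p by (auto simp: y_def)
  have q: "3/2 \<le> q" "q \<le> 5/3"
  proof -
    show "3/2 \<le> q"
      using e_bounds by (simp add: q_def field_simps)
    have "exp 1 \<ge> (5/2 :: real)"
      using exp_lower_Taylor_quadratic[of "1::real"] by simp
    then show "q \<le> 5/3"
      by (simp add: q_def field_simps)
  qed
  have r: "r * (1 + ln 2 * y) = \<Theta>"
  proof -
    have "1 / ((P + l) / (P + q)) * (1 + l * (1 / P)) = 1 + q * (1 / P)" if "P > 0" "l > 0" "q > 0" for P l q :: real
    proof -
      have "1 / ((P + l) / (P + q)) * (1 + l * (1 / P)) = (P + q) / (P + l) * ((P + l) / P)"
      proof -
        have "1 + l * (1 / P) = (P + l) / P"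
          using that by (simp add: add_divide_distrib)
        then show ?thesis
          by simp
      qed
      also have "\<dots> = (P + q) / P"
        using that by simp
      finally show ?thesis
        using that by (simp add: add_divide_distrib)
    qed
    then show ?thesis
      unfolding r_def \<Theta>_def y_def inner_rate_def q_def[symmetric] using p q by simp
  qed
  have ln2: "2/3 \<le> ln (2::real)" "ln 2 \<le> (25/36::real)"
    using ln2_ge_two_thirds ln2_le_25_over_36 by auto
  have r0: "r > 0"
    using inner_rate_pos[OF p] by (simp add: r_def)
  have r_le: "r \<le> 8/5"
  proof -
    have "q * y \<le> 5/3 * y" "2/3 * y \<le> ln 2 * y"
      using ln2 y q by (auto intro!: mult_right_mono)
    moreover have "8/5 * (1 + ln 2 * y) = 8/5 + 8/5 * (ln 2 * y)"
      by (simp add: distrib_left)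
    ultimately have "r * (1 + ln 2 * y) \<le> 8/5 * (1 + ln 2 * y)"
      unfolding r \<Theta>_def using y(2) by linarith
    then show ?thesis
      by (rule mult_right_le_imp_le) (use y in \<open>auto intro!: add_pos_pos mult_pos_pos\<close>)
  qed
  have G: "0 \<le> ln degree_const" "ln degree_const \<le> 3 * ln 2"
  proof -
    show "0 \<le> ln degree_const"
      using degree_const_bounds by simp
    have "ln degree_const \<le> ln (2 ^ 3)"
      using degree_const_bounds by (subst ln_le_cancel_iff) auto
    then show "ln degree_const \<le> 3 * ln 2"
      by (simp only: ln_realpow of_nat_numeral zero_less_numeral)
  qed
  have quad: "(2 * real p ^ 2 + real p + 4) / real p = 2 * real p + 1 + 4 * y"
    using p by (simp add: y_def field_simps power2_eq_square)
  define W where "W = ln degree_const + (2 + y) * ln 2 + (ln 2 / 2 + 1/2) * y"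
  have "W \<ge> 0"
    unfolding W_def using G ln2 y by (intro add_nonneg_nonneg mult_nonneg_nonneg) auto
  then have "r * W \<le> 8/5 * W"
    using r_le by (intro mult_right_mono) auto
  also have "\<dots> = ln degree_const + 3/5 * ln degree_const + 16/5 * ln 2 + 12/5 * (ln 2 * y) + 4/5 * y"
    by (simp add: W_def algebra_simps)
  also have "\<dots> \<le> \<Theta> + ln degree_const + (2 * real p + 1 + 4 * y) * ln 2"
  proof -
    have "- 1 \<le> ln 2 * (2 * real p - 4 + 8/5 * y)"
    proof (cases "p = 1")
      case True
      then show ?thesis
        using y ln2 by simp
    next
      case False
      then have "0 \<le> 2 * real p - 4 + 8/5 * y"
        using p y by simp
      then have "0 \<le> ln 2 * (2 * real p - 4 + 8/5 * y)"
        using ln2 by (intro mult_nonneg_nonneg) auto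
      then show ?thesis
        by linarith
    qed
    moreover have "ln 2 * (2 * real p - 4 + 8/5 * y)
        = (2 * real p + 1 + 4 * y) * ln 2 - 9/5 * ln 2 - 16/5 * ln 2 - 12/5 * (ln 2 * y)"
      by (simp add: algebra_simps)
    moreover have "3/2 * y \<le> q * y"
      using q y by (intro mult_right_mono) auto
    ultimately show ?thesis
      using G y unfolding \<Theta>_def by linarith
  qed
  finally have upper: "r * W + \<Theta> * ell \<le> \<Theta> + ln degree_const + (2 * real p + 1 + 4 * y) * ln 2 + \<Theta> * ell"
    by simp
  have eq: "r * W + \<Theta> * ell = r * (ln degree_const + (2 + y) * ln 2 + ell + (ln 2 * (ell + 1/2) + 1/2) * y)"
    unfolding W_def r[symmetric] by (simp add: algebra_simps)
  show ?thesis
  proof -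
    have \<Theta>: "(1 + exp 1 / ((exp 1 - 1) * real p)) = \<Theta>"
      by (simp add: \<Theta>_def q_def y_def)
    have "(ln degree_const + (2 + 1 / real p) * ln 2 + ell + (ln 2 * (ell + 1/2) + 1/2) / real p) / inner_rate p
        = r * (ln degree_const + (2 + y) * ln 2 + ell + (ln 2 * (ell + 1/2) + 1/2) * y)"
      by (simp add: r_def y_def)
    also have "\<dots> \<le> \<Theta> + ln degree_const + (2 * real p + 1 + 4 * y) * ln 2 + \<Theta> * ell"
      using upper unfolding eq .
    also have "\<dots> = \<Theta> * (1 + ell) + ln degree_const + (2 * real p + 1 + 4 * y) * ln 2"
      by (simp add: distrib_left)
    finally show ?thesis
      unfolding quad \<Theta> .
  qed
qed

lemma total_steps_le:
  assumes K: "1 + ell / \<omega> \<le> real K" "real K \<le> 2 + ell / \<omega>"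
  shows "real (\<Sum>k<K. t k) \<le> real K * (3 + (1 + exp 1 / ((exp 1 - 1) * real p)) * (1 + ell)
    + (ln degree_const + (2 * real p ^ 2 + real p + 4) / real p * ln 2))"
proof -
  let ?c = "ln degree_const + (2 + 1 / real p) * ln 2 + ell"
  have k: "\<omega> * (real k - 1) \<le> ell" if "k < K" for k
  proof -
    have "\<omega> * (real k - 1) \<le> \<omega> * (ell / \<omega>)"
      using that K(2) omega_pos by (intro mult_left_mono) auto
    then show ?thesis
      using omega_pos by simp
  qed
  have "real (\<Sum>k<K. t k) \<le> (\<Sum>k<K. 3 + (?c + \<zeta> k / real p) / inner_rate p)"
    unfolding of_nat_sum using inner_steps_le[OF k] unfolding ln_Y by (intro sum_mono) auto
  also have "\<dots> = real K * 3 + (real K * ?c + (\<Sum>k<K. \<zeta> k) / real p) / inner_rate p"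
    by (simp add: sum.distrib sum_divide_distrib[symmetric])
  also have "\<dots> \<le> real K * 3 + (real K * ?c + real K * (ln 2 * (ell + 1/2) + 1/2) / real p) / inner_rate p"
    using sum_zeta_le[OF K] inner_rate_pos[OF p]
    by (intro add_left_mono divide_right_mono) auto
  also have "\<dots> = real K * 3 + real K * ((?c + (ln 2 * (ell + 1/2) + 1/2) / real p) / inner_rate p)"
    by (simp add: distrib_left)
  also have "\<dots> \<le> real K * 3 + real K * ((1 + exp 1 / ((exp 1 - 1) * real p)) * (1 + ell) + ln degree_const
     + (2 * real p ^ 2 + real p + 4) / real p * ln 2)"
    using constants_le by (intro add_left_mono mult_left_mono) auto
  finally show ?thesis
    by (simp add: algebra_simps)
qed

end

theorem theorem4p7:
  fixes B :: "'a::euclidean_space \<Rightarrow> 'a \<Rightarrow> real"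
    and f :: "'a \<Rightarrow> real" and domf :: "'a set" and \<psi> :: "'a \<Rightarrow> ereal"
    and p K :: nat and L \<sigma> \<gamma>0 \<epsilon> \<omega> \<delta> \<L> :: real
    and x0 xs :: 'a
    and x v :: "nat \<Rightarrow> 'a" and a A \<gamma> :: "nat \<Rightarrow> real"
    and z :: "nat \<Rightarrow> nat \<Rightarrow> 'a" and t :: "nat \<Rightarrow> nat"
  assumes B: "spd_operator B"
    and p: "p \<ge> 1"
    and f_dom: "open domf"
    and f_convex: "convex_on domf f"
    and f_diff: "times_differentiable_on p f domf"
    and L_pos: "L > 0"
    and f_Lipschitz: "\<And>y w. y \<in> domf \<Longrightarrow> w \<in> domf \<Longrightarrow>
      form_norm B p (\<lambda>hs. nderiv f hs y - nderiv f hs w) \<le> L * bnorm B (y - w)"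
    and psi: "proper_closed_convex \<psi>"
    and dom: "edom \<psi> \<subseteq> domf"
    and solution: "is_arg_min (composite f \<psi>) (\<lambda>_. True) xs"
    and x0: "x0 \<in> edom (composite f \<psi>)"
    and sigma_pos: "\<sigma> > 0"
    and sigma: "relatively_strongly_convex (prox_fun B p x0) \<sigma> \<psi>"
    and gamma0: "\<gamma>0 > 0"
    and eps: "\<epsilon> > 0"
    and omega: "\<omega> = min ((\<sigma> * fact p / (L * real (p + 1) * 2 ^ (p - 1))) powr (1 / real (p + 1)))
                        (1 / 2)"
    and delta: "\<delta> = (fact p * \<epsilon> / L) powr (real p / real (p + 1))
                  * (\<gamma>0 * real p * \<omega>
                     / (2 ^ p * real (p + 1) powr ((real (p + 1) ^ 2 + 1) / real (p + 1))))"
    and ell: "\<L> = ln (max (real (p + 1) ^ p / \<omega> ^ (p + 1))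
                         (L * bregman (prox_fun B p x0) x0 xs * real (p + 1) ^ (p + 1)
                            * 2 powr (real p + 1 / real p) / (fact p * \<epsilon>)))"
    and K: "K = nat \<lfloor>2 + 1 / \<omega> * \<L>\<rfloor>"
    and run: "contracting_prox_tensor_method B p f \<psi> L \<sigma> x0 \<delta> \<gamma>0 \<omega> x v a A \<gamma> z t"
  shows "composite f \<psi> (x K) - composite f \<psi> xs \<le> ereal \<epsilon> \<and>
    (\<forall>k<K. \<exists>j. inner_stop B p (sub_reg p L (a (Suc k)) (A k))
                  (sub_smooth f (a (Suc k)) (A k) (x k)) \<delta> (z k) j) \<and>
    real (\<Sum>k<K. t k) \<le>
      real K * (3 + (1 + exp 1 / ((exp 1 - 1) * real p)) * (1 + \<L>)
        + ln (max 1 ((4 * \<sigma> * fact p / (real (p + 1) * L)) powr (1 / real p))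
              * (1 + 1 / \<gamma>0)
              * (real (p + 1) powr ((real p + 2) / real p) / real p powr ((real p + 1) / real p))
              * 2 powr ((2 * real p ^ 2 + real p + 4) / real p)))"
proof -
  interpret m: contracting_method B \<psi> f domf p L \<sigma> \<gamma>0 \<epsilon> \<omega> \<delta> x0 xs x v a A \<gamma> z t
    using assms by unfold_locales
  have \<L>: "\<L> = m.ell"
    unfolding ell m.ell_def ..
  have "0 \<le> m.ell / \<omega>"
    using m.ell_pos m.omega_pos by simp
  moreover have "K = nat \<lfloor>2 + m.ell / \<omega>\<rfloor>"
    unfolding K \<L> by simp
  ultimately have K_bounds: "1 + m.ell / \<omega> \<le> real K" "real K \<le> 2 + m.ell / \<omega>" "K \<noteq> 0"
    by linarith+
  have "composite f \<psi> (x K) - composite f \<psi> xs \<le> ereal \<epsilon>"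
  proof -
    obtain k where k: "K = Suc k"
      using K_bounds(3) by (cases K) auto
    have "m.ell / \<omega> \<le> real k"
      using K_bounds(1) by (simp add: k)
    then have "m.ell \<le> \<omega> * real k"
      using m.omega_pos by (simp add: pos_divide_le_eq mult.commute)
    then have "m.F (x K) - m.F xs \<le> \<epsilon>"
      unfolding k by (rule m.objective_bound)
    then show ?thesis
      by (simp add: m.composite_eq m.iterates_in m.xs_in)
  qed
  moreover have "\<forall>k<K. \<exists>j. inner_stop B p (sub_reg p L (a (Suc k)) (A k))
      (sub_smooth f (a (Suc k)) (A k) (x k)) \<delta> (z k) j"
    using m.iterate_step(1)[OF m.iterates_in] by blast
  moreover have "real (\<Sum>k<K. t k) \<le> real K * (3 + (1 + exp 1 / ((exp 1 - 1) * real p)) * (1 + \<L>)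
      + ln (max 1 ((4 * \<sigma> * fact p / (real (p + 1) * L)) powr (1 / real p))
            * (1 + 1 / \<gamma>0)
            * (real (p + 1) powr ((real p + 2) / real p) / real p powr ((real p + 1) / real p))
            * 2 powr ((2 * real p ^ 2 + real p + 4) / real p)))"
  proof -
    let ?m = "max 1 ((4 * \<sigma> * fact p / (real (p + 1) * L)) powr (1 / real p)) * (1 + 1 / \<gamma>0)"
    have "1 * 1 \<le> ?m"
      using gamma0 by (intro mult_mono) auto
    then have "1 \<le> ?m"
      by simp
    have C: "m.degree_const \<ge> 1"
      by (rule m.degree_const_bounds)
    have "ln m.degree_const + (2 * real p ^ 2 + real p + 4) / real p * ln 2
        = ln (m.degree_const * 2 powr ((2 * real p ^ 2 + real p + 4) / real p))"
      using C by (simp add: ln_mult ln_powr)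
    also have "\<dots> \<le> ln (?m * (m.degree_const * 2 powr ((2 * real p ^ 2 + real p + 4) / real p)))"
    proof -
      have "0 < m.degree_const * 2 powr ((2 * real p ^ 2 + real p + 4) / real p)"
        using C by simp
      moreover have "1 * w \<le> ?m * w" if "0 < w" for w :: real
        using \<open>1 \<le> ?m\<close> that by (intro mult_right_mono) auto
      ultimately show ?thesis
        by (intro ln_mono) (simp_all only: mult_1)
    qed
    also have "\<dots> = ln (?m * m.degree_const * 2 powr ((2 * real p ^ 2 + real p + 4) / real p))"
      by (simp only: mult.assoc)
    finally have "real K * (3 + (1 + exp 1 / ((exp 1 - 1) * real p)) * (1 + \<L>)
        + (ln m.degree_const + (2 * real p ^ 2 + real p + 4) / real p * ln 2))
        \<le> real K * (3 + (1 + exp 1 / ((exp 1 - 1) * real p)) * (1 + \<L>)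
        + ln (?m * m.degree_const * 2 powr ((2 * real p ^ 2 + real p + 4) / real p)))"
      by (intro mult_left_mono add_left_mono) auto
    with m.total_steps_le[OF K_bounds(1,2)] show ?thesis
      unfolding \<L> m.degree_const_def by linarith
  qed
  ultimately show ?thesis
    by blast
qed

end
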